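(* Consider the (regularized) Euler problem of two fixed centers, the Earth $E=(-1/2,0)$ and the Moon $M=(1/2,0)$, with mass ratio $\mu\in(0,1/2]$. Put $c_J=-1-2\sqrt{\mu(1-\mu)}$, $c_e=-1$, $c_h=-(1-2\mu)$. The following do not depend on the choice of the mass ratio: (i) For each $c\in(c_J,c_h)$, the hyperbolic orbit $\gamma^{\mathrm{hyp}}$ of energy $c$ admits homoclinics which collide with either the Earth or Moon. Moreover, all non-collision homoclinic orbits to $\gamma^{\mathrm{hyp}}$ rotate around one of the primaries precisely once. (ii) Fix $c\in(c_e,0)$ and consider the double-collision orbit $\gamma^{\mathrm{dou}}$ of energy $c$. All homoclinic orbits to $\gamma^{\mathrm{dou}}$ rotate around $\gamma^{\mathrm{dou}}$. No homoclinics to $\gamma^{\mathrm{dou}}$ admit collisions. (iii) Let $\gamma^{\mathrm{ext}}_M$ be the exterior collision orbit near the Moon for a fixed energy $c\in(c_h,0)$ and $\mu\neq 1/2$. It admits homoclinics which collide with the Earth. No homoclinics to it can collide with the Moon. Furthermore, any non-collision homoclinic to $\gamma^{\mathrm{ext}}_M$ rotates around the Earth precisely once.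
   Context: **The system.** The Euler problem describes a point-mass (the satellite) moving in the plane under the Newtonian attraction of two fixed points, the primaries $E$ (Earth) and $M$ (Moon). It is the Hamiltonian system on $T^*(\mathbb{R}^2\setminus\{E,M\})$ with $$H(q,p)=\tfrac12|p|^2-\frac{1-\mu}{|q-E|}-\frac{\mu}{|q-M|}.$$ Only negative energies $H=c<0$ are considered; the satellite is then confined to the bounded region $\mathcal K_c=\pi(H^{-1}(c))$, $\pi(q,p)=q$ (the Hill's region). The number $c_J$ is the energy of the unique critical point of $H$. **Regularization.** Doubly-covered elliptic coordinates $(\lambda,\nu)\in\mathbb{R}\times(\mathbb{R}/2\pi\mathbb{Z})$ are given by $\cosh\lambda=|q-E|+|q-M|$, $\cos\nu=|q-E|-|q-M|$, i.e. $q=(\tfrac12\cosh\lambda\cos\nu,\tfrac12\sinh\lambda\sin\nu)$, a 2-to-1 covering branched at $E$ and $M$; the momenta are determined by $p_1dq_1+p_2dq_2=p_\lambda d\lambda+p_\nu d\nu$. Points related by $(\lambda,\nu,p_\lambda,p_\nu)\mapsto(-\lambda,-\nu,-p_\lambda,-p_\nu)$ describe the same position and momentum $(q,p)$. For fixed $c$ put $$Q=(H-c)(\cosh^2\lambda-\cos^2\nu)=2p_\lambda^2-2\cosh\lambda-c\cosh^2\lambda+2p_\nu^2+2(1-2\mu)\cos\nu+c\cos^2\nu.$$ Orbits of $H$ of energy $c$ with time $t$ correspond to orbits of $Q$ of energy $0$ with time $\tau=\int dt/(\cosh^2\lambda-\cos^2\nu)$, and the flow of $Q$ on $Q^{-1}(0)$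 extends the motion through collisions. The system is assumed to be regularized in this way, so the satellite is allowed to pass through the primaries. An orbit collides with a primary if its projection to the $q$-plane passes through that primary; an orbit is non-collision if it collides with neither primary. **The periodic orbits of energy $c$** (each is an unstable periodic orbit in the energy range stated in the claim). - The hyperbolic orbit $\gamma^{\mathrm{hyp}}$: the satellite moves along the branch of hyperbola $|q-E|-|q-M|=-(1-2\mu)/c$, i.e. $\cos\nu=-(1-2\mu)/c$, within the Hill's region. - The double-collision orbit $\gamma^{\mathrm{dou}}$: the satellite moves along the line segment joining $E$ and $M$ (i.e. $\cosh\lambda=1$), through both primaries. - The exterior collision orbit near the Moon $\gamma^{\mathrm{ext}}_M$: the satellite moves along the ray $\cos\nu=1$, i.e. on $\{(q_1,0):q_1\ge 1/2\}$, between $M$ and the boundary of the Hill's region. **Homoclinic orbits.** A homoclinic orbit (homoclinic) to an unstable periodic orbit $\gamma$ is an orbit, other than $\gamma$ itself, which is asymptotic to $\gamma$ in both forward and backward time. **Rotation.** "Rotates around" is used in the ordinary geometric sense for the motion of $q$ in the plane. *)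

theory Defs
  imports "HOL-Analysis.Analysis"
begin

text \<open>The configuration plane is identified with \<^typ>\<open>complex\<close>, and a momentum \<open>(p\<^sub>1, p\<^sub>2)\<close> with
  \<open>p\<^sub>1 + \<i> p\<^sub>2\<close>.\<close>

definition earth :: complex where "earth = Complex (-1/2) 0"

definition moon :: complex where "moon = Complex (1/2) 0"

definition euler_H :: "real \<Rightarrow> complex \<Rightarrow> complex \<Rightarrow> real" where
  "euler_H \<mu> q p = (cmod p)\<^sup>2 / 2 - (1 - \<mu>) / cmod (q - earth) - \<mu> / cmod (q - moon)"

definition c_J :: "real \<Rightarrow> real" where "c_J \<mu> = -1 - 2 * sqrt (\<mu> * (1 - \<mu>))"

definition c_e :: real where "c_e = -1"

definition c_h :: "real \<Rightarrow> real" where "c_h \<mu> = - (1 - 2 * \<mu>)"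


subsection \<open>Regularized system\<close>

text \<open>A state is \<open>(\<lambda>, \<nu>, p\<^sub>\<lambda>, p\<^sub>\<nu>)\<close>. The angle \<open>\<nu>\<close> is represented by a real number; the
  identification modulo \<open>2\<pi>\<close> is part of \<open>same_state\<close> below.\<close>

type_synonym state = "real \<times> real \<times> real \<times> real"

definition elliptic :: "real \<Rightarrow> real \<Rightarrow> complex" where
  "elliptic l \<nu> = Complex (cosh l * cos \<nu> / 2) (sinh l * sin \<nu> / 2)"

definition euler_Q :: "real \<Rightarrow> real \<Rightarrow> real \<Rightarrow> real \<Rightarrow> real \<Rightarrow> real \<Rightarrow> real" where
  "euler_Q \<mu> c l \<nu> pl p\<nu> =
     2 * pl\<^sup>2 - 2 * cosh l - c * (cosh l)\<^sup>2 + 2 * p\<nu>\<^sup>2 + 2 * (1 - 2 * \<mu>) * cos \<nu> + c * (cos \<nu>)\<^sup>2"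

lemma elliptic_dist_earth: "cmod (elliptic l \<nu> - earth) = (cosh l + cos \<nu>) / 2"
proof -
  have s: "(sinh l)\<^sup>2 = (cosh l)\<^sup>2 - 1" "(sin \<nu>)\<^sup>2 = 1 - (cos \<nu>)\<^sup>2"
    by (simp_all add: cosh_square_eq sin_squared_eq)
  have "(cosh l * cos \<nu> / 2 + 1 / 2)\<^sup>2 + (sinh l * sin \<nu> / 2)\<^sup>2 = ((cosh l + cos \<nu>) / 2)\<^sup>2"
    by (simp add: power_mult_distrib power_divide s) (simp add: field_simps power2_eq_square)
  moreover have "0 \<le> cosh l + cos \<nu>"
    using cosh_real_ge_1[of l] cos_ge_minus_one[of \<nu>] by linarith
  ultimately show ?thesis
    by (simp add: elliptic_def earth_def cmod_def)
qed

lemma elliptic_dist_moon: "cmod (elliptic l \<nu> - moon) = (cosh l - cos \<nu>) / 2"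
proof -
  have s: "(sinh l)\<^sup>2 = (cosh l)\<^sup>2 - 1" "(sin \<nu>)\<^sup>2 = 1 - (cos \<nu>)\<^sup>2"
    by (simp_all add: cosh_square_eq sin_squared_eq)
  have "(cosh l * cos \<nu> / 2 - 1 / 2)\<^sup>2 + (sinh l * sin \<nu> / 2)\<^sup>2 = ((cosh l - cos \<nu>) / 2)\<^sup>2"
    by (simp add: power_mult_distrib power_divide s) (simp add: field_simps power2_eq_square)
  moreover have "0 \<le> cosh l - cos \<nu>"
    using cosh_real_ge_1[of l] cos_le_one[of \<nu>] by linarith
  ultimately show ?thesis
    by (simp add: elliptic_def moon_def cmod_def)
qed

text \<open>Away from the primaries \<open>euler_Q\<close> is \<open>(H - c) (cosh\<^sup>2 \<lambda> - cos\<^sup>2 \<nu>)\<close>; the two momentum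
  hypotheses say \<open>p\<^sub>1 dq\<^sub>1 + p\<^sub>2 dq\<^sub>2 = p\<^sub>\<lambda> d\<lambda> + p\<^sub>\<nu> d\<nu>\<close>.\<close>

lemma euler_Q_eq:
  assumes "elliptic l \<nu> \<noteq> earth" "elliptic l \<nu> \<noteq> moon"
    and "pl = Re p * (sinh l * cos \<nu> / 2) + Im p * (cosh l * sin \<nu> / 2)"
    and "p\<nu> = Re p * (- cosh l * sin \<nu> / 2) + Im p * (sinh l * cos \<nu> / 2)"
  shows "euler_Q \<mu> c l \<nu> pl p\<nu> = (euler_H \<mu> (elliptic l \<nu>) p - c) * ((cosh l)\<^sup>2 - (cos \<nu>)\<^sup>2)"
proof -
  have "cmod (elliptic l \<nu> - earth) > 0" "cmod (elliptic l \<nu> - moon) > 0"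
    using assms by auto
  then have pos: "cosh l + cos \<nu> \<noteq> 0" "cosh l - cos \<nu> \<noteq> 0"
    by (auto simp: elliptic_dist_earth elliptic_dist_moon)
  have s: "(sinh l)\<^sup>2 = (cosh l)\<^sup>2 - 1" "(sin \<nu>)\<^sup>2 = 1 - (cos \<nu>)\<^sup>2"
    by (simp_all add: cosh_square_eq sin_squared_eq)
  have "pl\<^sup>2 + p\<nu>\<^sup>2 = ((Re p)\<^sup>2 + (Im p)\<^sup>2) *
      ((sinh l)\<^sup>2 * (cos \<nu>)\<^sup>2 + (cosh l)\<^sup>2 * (sin \<nu>)\<^sup>2) / 4"
    unfolding assms(3,4) by (simp add: power2_eq_square field_simps)
  also have "\<dots> = (cmod p)\<^sup>2 * ((cosh l)\<^sup>2 - (cos \<nu>)\<^sup>2) / 4"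
    by (simp add: s cmod_power2) (simp add: algebra_simps)
  finally have kin: "2 * pl\<^sup>2 + 2 * p\<nu>\<^sup>2 = (cmod p)\<^sup>2 / 2 * ((cosh l)\<^sup>2 - (cos \<nu>)\<^sup>2)"
    by simp
  have fac: "(cosh l)\<^sup>2 - (cos \<nu>)\<^sup>2 = (cosh l + cos \<nu>) * (cosh l - cos \<nu>)"
    by (simp add: power2_eq_square algebra_simps)
  have "(1 - \<mu>) / cmod (elliptic l \<nu> - earth) * ((cosh l)\<^sup>2 - (cos \<nu>)\<^sup>2)
      = 2 * (1 - \<mu>) * (cosh l - cos \<nu>)"
    using pos unfolding elliptic_dist_earth fac by simp
  moreover have "\<mu> / cmod (elliptic l \<nu> - moon) * ((cosh l)\<^sup>2 - (cos \<nu>)\<^sup>2)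
      = 2 * \<mu> * (cosh l + cos \<nu>)"
    using pos unfolding elliptic_dist_moon fac by simp
  ultimately show ?thesis
    unfolding euler_H_def euler_Q_def left_diff_distrib using kin by (simp add: algebra_simps)
qed

definition regularized_orbit :: "real \<Rightarrow> real \<Rightarrow> (real \<Rightarrow> state) \<Rightarrow> bool" where
  "regularized_orbit \<mu> c x \<longleftrightarrow>
     (\<exists>l \<nu> pl p\<nu>. x = (\<lambda>\<tau>. (l \<tau>, \<nu> \<tau>, pl \<tau>, p\<nu> \<tau>)) \<and>
       (\<forall>\<tau>. euler_Q \<mu> c (l \<tau>) (\<nu> \<tau>) (pl \<tau>) (p\<nu> \<tau>) = 0 \<and>
         (l has_real_derivative deriv (\<lambda>y. euler_Q \<mu> c (l \<tau>) (\<nu> \<tau>) y (p\<nu> \<tau>)) (pl \<tau>)) (at \<tau>) \<and>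
         (\<nu> has_real_derivative deriv (\<lambda>y. euler_Q \<mu> c (l \<tau>) (\<nu> \<tau>) (pl \<tau>) y) (p\<nu> \<tau>)) (at \<tau>) \<and>
         (pl has_real_derivative - deriv (\<lambda>y. euler_Q \<mu> c y (\<nu> \<tau>) (pl \<tau>) (p\<nu> \<tau>)) (l \<tau>)) (at \<tau>) \<and>
         (p\<nu> has_real_derivative - deriv (\<lambda>y. euler_Q \<mu> c (l \<tau>) y (pl \<tau>) (p\<nu> \<tau>)) (\<nu> \<tau>)) (at \<tau>)))"

definition position :: "state \<Rightarrow> complex" where
  "position = (\<lambda>(l, \<nu>, pl, p\<nu>). elliptic l \<nu>)"

definition same_state :: "state \<Rightarrow> state \<Rightarrow> bool" where
  "same_state = (\<lambda>(l, \<nu>, pl, p\<nu>) w. \<exists>k::int.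
     w = (l, \<nu> + 2 * pi * of_int k, pl, p\<nu>) \<or> w = (- l, - \<nu> + 2 * pi * of_int k, - pl, - p\<nu>))"

text \<open>All representatives of the states on an orbit. An orbit of the problem is determined by this
  set; distinct lifts to the double cover, and time shifts, give the same set.\<close>

definition orbit_set :: "(real \<Rightarrow> state) \<Rightarrow> state set" where
  "orbit_set x = {w. \<exists>\<tau>. same_state (x \<tau>) w}"

definition collides :: "(real \<Rightarrow> state) \<Rightarrow> complex \<Rightarrow> bool" where
  "collides x P \<longleftrightarrow> (\<exists>\<tau>. position (x \<tau>) = P)"

definition non_collision :: "(real \<Rightarrow> state) \<Rightarrow> bool" where
  "non_collision x \<longleftrightarrow> \<not> collides x earth \<and> \<not> collides x moon"


subsection \<open>The periodic orbits and their homoclinics\<close>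

definition hyperbolic_orbit :: "real \<Rightarrow> real \<Rightarrow> (real \<Rightarrow> state) \<Rightarrow> bool" where
  "hyperbolic_orbit \<mu> c \<gamma> \<longleftrightarrow> regularized_orbit \<mu> c \<gamma> \<and>
     (\<forall>\<tau>. cmod (position (\<gamma> \<tau>) - earth) - cmod (position (\<gamma> \<tau>) - moon) = - (1 - 2 * \<mu>) / c)"

definition double_collision_orbit :: "real \<Rightarrow> real \<Rightarrow> (real \<Rightarrow> state) \<Rightarrow> bool" where
  "double_collision_orbit \<mu> c \<gamma> \<longleftrightarrow> regularized_orbit \<mu> c \<gamma> \<and>
     (\<forall>\<tau>. position (\<gamma> \<tau>) \<in> closed_segment earth moon)"

definition exterior_collision_orbit_moon :: "real \<Rightarrow> real \<Rightarrow> (real \<Rightarrow> state) \<Rightarrow> bool" where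
  "exterior_collision_orbit_moon \<mu> c \<gamma> \<longleftrightarrow> regularized_orbit \<mu> c \<gamma> \<and>
     (\<forall>\<tau>. Im (position (\<gamma> \<tau>)) = 0 \<and> Re (position (\<gamma> \<tau>)) \<ge> 1/2)"

text \<open>Since \<open>orbit_set \<gamma>\<close> contains all representatives, \<open>infdist\<close> to it measures the distance in the
  quotient by \<open>same_state\<close>. In the double cover such an orbit may well connect different lifts of
  \<open>\<gamma>\<close>.\<close>

definition homoclinic :: "real \<Rightarrow> real \<Rightarrow> (real \<Rightarrow> state) \<Rightarrow> (real \<Rightarrow> state) \<Rightarrow> bool" where
  "homoclinic \<mu> c \<gamma> x \<longleftrightarrow> regularized_orbit \<mu> c x \<and> orbit_set x \<noteq> orbit_set \<gamma> \<and>
     ((\<lambda>\<tau>. infdist (x \<tau>) (orbit_set \<gamma>)) \<longlongrightarrow> 0) at_top \<and>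
     ((\<lambda>\<tau>. infdist (x \<tau>) (orbit_set \<gamma>)) \<longlongrightarrow> 0) at_bot"


subsection \<open>Rotation\<close>

definition polar_angle :: "complex \<Rightarrow> (real \<Rightarrow> complex) \<Rightarrow> (real \<Rightarrow> real) \<Rightarrow> bool" where
  "polar_angle P q \<theta> \<longleftrightarrow> continuous_on UNIV \<theta> \<and>
     (\<forall>\<tau>. q \<tau> \<noteq> P \<and> q \<tau> - P = of_real (cmod (q \<tau> - P)) * cis (\<theta> \<tau>))"

text \<open>The (signed) number of turns that \<open>x\<close> makes around \<open>P\<close> between leaving \<open>\<gamma>\<close> and returning to
  it. The angle \<open>\<theta>\<close> itself need not converge, since \<open>\<gamma>\<close> moves. Instead, in polar coordinates about
  \<open>P\<close> (with the angle in \<open>\<real>\<close>), \<open>x\<close> is asymptotic to a lift of the trace of \<open>\<gamma>\<close> in backward time and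
  to the lift shifted by \<open>2\<pi>n\<close> in forward time. This is used only for \<open>\<gamma>\<close> whose trace in the plane
  is an arc avoiding \<open>P\<close>, for which \<open>n\<close> is unique.\<close>

definition turns :: "complex \<Rightarrow> (real \<Rightarrow> state) \<Rightarrow> (real \<Rightarrow> state) \<Rightarrow> int \<Rightarrow> bool" where
  "turns P \<gamma> x n \<longleftrightarrow> (\<exists>\<theta> \<phi>.
     polar_angle P (position \<circ> x) \<theta> \<and> polar_angle P (position \<circ> \<gamma>) \<phi> \<and>
     ((\<lambda>\<tau>. infdist (position (x \<tau>), \<theta> \<tau>) (range (\<lambda>s. (position (\<gamma> s), \<phi> s)))) \<longlongrightarrow> 0) at_bot \<and>
     ((\<lambda>\<tau>. infdist (position (x \<tau>), \<theta> \<tau>)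
        (range (\<lambda>s. (position (\<gamma> s), \<phi> s + 2 * pi * of_int n)))) \<longlongrightarrow> 0) at_top)"

definition rotates_once :: "complex \<Rightarrow> (real \<Rightarrow> state) \<Rightarrow> (real \<Rightarrow> state) \<Rightarrow> bool" where
  "rotates_once P \<gamma> x \<longleftrightarrow> turns P \<gamma> x 1 \<or> turns P \<gamma> x (-1)"

text \<open>For an orbit \<open>\<gamma>\<close> around which \<open>x\<close> keeps turning for all time: seen from any point of
  \<open>\<gamma>\<close>, the polar angle of \<open>x\<close> runs through all of \<open>\<real>\<close> from one end to the other.\<close>

definition rotates_around_orbit :: "(real \<Rightarrow> state) \<Rightarrow> (real \<Rightarrow> state) \<Rightarrow> bool" where
  "rotates_around_orbit \<gamma> x \<longleftrightarrow> (\<forall>s. \<exists>\<theta>. polar_angle (position (\<gamma> s)) (position \<circ> x) \<theta> \<and>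
     (filterlim \<theta> at_top at_top \<and> filterlim \<theta> at_bot at_bot \<or>
      filterlim \<theta> at_bot at_top \<and> filterlim \<theta> at_top at_bot))"

end

theory Submission
  imports Defs
begin

text \<open>In elliptic coordinates the regularized Hamiltonian splits as \<open>E\<^sub>l + E\<^sub>\<nu>\<close>, so that \<open>E\<^sub>l = G\<close> and
  \<open>E\<^sub>\<nu> = - G\<close> are conserved, and a homoclinic orbit has the same \<open>G\<close> as the orbit it is asymptotic to.
  For the hyperbolic and the exterior orbit, \<open>\<nu>\<close> rests at a saddle and \<open>\<lambda>\<close> oscillates through \<open>0\<close>;
  the homoclinics are the products of the same \<open>\<lambda>\<close> oscillation with a separatrix of the \<open>\<nu>\<close> motion,
  whose ends are identified by \<open>(\<lambda>, \<nu>) \<mapsto> (-\<lambda>, -\<nu>)\<close> modulo \<open>2\<pi>\<close>. The separatrix crosses \<open>\<nu> = 0\<close>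
  or \<open>\<nu> = \<pi>\<close> exactly once; the orbit collides there if \<open>\<lambda> = 0\<close>, and otherwise makes one turn about the
  primary. For the double-collision orbit the roles are exchanged: \<open>\<lambda>\<close> rests at the saddle \<open>0\<close>,
  \<open>\<lambda> \<noteq> 0\<close> along any homoclinic, and \<open>\<nu>\<close> is monotone and unbounded, which makes the orbit turn
  forever around the segment of the primaries.\<close>

section \<open>Mechanical systems with one degree of freedom\<close>

text \<open>The definition of a homoclinic only controls a distance to
  \<open>orbit_set \<gamma>\<close> and says nothing about phases. It becomes tractable because the
  \<lambda> oscillation runs through its whole energy level: all \<lambda> motions with the same G
  are time shifts of one another. For an orbit at rest in \<nu>, \<open>orbit_set \<gamma>\<close>
  is therefore a full product, any \<lambda> phase may be combined with a \<nu> separatrix, and the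
  phase with \<lambda> = 0 at the instant when \<nu> is 0 or \<pi> produces the collisions. The
  recurring condition \<open>G + 2 + c > 0\<close> says that the kinetic term 2 p^2 is positive at
  \<lambda> = 0.

  Solutions are built from closed forms or by inverting a travel time. The explicit separatrices
  serve existence; for an arbitrary homoclinic the limits of \<nu> are read off from energy
  conservation.

  Turns are counted through a square root of position minus primary. With a suitable global sign the
  root passes from one half plane to the other across the positive axis, so its Arg is continuous
  and gains half a turn; doubling gives one full turn.\<close>

definition motion :: "(real \<Rightarrow> real) \<Rightarrow> (real \<Rightarrow> real) \<Rightarrow> (real \<Rightarrow> real) \<Rightarrow> bool" where
  "motion W x p \<longleftrightarrow> (\<forall>t. (x has_real_derivative 4 * p t) (at t) \<and>
     (p has_real_derivative W (x t)) (at t))"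

lemma motionD:
  assumes "motion W x p"
  shows "(x has_real_derivative 4 * p t) (at t)" "(p has_real_derivative W (x t)) (at t)"
    "isCont x t" "isCont p t" "continuous_on S x" "continuous_on S p"
  using assms unfolding motion_def
  by (auto intro!: DERIV_isCont continuous_at_imp_continuous_on)

lemma motion_shift:
  assumes "motion W x p"
  shows "motion W (\<lambda>t. x (t + s)) (\<lambda>t. p (t + s))"
  using assms unfolding motion_def by (metis DERIV_shift)

lemma motion_const: "W e = 0 \<Longrightarrow> motion W (\<lambda>_. e) (\<lambda>_. 0)"
  by (simp add: motion_def)

section \<open>Uniqueness of solutions\<close>

text \<open>The weights exp (- K t) after \<open>t0\<close> and exp (K t) before it turn the bound
  on \<open>e'\<close> into monotonicity, so the value 0 at \<open>t0\<close> bounds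
  \<open>e\<close> from above on both sides.\<close>

lemma gronwall_zero:
  fixes e e' :: "real \<Rightarrow> real"
  assumes d: "\<And>t. (e has_real_derivative e' t) (at t)"
    and nn: "\<And>t. 0 \<le> e t" and b: "\<And>t. \<bar>e' t\<bar> \<le> K * e t" and z: "e t0 = 0"
  shows "e t = 0"
proof (cases "t0 \<le> t")
  case True
  have "e t0 * exp (- K * t0) \<ge> e t * exp (- K * t)"
  proof (rule DERIV_nonpos_imp_nonincreasing[OF True])
    fix s
    have "((\<lambda>t. e t * exp (- K * t)) has_real_derivative (e' s - K * e s) * exp (- K * s)) (at s)"
      by (auto intro!: derivative_eq_intros d simp: algebra_simps)
    moreover have "(e' s - K * e s) * exp (- K * s) \<le> 0"
      using b[of s] by (intro mult_nonpos_nonneg) auto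
    ultimately show "\<exists>y. ((\<lambda>t. e t * exp (- K * t)) has_real_derivative y) (at s) \<and> y \<le> 0"
      by blast
  qed
  then show ?thesis
    using z nn[of t] by (simp add: mult_le_0_iff)
next
  case False
  then have "t \<le> t0" by simp
  then have "e t * exp (K * t) \<le> e t0 * exp (K * t0)"
  proof (rule DERIV_nonneg_imp_nondecreasing)
    fix s
    have "((\<lambda>t. e t * exp (K * t)) has_real_derivative (e' s + K * e s) * exp (K * s)) (at s)"
      by (auto intro!: derivative_eq_intros d simp: algebra_simps)
    moreover have "(e' s + K * e s) * exp (K * s) \<ge> 0"
      using b[of s] by (intro mult_nonneg_nonneg) auto
    ultimately show "\<exists>y. ((\<lambda>t. e t * exp (K * t)) has_real_derivative y) (at s) \<and> y \<ge> 0"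
      by blast
  qed
  then show ?thesis
    using z nn[of t] by (simp add: mult_le_0_iff)
qed

text \<open>Gronwall for the squared distance of the two phase curves. The Lipschitz bound is asked
  only along these curves because \<open>W\<^sub>l\<close> grows exponentially and has no global
  one.\<close>

lemma motion_unique:
  assumes 1: "motion W x p" and 2: "motion W y q"
    and lip: "\<And>t. \<bar>W (x t) - W (y t)\<bar> \<le> K * \<bar>x t - y t\<bar>"
    and init: "x t0 = y t0" "p t0 = q t0"
  shows "x = y" "p = q"
proof -
  define e where "e = (\<lambda>t. (x t - y t)\<^sup>2 + (p t - q t)\<^sup>2)"
  define e' where "e' = (\<lambda>t. 8 * (x t - y t) * (p t - q t) + 2 * (p t - q t) * (W (x t) - W (y t)))"
  have d: "(e has_real_derivative e' t) (at t)" for t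
    unfolding e_def e'_def
    by (auto intro!: derivative_eq_intros motionD[OF 1] motionD[OF 2] simp: algebra_simps)
  have b: "\<bar>e' t\<bar> \<le> (4 + \<bar>K\<bar>) * e t" for t
  proof -
    let ?a = "\<bar>x t - y t\<bar>" and ?b = "\<bar>p t - q t\<bar>"
    have "\<bar>e' t\<bar> \<le> 8 * ?a * ?b + 2 * ?b * \<bar>W (x t) - W (y t)\<bar>"
      unfolding e'_def by (rule order_trans[OF abs_triangle_ineq]) (simp only: abs_mult abs_numeral order_refl)
    also have "\<bar>W (x t) - W (y t)\<bar> \<le> \<bar>K\<bar> * ?a"
      using lip[of t] by (rule order_trans) (simp add: mult_right_mono)
    also have "8 * ?a * ?b + 2 * ?b * (\<bar>K\<bar> * ?a) = (4 + \<bar>K\<bar>) * (2 * ?a * ?b)"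
      by (simp add: algebra_simps)
    also have "\<dots> \<le> (4 + \<bar>K\<bar>) * (?a\<^sup>2 + ?b\<^sup>2)"
      by (intro mult_left_mono sum_squares_bound) simp
    finally show ?thesis by (simp add: e_def mult_left_mono)
  qed
  have "e t = 0" for t
  proof (rule gronwall_zero[OF d _ b])
    show "0 \<le> e t" for t by (simp add: e_def)
    show "e t0 = 0" by (simp add: e_def init)
  qed
  then show "x = y" "p = q"
    by (auto simp: e_def sum_power2_eq_zero_iff fun_eq_iff)
qed

section \<open>Monotone motions and their limits\<close>

lemma nonzero_continuous_sign:
  fixes f :: "real \<Rightarrow> real"
  assumes "continuous_on UNIV f" "\<And>t. f t \<noteq> 0"
  shows "(\<forall>t. f t > 0) \<or> (\<forall>t. f t < 0)"
proof (rule ccontr)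
  assume "\<not> ?thesis"
  then obtain s t where "f s < 0" "f t > 0"
    by (metis assms(2) linorder_neqE_linordered_idom)
  moreover have "connected (range f)"
    using assms(1) by (intro connected_continuous_image) auto
  ultimately have "0 \<in> range f"
    using connected_contains_Icc[of "range f" "f s" "f t"] by auto
  then show False using assms(2) by auto
qed

lemma filterlim_deriv_ge:
  fixes x :: "real \<Rightarrow> real"
  assumes d: "\<And>t. (x has_real_derivative v t) (at t)" and v: "\<And>t. v t \<ge> \<delta>" and "\<delta> > 0"
  shows "filterlim x at_top at_top" "filterlim x at_bot at_bot"
proof -
  have m: "x s - \<delta> * s \<le> x t - \<delta> * t" if "s \<le> t" for s t
    using that
  proof (rule DERIV_nonneg_imp_nondecreasing)
    fix r
    have "((\<lambda>t. x t - \<delta> * t) has_real_derivative v r - \<delta>) (at r)"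
      by (auto intro!: derivative_eq_intros d)
    then show "\<exists>y. ((\<lambda>t. x t - \<delta> * t) has_real_derivative y) (at r) \<and> 0 \<le> y"
      using v[of r] by (intro exI[of _ "v r - \<delta>"]) auto
  qed
  have "filterlim (\<lambda>t. x 0 + \<delta> * t) at_top at_top"
    using \<open>\<delta> > 0\<close>
    by (intro filterlim_tendsto_add_at_top[OF tendsto_const]
        filterlim_tendsto_pos_mult_at_top[OF tendsto_const] filterlim_ident) auto
  then show "filterlim x at_top at_top"
    by (rule filterlim_at_top_mono)
      (use m[of 0] in \<open>auto simp: eventually_at_top_linorder algebra_simps intro!: exI[of _ 0]\<close>)
  show "filterlim x at_bot at_bot"
    unfolding filterlim_at_bot eventually_at_bot_linorder
  proof (intro allI exI impI)
    fix Z t assume t: "t \<le> min 0 ((Z - x 0) / \<delta>)"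
    then have "\<delta> * t \<le> Z - x 0"
      using \<open>\<delta> > 0\<close> by (simp add: field_simps)
    then show "x t \<le> Z" using m[of t 0] t by simp
  qed
qed

text \<open>If \<open>x\<close> stopped short of \<open>e2\<close>, \<open>F\<close> would have a
  positive minimum on the compact range left to it, and a speed bounded below leaves that range in
  finite time. Positivity is asked only on the open interval, so \<open>F\<close> may vanish at the
  ends, as it does for a separatrix.\<close>

lemma tendsto_upper_endpoint:
  fixes x v :: "real \<Rightarrow> real"
  assumes d: "\<And>t. (x has_real_derivative v t) (at t)" and v: "\<And>t. 0 < v t"
    and F: "\<And>t. (v t)\<^sup>2 = F (x t)" and cF: "continuous_on UNIV F"
    and pos: "\<And>y. e1 < y \<Longrightarrow> y < e2 \<Longrightarrow> 0 < F y"
    and x: "\<And>t. e1 < x t \<and> x t < e2"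
  shows "(x \<longlongrightarrow> e2) at_top"
proof (rule order_tendstoI)
  show "\<forall>\<^sub>F t in at_top. x t < a" if "e2 < a" for a
    by (rule always_eventually) (use x that less_trans in blast)
  have mono: "x s \<le> x t" if "s \<le> t" for s t
    by (rule DERIV_nonneg_imp_nondecreasing[OF that]) (meson d v less_imp_le)
  fix a assume "a < e2"
  have "\<exists>t. a < x t"
  proof (rule ccontr)
    assume "\<not> ?thesis"
    then have le: "x t \<le> a" for t by (simp add: not_less)
    define I where "I = {x 0..a}"
    have "compact I" "I \<noteq> {}" "continuous_on I F"
      using le cF by (auto simp: I_def intro: continuous_on_subset)
    then obtain y where y: "y \<in> I" "\<And>z. z \<in> I \<Longrightarrow> F y \<le> F z"
      using continuous_attains_inf[of I F] by blast
    have "0 < F y" using y(1) x[of 0] \<open>a < e2\<close> by (intro pos) (auto simp: I_def)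
    have "v t \<ge> sqrt (F y)" if "t \<ge> 0" for t
    proof -
      have "F y \<le> (v t)\<^sup>2" using mono[OF that] le F by (auto simp: I_def intro!: y(2))
      then show ?thesis using v[of t] by (simp add: real_le_lsqrt)
    qed
    then have g: "x 0 + sqrt (F y) * t \<le> x t" if "t \<ge> 0" for t
    proof -
      have "x 0 - sqrt (F y) * 0 \<le> x t - sqrt (F y) * t"
      proof (rule DERIV_nonneg_imp_nondecreasing[OF that])
        fix r :: real assume "0 \<le> r"
        then show "\<exists>z. ((\<lambda>t. x t - sqrt (F y) * t) has_real_derivative z) (at r) \<and> 0 \<le> z"
          using \<open>\<And>t. t \<ge> 0 \<Longrightarrow> v t \<ge> sqrt (F y)\<close>
          by (intro exI[of _ "v r - sqrt (F y)"]) (auto intro!: derivative_eq_intros d)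
      qed
      then show ?thesis by simp
    qed
    have s: "sqrt (F y) > 0" using \<open>0 < F y\<close> by simp
    \<comment> \<open>At this time the linear lower bound has reached \<open>a + 1\<close>.\<close>
    have "x 0 + sqrt (F y) * ((a - x 0 + 1) / sqrt (F y)) \<le> x ((a - x 0 + 1) / sqrt (F y))"
      using s le[of 0] by (intro g) auto
    then show False using s le[of "(a - x 0 + 1) / sqrt (F y)"] by simp
  qed
  then obtain t where "a < x t" ..
  then show "\<forall>\<^sub>F t in at_top. a < x t"
    using mono by (auto simp: eventually_at_top_linorder intro!: exI[of _ t] elim: less_le_trans)
qed

text \<open>The momentum keeps its sign, and every limit is an upper endpoint limit after reflecting
  space, time or both.\<close>

lemma separatrix_tendsto:
  assumes m: "motion W x p" and F: "\<And>t. (4 * p t)\<^sup>2 = F (x t)" and cF: "continuous_on UNIV F"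
    and pos: "\<And>y. e1 < y \<Longrightarrow> y < e2 \<Longrightarrow> 0 < F y"
    and x: "\<And>t. e1 < x t \<and> x t < e2"
  shows "(x \<longlongrightarrow> e2) at_top \<and> (x \<longlongrightarrow> e1) at_bot \<or> (x \<longlongrightarrow> e1) at_top \<and> (x \<longlongrightarrow> e2) at_bot"
proof -
  note d = motionD(1)[OF m]
  have cF': "continuous_on UNIV (\<lambda>y. F (- y))"
    by (intro continuous_on_compose2[OF cF] continuous_intros) auto
  have d': "((\<lambda>t. x (- t)) has_real_derivative - (4 * p (- t))) (at t)" for t
    using DERIV_mirror[THEN iffD1, OF d[of "- t"]] by simp
  have "p t \<noteq> 0" for t using F[of t] pos[of "x t"] x[of t] by auto
  then consider "\<forall>t. p t > 0" | "\<forall>t. p t < 0"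
    using nonzero_continuous_sign[of p] motionD[OF m] by blast
  then show ?thesis
  proof cases
    case 1
    have "(x \<longlongrightarrow> e2) at_top"
      by (rule tendsto_upper_endpoint[OF d _ F cF pos x]) (use 1 in auto)
    moreover have "((\<lambda>t. - x (- t)) \<longlongrightarrow> - e1) at_top"
      by (rule tendsto_upper_endpoint[where v = "\<lambda>t. 4 * p (- t)" and ?e1.0 = "- e2", OF _ _ _ cF'])
        (use 1 F pos x in \<open>auto intro!: derivative_eq_intros d'\<close>)
    ultimately show ?thesis
      by (auto simp: filterlim_at_bot_mirror dest: tendsto_minus)
  next
    case 2
    have "((\<lambda>t. - x t) \<longlongrightarrow> - e1) at_top"
      by (rule tendsto_upper_endpoint[where v = "\<lambda>t. - (4 * p t)" and ?e1.0 = "- e2", OF _ _ _ cF'])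
        (use 2 F pos x in \<open>auto intro!: derivative_eq_intros d\<close>)
    moreover have "((\<lambda>t. x (- t)) \<longlongrightarrow> e2) at_top"
      by (rule tendsto_upper_endpoint[OF d' _ _ cF pos])
        (use 2 F x in auto)
    ultimately show ?thesis
      by (auto simp: filterlim_at_bot_mirror dest: tendsto_minus)
  qed
qed

lemma stays_between:
  fixes x :: "real \<Rightarrow> real"
  assumes "continuous_on UNIV x" "\<And>t. x t \<noteq> e1" "\<And>t. x t \<noteq> e2" "e1 < x 0" "x 0 < e2"
  shows "e1 < x t \<and> x t < e2"
proof -
  have "(\<forall>t. x t - e1 > 0) \<or> (\<forall>t. x t - e1 < 0)"
    using assms(2) by (intro nonzero_continuous_sign continuous_intros assms(1)) simp
  moreover have "(\<forall>t. x t - e2 > 0) \<or> (\<forall>t. x t - e2 < 0)"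
    using assms(3) by (intro nonzero_continuous_sign continuous_intros assms(1)) simp
  ultimately have "\<forall>t. x t - e1 > 0" "\<forall>t. x t - e2 < 0"
    using assms(4,5) by (meson diff_gt_0_iff_gt diff_less_0_iff_less less_asym)+
  then show ?thesis by simp
qed

text \<open>The solution is the inverse of the travel time T with T' = 1 / g. The upper bound on
  \<open>g\<close> gives T' >= 1 / M, so T is onto and the solution lives for all time; that T is
  defined everywhere makes the solution onto.\<close>

lemma autonomous_ode_surj:
  fixes g :: "real \<Rightarrow> real"
  assumes cg: "continuous_on UNIV g" and pos: "\<And>y. 0 < g y" and bd: "\<And>y. g y \<le> M"
  obtains \<psi> where "\<And>t. (\<psi> has_real_derivative g (\<psi> t)) (at t)" "surj \<psi>"
proof -
  have cinv: "isCont (\<lambda>y. 1 / g y) y" for y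
  proof (rule isCont_divide[OF continuous_const])
    show "isCont g y" using cg by (simp add: continuous_on_eq_continuous_at)
    show "g y \<noteq> 0" using pos[of y] by linarith
  qed
  obtain T where T: "\<And>y. (T has_real_derivative 1 / g y) (at y)"
  proof -
    have "\<exists>T. \<forall>y::real. -\<infinity> < ereal y \<longrightarrow> ereal y < \<infinity> \<longrightarrow> (T has_vector_derivative 1 / g y) (at y)"
      by (rule einterval_antiderivative) (simp, rule cinv)
    then show ?thesis
      using that unfolding has_real_derivative_iff_has_vector_derivative by simp metis
  qed
  have M: "M > 0" using pos[of 0] bd[of 0] by linarith
  have "1 / g y \<ge> 1 / M" for y
    using pos[of y] bd[of y] by (simp add: frac_le)
  then have lim: "filterlim T at_top at_top" "filterlim T at_bot at_bot"
    using filterlim_deriv_ge[OF T, of "1 / M"] M by auto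
  have cT: "continuous_on UNIV T" "isCont T y" for y
    by (intro continuous_at_imp_continuous_on ballI DERIV_isCont[OF T] | rule DERIV_isCont[OF T])+
  have inc: "T y < T z" if "y < z" for y z
    using that by (rule DERIV_pos_imp_increasing) (meson T pos zero_less_divide_1_iff)
  have surjT: "\<exists>y. T y = t" for t
  proof -
    obtain a b where "T a \<le> t" "t \<le> T b"
      using lim unfolding filterlim_at_top filterlim_at_bot
      by (metis eventually_at_top_linorder eventually_at_bot_linorder order_refl)
    moreover have "connected (range T)" using cT(1) by (intro connected_continuous_image) auto
    ultimately have "t \<in> range T"
      using connected_contains_Icc[of "range T" "T a" "T b"] by auto
    then show ?thesis by auto
  qed
  define \<psi> where "\<psi> = inv T"
  have injT: "inj T" using inc by (metis injI linorder_neqE_linordered_idom less_irrefl)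
  have T\<psi>: "T (\<psi> t) = t" for t
    unfolding \<psi>_def using surjT[of t] by (metis f_inv_into_f rangeI)
  have \<psi>T: "\<psi> (T y) = y" for y unfolding \<psi>_def using injT by simp
  have c\<psi>: "isCont \<psi> t" for t
    using isCont_inverse_function[of 1 "\<psi> t" \<psi> T] \<psi>T cT(2) by (simp only: T\<psi> zero_less_one simp_thms)
  have "(\<psi> has_real_derivative g (\<psi> t)) (at t)" for t
    using DERIV_inverse_function[where f = T and g = \<psi> and x = t and a = "t - 1" and b = "t + 1",
        OF T _ _ _ T\<psi> c\<psi>] pos[of "\<psi> t"] by simp
  moreover have "surj \<psi>" using \<psi>T by (metis surjI)
  ultimately show ?thesis using that by blast
qed

section \<open>Separation of variables\<close>

text \<open>\<open>W\<^sub>l\<close> and \<open>W\<^sub>\<nu>\<close> are forces: minus the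
  derivatives of the potential parts of \<open>E\<^sub>l\<close> and
  \<open>E\<^sub>\<nu>\<close>.\<close>

definition W\<^sub>l :: "real \<Rightarrow> real \<Rightarrow> real" where
  "W\<^sub>l c l = 2 * sinh l + 2 * c * cosh l * sinh l"

definition W\<^sub>\<nu> :: "real \<Rightarrow> real \<Rightarrow> real \<Rightarrow> real" where
  "W\<^sub>\<nu> \<mu> c \<nu> = 2 * (1 - 2 * \<mu>) * sin \<nu> + 2 * c * cos \<nu> * sin \<nu>"

definition E\<^sub>l :: "real \<Rightarrow> real \<Rightarrow> real \<Rightarrow> real" where
  "E\<^sub>l c l p = 2 * p\<^sup>2 - 2 * cosh l - c * (cosh l)\<^sup>2"

definition E\<^sub>\<nu> :: "real \<Rightarrow> real \<Rightarrow> real \<Rightarrow> real \<Rightarrow> real" where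
  "E\<^sub>\<nu> \<mu> c \<nu> p = 2 * p\<^sup>2 + 2 * (1 - 2 * \<mu>) * cos \<nu> + c * (cos \<nu>)\<^sup>2"

lemma euler_Q_split: "euler_Q \<mu> c l \<nu> pl p\<nu> = E\<^sub>l c l pl + E\<^sub>\<nu> \<mu> c \<nu> p\<nu>"
  by (simp add: euler_Q_def E\<^sub>l_def E\<^sub>\<nu>_def)

lemma regularized_orbit_iff:
  "regularized_orbit \<mu> c x \<longleftrightarrow> (\<exists>l \<nu> pl p\<nu>. x = (\<lambda>\<tau>. (l \<tau>, \<nu> \<tau>, pl \<tau>, p\<nu> \<tau>)) \<and>
     (\<forall>\<tau>. E\<^sub>l c (l \<tau>) (pl \<tau>) + E\<^sub>\<nu> \<mu> c (\<nu> \<tau>) (p\<nu> \<tau>) = 0) \<and>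
     motion (W\<^sub>l c) l pl \<and> motion (W\<^sub>\<nu> \<mu> c) \<nu> p\<nu>)"
proof -
  have "deriv (\<lambda>y. euler_Q \<mu> c l \<nu> y p\<nu>) pl = 4 * pl"
    "deriv (\<lambda>y. euler_Q \<mu> c l \<nu> pl y) p\<nu> = 4 * p\<nu>"
    "deriv (\<lambda>y. euler_Q \<mu> c y \<nu> pl p\<nu>) l = - W\<^sub>l c l"
    "deriv (\<lambda>y. euler_Q \<mu> c l y pl p\<nu>) \<nu> = - W\<^sub>\<nu> \<mu> c \<nu>" for l \<nu> pl p\<nu>
    unfolding euler_Q_def W\<^sub>l_def W\<^sub>\<nu>_def
    by (rule DERIV_imp_deriv; auto intro!: derivative_eq_intros simp: algebra_simps)+
  then show ?thesis
    unfolding regularized_orbit_def motion_def euler_Q_split[symmetric]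
    by (simp add: all_conj_distrib conj_ac)
qed

lemma motion_energy:
  shows "motion (W\<^sub>l c) l pl \<Longrightarrow> E\<^sub>l c (l s) (pl s) = E\<^sub>l c (l t) (pl t)"
    and "motion (W\<^sub>\<nu> \<mu> c) \<nu> p\<nu> \<Longrightarrow> E\<^sub>\<nu> \<mu> c (\<nu> s) (p\<nu> s) = E\<^sub>\<nu> \<mu> c (\<nu> t) (p\<nu> t)"
proof -
  assume m: "motion (W\<^sub>l c) l pl"
  have "((\<lambda>t. E\<^sub>l c (l t) (pl t)) has_real_derivative 0) (at t)" for t
    unfolding E\<^sub>l_def
    by (auto intro!: derivative_eq_intros motionD[OF m] simp: W\<^sub>l_def algebra_simps)
  then show "E\<^sub>l c (l s) (pl s) = E\<^sub>l c (l t) (pl t)"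
    using DERIV_isconst_all[of "\<lambda>t. E\<^sub>l c (l t) (pl t)"] by blast
next
  assume m: "motion (W\<^sub>\<nu> \<mu> c) \<nu> p\<nu>"
  have "((\<lambda>t. E\<^sub>\<nu> \<mu> c (\<nu> t) (p\<nu> t)) has_real_derivative 0) (at t)" for t
    unfolding E\<^sub>\<nu>_def
    by (auto intro!: derivative_eq_intros motionD[OF m] simp: W\<^sub>\<nu>_def algebra_simps)
  then show "E\<^sub>\<nu> \<mu> c (\<nu> s) (p\<nu> s) = E\<^sub>\<nu> \<mu> c (\<nu> t) (p\<nu> t)"
    using DERIV_isconst_all[of "\<lambda>t. E\<^sub>\<nu> \<mu> c (\<nu> t) (p\<nu> t)"] by blast
qed

lemma regularized_orbitE:
  assumes "regularized_orbit \<mu> c x"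
  obtains l \<nu> pl p\<nu> G where "x = (\<lambda>\<tau>. (l \<tau>, \<nu> \<tau>, pl \<tau>, p\<nu> \<tau>))"
    "motion (W\<^sub>l c) l pl" "motion (W\<^sub>\<nu> \<mu> c) \<nu> p\<nu>"
    "\<forall>\<tau>. E\<^sub>l c (l \<tau>) (pl \<tau>) = G" "\<forall>\<tau>. E\<^sub>\<nu> \<mu> c (\<nu> \<tau>) (p\<nu> \<tau>) = - G"
proof -
  obtain l \<nu> pl p\<nu> where o: "x = (\<lambda>\<tau>. (l \<tau>, \<nu> \<tau>, pl \<tau>, p\<nu> \<tau>))"
     "\<forall>\<tau>. E\<^sub>l c (l \<tau>) (pl \<tau>) + E\<^sub>\<nu> \<mu> c (\<nu> \<tau>) (p\<nu> \<tau>) = 0"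
     "motion (W\<^sub>l c) l pl" "motion (W\<^sub>\<nu> \<mu> c) \<nu> p\<nu>"
    using assms unfolding regularized_orbit_iff by blast
  have a: "E\<^sub>l c (l \<tau>) (pl \<tau>) = E\<^sub>l c (l 0) (pl 0)" for \<tau>
    using motion_energy(1)[OF o(3)] .
  have b: "E\<^sub>\<nu> \<mu> c (\<nu> \<tau>) (p\<nu> \<tau>) = - E\<^sub>l c (l 0) (pl 0)" for \<tau>
    using o(2)[rule_format, of \<tau>] a[of \<tau>] by simp
  show ?thesis by (rule that[OF o(1,3,4)]; intro allI) (rule a b)+
qed

section \<open>Bounded energy levels and uniqueness in each variable\<close>

lemma abs_le_cosh: "\<bar>x::real\<bar> \<le> cosh x"
proof -
  have "1 + \<bar>x\<bar> \<le> exp \<bar>x\<bar>" by simp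
  moreover have "exp \<bar>x\<bar> \<le> 2 * cosh x" 
    by (cases "x \<ge> 0") (auto simp: cosh_def)
  moreover have "2 * \<bar>x\<bar> \<le> exp \<bar>x\<bar>"
  proof -
    \<comment> \<open>Bounding the exponential at half the argument and squaring suffices, since (1
      + r/2)^2 exceeds 2 r by the square (1 - r/2)^2.\<close>
    have "1 + \<bar>x\<bar>/2 \<le> exp (\<bar>x\<bar>/2)" by simp
    then have "(1 + \<bar>x\<bar>/2)\<^sup>2 \<le> (exp (\<bar>x\<bar>/2))\<^sup>2" by (intro power_mono) auto
    also have "\<dots> = exp \<bar>x\<bar>" by (simp add: power2_eq_square flip: exp_add)
    finally have "(1 + \<bar>x\<bar>/2)\<^sup>2 \<le> exp \<bar>x\<bar>" .
    moreover have "(1 + \<bar>x\<bar>/2)\<^sup>2 = 2 * \<bar>x\<bar> + (1 - \<bar>x\<bar>/2)\<^sup>2"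
      by (simp add: power2_eq_square algebra_simps)
    ultimately show ?thesis using zero_le_power2[of "1 - \<bar>x\<bar>/2"] by linarith
  qed
  ultimately show ?thesis by linarith
qed

lemma energy_level_bounded:
  assumes "c < 0"
  obtains R where "0 \<le> R" "\<And>l p. E\<^sub>l c l p = G \<Longrightarrow> \<bar>l\<bar> \<le> R \<and> \<bar>p\<bar> \<le> R"
proof -
  \<comment> \<open>If cosh l exceeds the quotient, then - c cosh^2 l exceeds (|G| + 2) cosh l,
    which is at least G + 2 cosh l, contradicting the energy relation.\<close>
  define B where "B = (\<bar>G\<bar> + 2) / (- c) + 1"
  have "(\<bar>G\<bar> + 2) / (- c) \<ge> 0" using assms by (intro divide_nonneg_pos) auto
  then have B: "B \<ge> 1" by (simp add: B_def)
  have y: "cosh l \<le> B" if "E\<^sub>l c l p = G" for l p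
  proof (rule ccontr)
    assume "\<not> ?thesis"
    then have "cosh l > (\<bar>G\<bar> + 2) / (- c)" by (simp add: B_def)
    then have *: "- c * cosh l > \<bar>G\<bar> + 2" using assms by (simp add: field_simps)
    have "- c * cosh l * cosh l > (\<bar>G\<bar> + 2) * cosh l"
      by (intro mult_strict_right_mono *) simp
    moreover have "\<bar>G\<bar> * 1 \<le> \<bar>G\<bar> * cosh l" by (intro mult_left_mono cosh_real_ge_1) simp
    ultimately have "- c * (cosh l)\<^sup>2 > G + 2 * cosh l"
      by (simp add: power2_eq_square algebra_simps)
    moreover have "0 \<le> 2 * p\<^sup>2" by simp
    ultimately show False using that unfolding E\<^sub>l_def by linarith
  qed
  have p: "\<bar>p\<bar> \<le> B + \<bar>G\<bar> + 1" if "E\<^sub>l c l p = G" for l p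
  proof -
    have "c * (cosh l)\<^sup>2 \<le> 0" using assms by (simp add: mult_le_0_iff)
    then have "2 * p\<^sup>2 \<le> \<bar>G\<bar> + 2 * B" using that y[OF that] unfolding E\<^sub>l_def by linarith
    moreover have "2 * \<bar>p\<bar> \<le> p\<^sup>2 + 1"
      using zero_le_power2[of "\<bar>p\<bar> - 1"] by (simp add: power2_eq_square algebra_simps)
    ultimately show ?thesis using B by linarith
  qed
  show ?thesis
  proof
    show "\<bar>l\<bar> \<le> B + \<bar>G\<bar> + 1 \<and> \<bar>p\<bar> \<le> B + \<bar>G\<bar> + 1" if "E\<^sub>l c l p = G" for l p
      using y[OF that] p[OF that] abs_le_cosh[of l] by linarith
  qed (use B in auto)
qed

text \<open>Equal initial states have equal energy, and its level is bounded because
  \<open>c\<close> is negative; both motions thus stay in a compact interval on which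
  \<open>W\<^sub>l\<close> is Lipschitz.\<close>

lemma motion_l_unique:
  assumes "c < 0" "motion (W\<^sub>l c) l p" "motion (W\<^sub>l c) l' p'" "l t0 = l' t0" "p t0 = p' t0"
  shows "l = l'" "p = p'"
proof -
  define G where "G = E\<^sub>l c (l t0) (p t0)"
  obtain R where R: "\<And>l p. E\<^sub>l c l p = G \<Longrightarrow> \<bar>l\<bar> \<le> R \<and> \<bar>p\<bar> \<le> R" "0 \<le> R"
    using energy_level_bounded[OF \<open>c < 0\<close>] by metis
  have "E\<^sub>l c (l t) (p t) = G" "E\<^sub>l c (l' t) (p' t) = G" for t
    using motion_energy(1)[OF assms(2), of t t0] motion_energy(1)[OF assms(3), of t t0]
    by (simp_all add: G_def assms)
  then have "\<bar>l t\<bar> \<le> R" "\<bar>l' t\<bar> \<le> R" for t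
    using R(1) by blast+
  then have b: "l t \<in> {-R..R}" "l' t \<in> {-R..R}" for t
    unfolding atLeastAtMost_iff by (metis abs_le_D1 abs_le_D2 minus_le_iff)+
  define W' where "W' = (\<lambda>y. 2 * cosh y + 2 * c * (sinh y * sinh y + cosh y * cosh y))"
  have "bounded (W' ` {-R..R})"
    unfolding W'_def
    by (intro compact_imp_bounded compact_continuous_image continuous_intros) auto
  then obtain K where "\<forall>z\<in>W' ` {-R..R}. norm z \<le> K"
    unfolding bounded_iff by blast
  then have K: "\<And>y. y \<in> {-R..R} \<Longrightarrow> norm (W' y) \<le> K" by blast
  have "\<bar>W\<^sub>l c (l t) - W\<^sub>l c (l' t)\<bar> \<le> K * \<bar>l t - l' t\<bar>" for t
    unfolding real_norm_def[symmetric]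
  proof (rule field_differentiable_bound[OF _ _ K])
    show "(W\<^sub>l c has_real_derivative W' z) (at z within {- R..R})" for z
      unfolding W\<^sub>l_def W'_def by (auto intro!: derivative_eq_intros simp: algebra_simps)
  qed (use b in auto)
  then show "l = l'" "p = p'"
    using motion_unique[OF assms(2,3) _ assms(4,5)] by blast+
qed

lemma motion_\<nu>_unique:
  assumes "motion (W\<^sub>\<nu> \<mu> c) x p" "motion (W\<^sub>\<nu> \<mu> c) y q" "x t0 = y t0" "p t0 = q t0"
  shows "x = y" "p = q"
proof -
  define W' where "W' = (\<lambda>y. 2 * (1 - 2 * \<mu>) * cos y + 2 * c * (cos y * cos y - sin y * sin y))"
  have "\<bar>W\<^sub>\<nu> \<mu> c (x t) - W\<^sub>\<nu> \<mu> c (y t)\<bar> \<le> (\<bar>2 * (1 - 2 * \<mu>)\<bar> + \<bar>2 * c\<bar>) * \<bar>x t - y t\<bar>" for t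
    unfolding real_norm_def[symmetric]
  proof (rule field_differentiable_bound[where f' = W' and S = UNIV])
    show "(W\<^sub>\<nu> \<mu> c has_real_derivative W' z) (at z within UNIV)" for z
      unfolding W\<^sub>\<nu>_def W'_def by (auto intro!: derivative_eq_intros simp: algebra_simps)
    fix z
    have "W' z = 2 * (1 - 2 * \<mu>) * cos z + 2 * c * cos (2 * z)"
      by (simp add: W'_def cos_double power2_eq_square)
    also have "norm \<dots> \<le> norm (2 * (1 - 2 * \<mu>) * cos z) + norm (2 * c * cos (2 * z))"
      by (rule norm_triangle_ineq)
    also have "\<dots> \<le> norm (2 * (1 - 2 * \<mu>)) * 1 + norm (2 * c) * 1"
      unfolding norm_mult[of _ "cos _"] by (intro add_mono mult_left_mono) auto
    finally show "norm (W' z) \<le> norm (2 * (1 - 2 * \<mu>)) + norm (2 * c)" by simp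
  qed auto
  then show "x = y" "p = q"
    using motion_unique[OF assms(1,2) _ assms(3,4)] by blast+
qed

section \<open>The oscillation in \<open>\<lambda>\<close>\<close>

text \<open>The substitution \<open>sinh (l/2) = S sin \<psi>\<close>, with \<open>S\<close> the amplitude, removes the turning points:
  \<open>\<psi>' = sqrt (2 (1 + S\<^sup>2 sin\<^sup>2 \<psi>) (D / S\<^sup>2 - 4 c S\<^sup>2 sin\<^sup>2 \<psi>))\<close> never vanishes.\<close>

lemma oscillation_exists:
  assumes c: "c < 0" and D: "G + 2 + c > 0"
  shows "\<exists>l p. motion (W\<^sub>l c) l p \<and> (\<forall>t. E\<^sub>l c (l t) (p t) = G) \<and>
    (\<forall>y q. E\<^sub>l c y q = G \<longrightarrow> (\<exists>t. l t = y \<and> p t = q))"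
proof -
  define D where "D = G + 2 + c"
  have "D > 0" using D by (simp add: D_def)
  \<comment> \<open>The value of sinh^2 (l/2) at the turning points: putting p = 0 and cosh l = 1 +
    2 u in the energy relation gives 4 c u^2 + 4 (1 + c) u + D = 0. Since c < 0 < D its roots have
    opposite signs; this is the positive one.\<close>
  define u where "u = ((1 + c) + sqrt ((1 + c)\<^sup>2 - c * D)) / (- 2 * c)"
  have cD: "c * D < 0" using c \<open>D > 0\<close> by (simp add: mult_neg_pos)
  have "u > 0"
  proof -
    have "\<bar>1 + c\<bar> = sqrt ((1 + c)\<^sup>2)" by simp
    also have "\<dots> < sqrt ((1 + c)\<^sup>2 - c * D)" using cD by (intro real_sqrt_less_mono) linarith
    finally have "(1 + c) + sqrt ((1 + c)\<^sup>2 - c * D) > 0" by linarith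
    then show ?thesis unfolding u_def using c by (intro divide_pos_pos) auto
  qed
  have u: "- 4 * c * u\<^sup>2 - 4 * (1 + c) * u - D = 0"
  proof -
    define r where "r = sqrt ((1 + c)\<^sup>2 - c * D)"
    have r2: "r\<^sup>2 = (1 + c)\<^sup>2 - c * D"
      unfolding r_def using cD zero_le_power2[of "1 + c"] by (intro real_sqrt_pow2) linarith
    have "- 2 * c * u = (1 + c) + r" using c by (simp add: u_def r_def)
    then have "(- 2 * c * u - (1 + c))\<^sup>2 = (1 + c)\<^sup>2 - c * D" using r2 by simp
    then have "c * (- 4 * c * u\<^sup>2 - 4 * (1 + c) * u - D) = 0"
      by (simp add: power2_eq_square algebra_simps)
    then show ?thesis using c by simp
  qed
  define S where "S = sqrt u"
  have S: "S > 0" "S\<^sup>2 = u" using \<open>u > 0\<close> by (simp_all add: S_def)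
  \<comment> \<open>With s = sinh (l/2), the polynomial for 2 p^2 factors as (u - s^2) (D / u - 4 c
    s^2). Only the first factor vanishes on the orbit, and s = S sin \<psi> makes it the square of S
    cos \<psi>; \<open>k\<close> absorbs the positive second factor.\<close>
  define k where "k = (\<lambda>s::real. sqrt (2 * (D / u - 4 * c * s\<^sup>2)))"
  have kpos: "2 * (D / u - 4 * c * s\<^sup>2) > 0" for s
  proof -
    have "D / u > 0" "- 4 * c * s\<^sup>2 \<ge> 0" using \<open>D > 0\<close> \<open>u > 0\<close> c by (auto simp: mult_le_0_iff)
    then show ?thesis by simp
  qed
  have k: "k s > 0" "(k s)\<^sup>2 = 2 * (D / u - 4 * c * s\<^sup>2)" for s
    using kpos[of s] by (simp_all add: k_def)
  have Eid: "G + 2 * (1 + 2 * s\<^sup>2) + c * (1 + 2 * s\<^sup>2)\<^sup>2 = (u - s\<^sup>2) * (k s)\<^sup>2 / 2" for s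
  proof -
    have "(u - s\<^sup>2) * (k s)\<^sup>2 / 2 = (u - s\<^sup>2) * (D / u - 4 * c * s\<^sup>2)"
      by (simp add: k)
    also have "\<dots> = D - s\<^sup>2 * (4 * c * u + D / u) + 4 * c * s\<^sup>2 * s\<^sup>2"
      using \<open>u > 0\<close> by (simp add: field_simps)
    also have "4 * c * u + D / u = - 4 * (1 + c)"
      using u \<open>u > 0\<close> by (simp add: field_simps power2_eq_square)
    finally show ?thesis by (simp add: D_def power2_eq_square algebra_simps)
  qed
  \<comment> \<open>The speed of \<psi> forced by l' = 4 p: differentiating l = 2 arsinh (S sin
    \<psi>) leaves S cos \<psi> on both sides, and it cancels.\<close>
  define g where "g = (\<lambda>\<psi>. sqrt (1 + (S * sin \<psi>)\<^sup>2) * k (S * sin \<psi>))"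
  have cosh2: "cosh l = 1 + 2 * (sinh (l / 2))\<^sup>2" for l :: real
    using cosh_double[of "l / 2"] cosh_square_eq[of "l / 2"] by simp
  have g_cont: "continuous_on UNIV g"
    unfolding g_def k_def by (intro continuous_intros)
  have g_pos: "0 < g y" for y
    unfolding g_def by (intro mult_pos_pos k) (simp add: add_pos_nonneg)
  have g_le: "g y \<le> sqrt (1 + u) * sqrt (2 * (D / u - 4 * c * u))" for y
    proof -
      have "(sin y)\<^sup>2 \<le> 1" by (simp add: abs_square_le_1)
      then have "u * (sin y)\<^sup>2 \<le> u * 1" using \<open>u > 0\<close> by (intro mult_left_mono) auto
      then have *: "(S * sin y)\<^sup>2 \<le> u" by (simp add: power_mult_distrib S)
      then have "- 4 * c * (S * sin y)\<^sup>2 \<le> - 4 * c * u" using c by (intro mult_left_mono) auto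
      then show ?thesis
        unfolding g_def k_def using * kpos[of "S * sin y"] \<open>u > 0\<close>
        by (intro mult_mono real_sqrt_le_mono) (auto intro: add_nonneg_nonneg)
  qed
  obtain \<psi> where \<psi>: "\<And>t. (\<psi> has_real_derivative g (\<psi> t)) (at t)" "surj \<psi>"
    using autonomous_ode_surj[OF g_cont g_pos g_le] by metis
  define l where "l = (\<lambda>t. 2 * arsinh (S * sin (\<psi> t)))"
  define p where "p = (\<lambda>t. S * cos (\<psi> t) * k (S * sin (\<psi> t)) / 2)"
  have sl: "sinh (l t / 2) = S * sin (\<psi> t)" for t by (simp add: l_def)
  have cl: "cosh (l t / 2) = sqrt (1 + (S * sin (\<psi> t))\<^sup>2)" for t
    using cosh_square_eq[of "l t / 2"] unfolding sl
    by (metis abs_of_nonneg add.commute cosh_real_nonneg real_sqrt_abs)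
  have ds: "((\<lambda>t. S * sin (\<psi> t)) has_real_derivative S * cos (\<psi> t) * g (\<psi> t)) (at t)" for t
    by (auto intro!: derivative_eq_intros \<psi>(1))
  have dl: "(l has_real_derivative 4 * p t) (at t)" for t
  proof -
    have "sqrt ((S * sin (\<psi> t))\<^sup>2 + 1) > 0" by (simp add: add_nonneg_pos)
    then have "2 * (1 / sqrt ((S * sin (\<psi> t))\<^sup>2 + 1) * (S * cos (\<psi> t) * g (\<psi> t))) = 4 * p t"
      unfolding p_def g_def by (simp add: add.commute)
    then show ?thesis
      unfolding l_def
      using DERIV_cmult[OF DERIV_chain2[OF arsinh_real_has_field_derivative ds], of 2 t] by simp
  qed
  have dp: "(p has_real_derivative W\<^sub>l c (l t)) (at t)" for t
  proof -
    define s where "s = S * sin (\<psi> t)"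
    have dk: "(k has_real_derivative - 8 * c * s / k s) (at s)"
    proof -
      have h: "((\<lambda>s. 2 * (D / u - 4 * c * s\<^sup>2)) has_real_derivative - 16 * c * s) (at s)"
        by (auto intro!: derivative_eq_intros)
      show ?thesis
        unfolding k_def
      proof (rule DERIV_cong[OF DERIV_chain2[OF DERIV_real_sqrt[OF kpos] h]])
        show "inverse (sqrt (2 * (D / u - 4 * c * s\<^sup>2))) / 2 * (- 16 * c * s)
            = - 8 * c * s / sqrt (2 * (D / u - 4 * c * s\<^sup>2))"
          unfolding divide_inverse by algebra
      qed
    qed
    have dc: "((\<lambda>t. S * cos (\<psi> t)) has_real_derivative - s * g (\<psi> t)) (at t)"
      by (auto intro!: derivative_eq_intros \<psi>(1) simp: s_def)
    have dks: "((\<lambda>t. k (S * sin (\<psi> t))) has_real_derivative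
        (- 8 * c * s / k s) * (S * cos (\<psi> t) * g (\<psi> t))) (at t)"
      using DERIV_chain2[where f = k and g = "\<lambda>t. S * sin (\<psi> t)" and x = t, OF _ ds] dk
      unfolding s_def by blast
    have g: "g (\<psi> t) = sqrt (1 + s\<^sup>2) * k s" by (simp add: g_def s_def)
    define C where "C = S * cos (\<psi> t)"
    have "(p has_real_derivative (- s * g (\<psi> t) * k s + (- 8 * c * s / k s) * (C * g (\<psi> t)) * C) / 2) (at t)"
      unfolding p_def C_def using DERIV_cdivide[OF DERIV_mult[OF dc dks], of 2] by (simp add: s_def)
    also have "(- s * g (\<psi> t) * k s + (- 8 * c * s / k s) * (C * g (\<psi> t)) * C) / 2
        = s * sqrt (1 + s\<^sup>2) * (- 8 * c * C\<^sup>2 - (k s)\<^sup>2) / 2"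
      using k(1)[of s] unfolding g by (simp add: field_simps power2_eq_square)
    also have "C\<^sup>2 = u - s\<^sup>2"
      by (simp add: C_def s_def power_mult_distrib S cos_squared_eq algebra_simps)
    also have "- 8 * c * (u - s\<^sup>2) - (k s)\<^sup>2 = 8 * (1 + c + 2 * c * s\<^sup>2)"
    proof -
      have "D / u = - 4 * c * u - 4 * (1 + c)"
        using u \<open>u > 0\<close> by (simp add: field_simps power2_eq_square)
      then show ?thesis by (simp only: k(2)) (simp add: algebra_simps)
    qed
    also have "s * sqrt (1 + s\<^sup>2) * (8 * (1 + c + 2 * c * s\<^sup>2)) / 2 = W\<^sub>l c (l t)"
    proof -
      have "sinh (l t) = 2 * (s * sqrt (1 + s\<^sup>2))"
        using sinh_double[of "l t / 2"] by (simp add: sl cl s_def)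
      moreover have "cosh (l t) = 1 + 2 * s\<^sup>2" using cosh2[of "l t"] by (simp add: sl s_def)
      ultimately show ?thesis by (simp add: W\<^sub>l_def algebra_simps)
    qed
    finally show ?thesis .
  qed
  show ?thesis
  proof (rule exI[of _ l], rule exI[of _ p], intro conjI allI impI)
    show "motion (W\<^sub>l c) l p" using dl dp by (simp add: motion_def)
    show "E\<^sub>l c (l t) (p t) = G" for t
    proof -
      have "2 * (p t)\<^sup>2 = (S * cos (\<psi> t))\<^sup>2 * (k (S * sin (\<psi> t)))\<^sup>2 / 2"
        by (simp add: p_def power_mult_distrib power_divide)
      also have "(S * cos (\<psi> t))\<^sup>2 = u - (S * sin (\<psi> t))\<^sup>2"
        by (simp add: power_mult_distrib S cos_squared_eq algebra_simps)
      finally have "2 * (p t)\<^sup>2 = (u - (S * sin (\<psi> t))\<^sup>2) * (k (S * sin (\<psi> t)))\<^sup>2 / 2" .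
      then show ?thesis
        unfolding E\<^sub>l_def cosh2[of "l t"] sl using Eid[of "S * sin (\<psi> t)"] by linarith
    qed
    fix y q assume E: "E\<^sub>l c y q = G"
    show "\<exists>t. l t = y \<and> p t = q"
    proof -
      define s where "s = sinh (y / 2)"
      have q: "2 * q\<^sup>2 = (u - s\<^sup>2) * (k s)\<^sup>2 / 2"
        using E Eid[of s] unfolding E\<^sub>l_def cosh2[of y] s_def by linarith
      \<comment> \<open>Dividing the energy relation by its amplitude puts the state on the unit
        circle. Its angle is a value of \<psi>, which is onto.\<close>
      have "(2 * q / (S * k s))\<^sup>2 + (s / S)\<^sup>2 = 1"
        using S k(1)[of s] \<open>u > 0\<close> q by (simp add: power_divide power_mult_distrib field_simps)
      then obtain a where a: "2 * q / (S * k s) = cos a" "s / S = sin a"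
        by (rule sincos_total_2pi)
      obtain t where t: "\<psi> t = a" using \<psi>(2) by (metis surjD)
      have s: "S * sin (\<psi> t) = s" using a S(1) by (simp add: t flip: a)
      have "l t = y" unfolding l_def s by (simp add: s_def arsinh_sinh_real)
      moreover have "p t = q"
      proof -
        have "cos (\<psi> t) = 2 * q / (S * k s)" using a(1) t by simp
        then show ?thesis unfolding p_def s using S(1) k(1)[of s] by simp
      qed
      ultimately show ?thesis by blast
    qed
  qed
qed

text \<open>The level has squared momentum (G + 2 + c) / 2 over l = 0, and a time shift moves that
  passage to time 0. This lets a homoclinic hit a primary at a prescribed instant.\<close>

lemma oscillation_through_zero:
  assumes "c < 0" "G + 2 + c > 0"
  shows "\<exists>l p. motion (W\<^sub>l c) l p \<and> (\<forall>t. E\<^sub>l c (l t) (p t) = G) \<and> l 0 = 0"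
proof -
  obtain l p where o: "motion (W\<^sub>l c) l p" "\<forall>t. E\<^sub>l c (l t) (p t) = G"
    "\<forall>y q. E\<^sub>l c y q = G \<longrightarrow> (\<exists>t. l t = y \<and> p t = q)"
    using oscillation_exists[OF assms] by (elim exE conjE) (rule that)
  have "(sqrt ((G + 2 + c) / 2))\<^sup>2 = (G + 2 + c) / 2"
    using assms(2) by (intro real_sqrt_pow2) simp
  then have "E\<^sub>l c 0 (sqrt ((G + 2 + c) / 2)) = G" by (simp add: E\<^sub>l_def field_simps)
  then obtain t where "l t = 0" using o(3) by blast
  then show ?thesis
    using motion_shift[OF o(1), of t] o(2)
    by (intro exI[of _ "\<lambda>s. l (s + t)"] exI[of _ "\<lambda>s. p (s + t)"] conjI) simp_all
qed

text \<open>By uniqueness any motion on the level is a time shift of the constructed one, since the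
  latter passes through its initial state.\<close>

lemma oscillation_covers:
  assumes "c < 0" "G + 2 + c > 0" "motion (W\<^sub>l c) l p" "\<And>t. E\<^sub>l c (l t) (p t) = G" "E\<^sub>l c y q = G"
  shows "\<exists>t. l t = y \<and> p t = q"
proof -
  obtain l' p' where o: "motion (W\<^sub>l c) l' p'"
    "\<forall>y q. E\<^sub>l c y q = G \<longrightarrow> (\<exists>t. l' t = y \<and> p' t = q)"
    using oscillation_exists[OF assms(1,2)] by (elim exE conjE) (rule that)
  obtain t0 where t0: "l' t0 = l 0" "p' t0 = p 0" using o(2) assms(4)[of 0] by blast
  have init: "l 0 = l' (0 + t0)" "p 0 = p' (0 + t0)" using t0 by simp_all
  note eq = motion_l_unique[OF assms(1,3) motion_shift[OF o(1)] init]
  obtain t1 where t1: "l' t1 = y" "p' t1 = q" using o(2) assms(5) by blast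
  show ?thesis
    by (rule exI[of _ "t1 - t0"], unfold eq) (simp add: t1)
qed

section \<open>Winding numbers in elliptic coordinates\<close>

text \<open>The content of \<open>turns\<close> in terms of plane curves alone, so that curves can
  be reflected in the origin without producing states for the reflected curve.\<close>

definition winds :: "complex \<Rightarrow> (real \<Rightarrow> complex) \<Rightarrow> (real \<Rightarrow> complex) \<Rightarrow> int \<Rightarrow> bool" where
  "winds P g q n \<longleftrightarrow> (\<exists>\<theta> \<phi>. polar_angle P q \<theta> \<and> polar_angle P g \<phi> \<and>
     ((\<lambda>\<tau>. infdist (q \<tau>, \<theta> \<tau>) (range (\<lambda>s. (g s, \<phi> s)))) \<longlongrightarrow> 0) at_bot \<and>
     ((\<lambda>\<tau>. infdist (q \<tau>, \<theta> \<tau>) (range (\<lambda>s. (g s, \<phi> s + 2 * pi * of_int n)))) \<longlongrightarrow> 0) at_top)"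

lemma turns_iff_winds: "turns P \<gamma> x n \<longleftrightarrow> winds P (position \<circ> \<gamma>) (position \<circ> x) n"
  by (simp add: turns_def winds_def)

lemma polar_angle_add_2pi:
  assumes "polar_angle P q \<theta>"
  shows "polar_angle P q (\<lambda>t. \<theta> t + 2 * pi * of_int n)"
proof -
  have "cis (a + 2 * pi * of_int n) = cis a" for a
  proof -
    have "sin (a + 2 * pi * of_int n) = sin a \<and> cos (a + 2 * pi * of_int n) = cos a"
      unfolding sin_cos_eq_iff by blast
    then show ?thesis by (simp add: complex_eq_iff)
  qed
  then show ?thesis
    using assms unfolding polar_angle_def by (simp add: continuous_on_add)
qed

lemma polar_angle_uminus:
  assumes "polar_angle P q \<theta>"
  shows "polar_angle (- P) (\<lambda>t. - q t) (\<lambda>t. \<theta> t + pi)"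
  unfolding polar_angle_def
proof (intro conjI allI)
  show "continuous_on UNIV (\<lambda>t. \<theta> t + pi)"
    using assms unfolding polar_angle_def by (intro continuous_intros) auto
  fix t
  have c: "cis (\<theta> t + pi) = - cis (\<theta> t)" by (simp add: complex_eq_iff)
  have q: "q t \<noteq> P" "q t - P = of_real (cmod (q t - P)) * cis (\<theta> t)"
    using assms unfolding polar_angle_def by blast+
  show "- q t \<noteq> - P" using q(1) by simp
  have e: "- q t - - P = - (q t - P)" by simp
  show "- q t - - P = of_real (cmod (- q t - - P)) * cis (\<theta> t + pi)"
    unfolding e c norm_minus_cancel using q(2) by simp
qed

text \<open>The reflection adds \<pi> to both angles. This is an isometry of the space in which the
  distances are measured, so \<open>n\<close> is unchanged.\<close>

lemma winds_uminus:
  assumes "winds P g q n"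
  shows "winds (- P) (\<lambda>s. - g s) (\<lambda>t. - q t) n"
proof -
  obtain \<theta> \<phi> where *: "polar_angle P q \<theta>" "polar_angle P g \<phi>"
     "((\<lambda>\<tau>. infdist (q \<tau>, \<theta> \<tau>) (range (\<lambda>s. (g s, \<phi> s)))) \<longlongrightarrow> 0) at_bot"
     "((\<lambda>\<tau>. infdist (q \<tau>, \<theta> \<tau>) (range (\<lambda>s. (g s, \<phi> s + 2 * pi * of_int n)))) \<longlongrightarrow> 0) at_top"
    using assms unfolding winds_def by (elim exE conjE) (rule that)
  have i: "infdist (- a, b + pi) (range (\<lambda>s. (- g s, f s + pi))) = infdist (a, b) (range (\<lambda>s. (g s, f s)))"
    for a b f
    by (simp add: infdist_def image_image dist_Pair_Pair dist_minus)
  have e: "\<phi> s + pi + 2 * pi * of_int n = (\<phi> s + 2 * pi * of_int n) + pi" for s by simp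
  show ?thesis
    unfolding winds_def
  proof (rule exI[of _ "\<lambda>t. \<theta> t + pi"], rule exI[of _ "\<lambda>t. \<phi> t + pi"], intro conjI)
    show "((\<lambda>\<tau>. infdist (- q \<tau>, \<theta> \<tau> + pi) (range (\<lambda>s. (- g s, \<phi> s + pi)))) \<longlongrightarrow> 0) at_bot"
      unfolding i by (rule *(3))
    show "((\<lambda>\<tau>. infdist (- q \<tau>, \<theta> \<tau> + pi)
        (range (\<lambda>s. (- g s, \<phi> s + pi + 2 * pi * of_int n)))) \<longlongrightarrow> 0) at_top"
      unfolding e i by (rule *(4))
  qed (intro polar_angle_uminus *)+
qed

lemma winds_reverse:
  assumes "winds P g (\<lambda>t. q (- t)) n"
  shows "winds P g q (- n)"
proof -
  obtain \<theta> \<phi> where *: "polar_angle P (\<lambda>t. q (- t)) \<theta>" "polar_angle P g \<phi>"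
     "((\<lambda>\<tau>. infdist (q (- \<tau>), \<theta> \<tau>) (range (\<lambda>s. (g s, \<phi> s)))) \<longlongrightarrow> 0) at_bot"
     "((\<lambda>\<tau>. infdist (q (- \<tau>), \<theta> \<tau>) (range (\<lambda>s. (g s, \<phi> s + 2 * pi * of_int n)))) \<longlongrightarrow> 0) at_top"
    using assms unfolding winds_def by (elim exE conjE) (rule that)
  show ?thesis
    unfolding winds_def
  \<comment> \<open>The lift approached at the forward end becomes the reference lift; the original
    one then lies - n turns away.\<close>
  proof (rule exI[of _ "\<lambda>t. \<theta> (- t)"], rule exI[of _ "\<lambda>t. \<phi> t + 2 * pi * of_int n"], intro conjI)
    show "polar_angle P q (\<lambda>t. \<theta> (- t))"
      unfolding polar_angle_def
    proof (intro conjI allI)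
      have "continuous_on UNIV \<theta>" using *(1) unfolding polar_angle_def by blast
      then show "continuous_on UNIV (\<lambda>t. \<theta> (- t))"
        using continuous_on_compose2[of UNIV \<theta> UNIV "\<lambda>t. - t"] by (simp add: continuous_on_minus)
      fix t
      show "q t \<noteq> P" "q t - P = of_real (cmod (q t - P)) * cis (\<theta> (- t))"
        using *(1)[unfolded polar_angle_def, THEN conjunct2, rule_format, of "- t"] by simp_all
    qed
    show "((\<lambda>\<tau>. infdist (q \<tau>, \<theta> (- \<tau>)) (range (\<lambda>s. (g s, \<phi> s + 2 * pi * of_int n)))) \<longlongrightarrow> 0) at_bot"
      using *(4) by (simp add: filterlim_at_bot_mirror)
    show "((\<lambda>\<tau>. infdist (q \<tau>, \<theta> (- \<tau>)) (range (\<lambda>s. (g s, \<phi> s + 2 * pi * of_int n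
        + 2 * pi * of_int (- n))))) \<longlongrightarrow> 0) at_top"
      using *(3) by (simp add: filterlim_at_bot_mirror)
  qed (rule polar_angle_add_2pi[OF *(2)])
qed

text \<open>Only \<nu> converges while \<lambda> keeps oscillating, so the comparison point is
  \<open>h (l t, e)\<close> with the same \<open>l t\<close>. Uniform continuity on the compact
  rectangle makes the estimate independent of the phase.\<close>

lemma infdist_tendsto_zero:
  fixes h :: "real \<times> real \<Rightarrow> 'a::metric_space"
  assumes cont: "continuous_on ({- R..R} \<times> {d1..d2}) h" and l: "\<And>t. \<bar>l t\<bar> \<le> R"
    and lim: "(\<nu> \<longlongrightarrow> e) F" and ev: "\<forall>\<^sub>F t in F. \<nu> t \<in> {d1..d2}" and e: "e \<in> {d1..d2}"
    and S: "\<And>t. h (l t, e) \<in> S"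
  shows "((\<lambda>t. infdist (h (l t, \<nu> t)) S) \<longlongrightarrow> 0) F"
proof (rule tendstoI)
  fix r :: real assume "r > 0"
  have "uniformly_continuous_on ({- R..R} \<times> {d1..d2}) h"
    by (intro compact_uniformly_continuous cont compact_Times compact_Icc)
  then obtain d where d: "d > 0"
    "\<And>a b. a \<in> {- R..R} \<times> {d1..d2} \<Longrightarrow> b \<in> {- R..R} \<times> {d1..d2} \<Longrightarrow> dist b a < d \<Longrightarrow> dist (h b) (h a) < r"
    using \<open>r > 0\<close> unfolding uniformly_continuous_on_def by metis
  have "\<forall>\<^sub>F t in F. dist (\<nu> t) e < d" using lim d(1) by (rule tendstoD)
  with ev show "\<forall>\<^sub>F t in F. dist (infdist (h (l t, \<nu> t)) S) 0 < r"
  proof eventually_elim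
    case (elim t)
    have "l t \<in> {- R..R}" using l[of t] by auto
    then have "dist (h (l t, \<nu> t)) (h (l t, e)) < r"
      using elim e by (intro d(2)) (auto simp: dist_Pair_Pair)
    then show ?case using infdist_le[OF S[of t], of "h (l t, \<nu> t)"] by (simp add: infdist_nonneg)
  qed
qed

text \<open>Writing \<open>w = l + \<i> \<nu>\<close>, one has \<open>elliptic l \<nu> = cosh w / 2\<close>, so that \<open>elliptic l \<nu> - moon\<close> and
  \<open>elliptic l \<nu> - earth\<close> are the squares of \<open>sinh (w / 2)\<close> and \<open>cosh (w / 2)\<close>.\<close>

definition sinh_half :: "real \<Rightarrow> real \<Rightarrow> complex" where
  "sinh_half l \<nu> = Complex (sinh (l / 2) * cos (\<nu> / 2)) (cosh (l / 2) * sin (\<nu> / 2))"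

definition cosh_half :: "real \<Rightarrow> real \<Rightarrow> complex" where
  "cosh_half l \<nu> = Complex (cosh (l / 2) * cos (\<nu> / 2)) (sinh (l / 2) * sin (\<nu> / 2))"

lemma elliptic_square:
  "elliptic l \<nu> - moon = (sinh_half l \<nu>)\<^sup>2" "elliptic l \<nu> - earth = (cosh_half l \<nu>)\<^sup>2"
proof -
  have 1: "cosh l = 1 + 2 * (sinh (l / 2))\<^sup>2" "(cosh (l / 2))\<^sup>2 = 1 + (sinh (l / 2))\<^sup>2"
    "sinh l = 2 * sinh (l / 2) * cosh (l / 2)"
    using cosh_double[of "l / 2"] cosh_square_eq[of "l / 2"] sinh_double[of "l / 2"] by simp_all
  have 2: "cos \<nu> = 1 - 2 * (sin (\<nu> / 2))\<^sup>2" "(cos (\<nu> / 2))\<^sup>2 = 1 - (sin (\<nu> / 2))\<^sup>2"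
    "sin \<nu> = 2 * sin (\<nu> / 2) * cos (\<nu> / 2)"
    using cos_double_sin[of "\<nu> / 2"] cos_squared_eq[of "\<nu> / 2"] sin_double[of "\<nu> / 2"] by simp_all
  have "cosh l * cos \<nu> / 2 - 1 / 2 = (sinh (l / 2) * cos (\<nu> / 2))\<^sup>2 - (cosh (l / 2) * sin (\<nu> / 2))\<^sup>2"
    "cosh l * cos \<nu> / 2 + 1 / 2 = (cosh (l / 2) * cos (\<nu> / 2))\<^sup>2 - (sinh (l / 2) * sin (\<nu> / 2))\<^sup>2"
    unfolding 1(1) 2(1) power_mult_distrib 1(2) 2(2) by (simp_all add: field_simps)
  then show "elliptic l \<nu> - moon = (sinh_half l \<nu>)\<^sup>2" "elliptic l \<nu> - earth = (cosh_half l \<nu>)\<^sup>2"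
    by (simp_all add: complex_eq_iff Re_power2 Im_power2 elliptic_def moon_def earth_def
        sinh_half_def cosh_half_def 1(3) 2(3))
qed

lemma half_minus:
  "sinh_half l (- \<nu>) = - sinh_half (- l) \<nu>" "cosh_half l (- \<nu>) = cosh_half (- l) \<nu>"
  by (simp_all add: sinh_half_def cosh_half_def complex_eq_iff)

lemma elliptic_symmetries:
  "elliptic (- l) (- \<nu>) = elliptic l \<nu>"
  "elliptic l (- \<nu>) = elliptic (- l) \<nu>"
  "elliptic l (\<nu> + 2 * pi * of_int k) = elliptic l \<nu>"
  "elliptic l (\<nu> - pi) = - elliptic l \<nu>"
proof -
  have "sin (\<nu> + 2 * pi * of_int k) = sin \<nu> \<and> cos (\<nu> + 2 * pi * of_int k) = cos \<nu>"
    unfolding sin_cos_eq_iff by blast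
  then show "elliptic l (\<nu> + 2 * pi * of_int k) = elliptic l \<nu>" by (simp add: elliptic_def)
qed (simp_all add: elliptic_def complex_eq_iff cos_diff sin_diff)

lemma continuous_on_elliptic [continuous_intros]:
  fixes S :: "'a::t2_space set"
  shows "continuous_on S f \<Longrightarrow> continuous_on S g \<Longrightarrow> continuous_on S (\<lambda>x. elliptic (f x) (g x))"
    "continuous_on S f \<Longrightarrow> continuous_on S g \<Longrightarrow> continuous_on S (\<lambda>x. sinh_half (f x) (g x))"
    "continuous_on S f \<Longrightarrow> continuous_on S g \<Longrightarrow> continuous_on S (\<lambda>x. cosh_half (f x) (g x))"
  unfolding elliptic_def sinh_half_def cosh_half_def Complex_eq by (auto intro!: continuous_intros)

text \<open>Doubling Arg of a square root gives a range of length 4 \<pi>, enough for the curve to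
  wind once around \<open>P\<close> while the root stays off the branch cut.\<close>

lemma polar_angle_square:
  assumes "\<And>t. q t - P = (\<zeta> t)\<^sup>2" "continuous_on UNIV \<zeta>" "\<And>t. \<zeta> t \<notin> \<real>\<^sub>\<le>\<^sub>0"
  shows "polar_angle P q (\<lambda>t. 2 * Arg (\<zeta> t))"
  unfolding polar_angle_def
proof (intro conjI allI)
  show "continuous_on UNIV (\<lambda>t. 2 * Arg (\<zeta> t))"
    using assms by (intro continuous_intros) auto
  fix t
  have "\<zeta> t \<noteq> 0" using assms(3)[of t] by auto
  then show "q t \<noteq> P" using assms(1)[of t] by auto
  have "(\<zeta> t)\<^sup>2 = (of_real (cmod (\<zeta> t)) * cis (Arg (\<zeta> t)))\<^sup>2"
    using rcis_cmod_Arg[of "\<zeta> t"] by (simp add: rcis_def)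
  also have "\<dots> = of_real (cmod ((\<zeta> t)\<^sup>2)) * cis (2 * Arg (\<zeta> t))"
    by (simp add: power_mult_distrib norm_power Complex.DeMoivre)
  finally show "q t - P = of_real (cmod (q t - P)) * cis (2 * Arg (\<zeta> t))"
    using assms(1)[of t] by simp
qed

text \<open>The sign of the imaginary part is that of \<nu>, so the root about the Moon can meet the
  real axis only at \<nu> = 0.\<close>

lemma sinh_half_upper:
  assumes "0 < \<nu>" "\<nu> < 2 * pi"
  shows "Im (sinh_half l \<nu>) > 0" "Im (sinh_half l (- \<nu>)) < 0"
proof -
  have "sin (\<nu> / 2) > 0" using assms by (intro sin_gt_zero) auto
  moreover have "cosh (l / 2) > 0" by simp
  ultimately show "Im (sinh_half l \<nu>) > 0" "Im (sinh_half l (- \<nu>)) < 0"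
    by (simp_all add: sinh_half_def)
qed

lemma not_nonpos_Reals_if_Im: "Im z \<noteq> 0 \<Longrightarrow> z \<notin> \<real>\<^sub>\<le>\<^sub>0"
  by (simp add: complex_nonpos_Reals_iff)

lemma not_nonpos_Reals_if_Re: "Re z > 0 \<Longrightarrow> z \<notin> \<real>\<^sub>\<le>\<^sub>0"
  by (simp add: complex_nonpos_Reals_iff)

section \<open>Turns about each primary\<close>

text \<open>The root \<open>sinh_half\<close> changes half plane exactly once, at \<nu> = 0, where
  it is the nonzero real number sinh (l/2). After a choice of sign this number is positive, and Arg
  is continuous along the whole orbit. Since (l, -e) and (-l, e) are the same position, both ends
  are compared with one angle \<open>e\<close>; this is why \<open>L\<close> must cover both signs
  of \<open>l\<close>.\<close>

lemma winds_moon_increasing: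
  fixes l \<nu> L :: "real \<Rightarrow> real"
  assumes e: "0 < e" "e \<le> pi" and cont: "continuous_on UNIV l" "continuous_on UNIV \<nu>" "continuous_on UNIV L"
    and lR: "\<And>t. \<bar>l t\<bar> \<le> R" and \<nu>: "\<And>t. - e < \<nu> t \<and> \<nu> t < e" and inj: "inj \<nu>"
    and top: "(\<nu> \<longlongrightarrow> e) at_top" and bot: "(\<nu> \<longlongrightarrow> - e) at_bot"
    and nz: "\<And>t. \<nu> t = 0 \<Longrightarrow> l t \<noteq> 0"
    and L: "\<And>t. \<exists>s. L s = l t" "\<And>t. \<exists>s. L s = - l t"
  shows "\<exists>n\<in>{1, -1}. winds moon (\<lambda>s. elliptic (L s) e) (\<lambda>t. elliptic (l t) (\<nu> t)) n"
proof -
  \<comment> \<open>The sign of \<lambda> at the crossing, well determined because \<nu> is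
    injective; it turns out to be the number of turns. If there is no crossing value of
    \<open>l\<close> below 0, it is 1.\<close>
  define \<sigma> :: int where "\<sigma> = (if \<exists>t. \<nu> t = 0 \<and> l t < 0 then - 1 else 1)"
  have \<sigma>: "\<sigma> = 1 \<or> \<sigma> = - 1" by (auto simp: \<sigma>_def)
  have \<sigma>l: "of_int \<sigma> * l t > 0" if "\<nu> t = 0" for t
  proof (cases "l t < 0")
    case True
    then show ?thesis using that by (auto simp: \<sigma>_def)
  next
    case False
    then have "\<not> (\<exists>s. \<nu> s = 0 \<and> l s < 0)"
      using that inj by (metis injD)
    then show ?thesis using nz[OF that] False by (simp add: \<sigma>_def)
  qed
  define h where "h = (\<lambda>(l, \<nu>). (elliptic l \<nu>, 2 * Arg (of_int \<sigma> * sinh_half l \<nu>)))"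
  have Im_nz: "Im (sinh_half l y) \<noteq> 0" if "y \<noteq> 0" "\<bar>y\<bar> \<le> e" for l y
    using sinh_half_upper[of "\<bar>y\<bar>" l] that e by (cases "y > 0") auto
  have Im_\<sigma>: "Im (of_int \<sigma> * z) \<noteq> 0 \<longleftrightarrow> Im z \<noteq> 0" for z using \<sigma> by auto
  \<comment> \<open>A rectangle containing \<nu> = 0 would contain points with roots on the cut.
    Continuity of \<open>h\<close> is therefore claimed only on rectangles to one side, which is all
    the two limits require.\<close>
  have ch: "continuous_on ({- R..R} \<times> {a..b}) h" if "0 \<notin> {a..b}" "{a..b} \<subseteq> {- e..e}" for a b
    unfolding h_def case_prod_beta
  proof (intro continuous_intros)
    fix z :: "real \<times> real" assume "z \<in> {- R..R} \<times> {a..b}"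
    then have "snd z \<noteq> 0" "\<bar>snd z\<bar> \<le> e" using that by (auto simp: mem_Times_iff abs_le_iff)
    then show "of_int \<sigma> * sinh_half (fst z) (snd z) \<notin> \<real>\<^sub>\<le>\<^sub>0"
      by (intro not_nonpos_Reals_if_Im) (simp only: Im_\<sigma>, rule Im_nz)
  qed
  define \<zeta> where "\<zeta> = (\<lambda>t. of_int \<sigma> * sinh_half (l t) (\<nu> t))"
  have \<zeta>: "\<zeta> t \<notin> \<real>\<^sub>\<le>\<^sub>0" for t
  proof (cases "\<nu> t = 0")
    case False
    then show ?thesis
      unfolding \<zeta>_def using \<nu>[of t]
      by (intro not_nonpos_Reals_if_Im) (simp only: Im_\<sigma>, rule Im_nz, auto)
  next
    case True
    have "Re (\<zeta> t) = of_int \<sigma> * sinh (l t / 2)"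
      unfolding \<zeta>_def using \<sigma> True by (auto simp: sinh_half_def)
    also have "\<dots> > 0" using \<sigma> \<sigma>l[OF True] by auto
    finally show ?thesis by (rule not_nonpos_Reals_if_Re)
  qed
  have sq: "(of_int \<sigma> * z)\<^sup>2 = z\<^sup>2" for z :: complex using \<sigma> by auto
  have \<theta>: "polar_angle moon (\<lambda>t. elliptic (l t) (\<nu> t)) (\<lambda>t. 2 * Arg (\<zeta> t))"
  proof (rule polar_angle_square[OF _ _ \<zeta>])
    show "elliptic (l t) (\<nu> t) - moon = (\<zeta> t)\<^sup>2" for t
      by (simp only: \<zeta>_def sq elliptic_square)
    show "continuous_on UNIV \<zeta>" unfolding \<zeta>_def by (intro continuous_intros cont)
  qed
  \<comment> \<open>The root reached at \<nu> = - e, rewritten at the angle \<open>e\<close>. It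
    fixes the reference lift of \<gamma>; at \<nu> = e the orbit has the opposite root.\<close>
  define \<xi> where "\<xi> = (\<lambda>y. - (of_int \<sigma> * sinh_half y e))"
  have upper: "Im (sinh_half y e) > 0" for y using sinh_half_upper[of e y] e by simp
  have \<phi>: "polar_angle moon (\<lambda>s. elliptic (L s) e) (\<lambda>s. 2 * Arg (\<xi> (L s)))"
  proof (rule polar_angle_square)
    show "elliptic (L s) e - moon = (\<xi> (L s))\<^sup>2" for s
      by (simp only: \<xi>_def power2_minus sq elliptic_square)
    show "continuous_on UNIV (\<lambda>s. \<xi> (L s))" unfolding \<xi>_def by (intro continuous_intros cont)
    show "\<xi> (L s) \<notin> \<real>\<^sub>\<le>\<^sub>0" for s
      using upper[of "L s"] \<sigma> unfolding \<xi>_def by (intro not_nonpos_Reals_if_Im) auto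
  qed
  have lower_end: "h (y, - e) = (elliptic (- y) e, 2 * Arg (\<xi> (- y)))" for y
    by (simp add: h_def \<xi>_def half_minus elliptic_symmetries)
  have upper_end: "h (y, e) = (elliptic y e, 2 * Arg (\<xi> y) + 2 * pi * of_int \<sigma>)" for y
  proof -
    have "sinh_half y e \<noteq> 0" "Arg (sinh_half y e) > 0"
      using upper[of y] Arg_lt_pi by force+
    \<comment> \<open>Opposite roots differ by \<pi> in Arg, hence by a full turn after doubling;
      the direction depends on \<sigma>.\<close>
    then have "Arg (- sinh_half y e) = Arg (sinh_half y e) - pi"
      by (simp add: Arg_minus)
    then show ?thesis using \<sigma> by (auto simp: h_def \<xi>_def)
  qed
  have "((\<lambda>t. infdist (h (l t, \<nu> t)) (range (\<lambda>s. (elliptic (L s) e, 2 * Arg (\<xi> (L s)))))) \<longlongrightarrow> 0) at_bot"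
  proof (rule infdist_tendsto_zero[OF _ lR bot])
    show "continuous_on ({- R..R} \<times> {- e..- e / 2}) h" using e by (intro ch) auto
    show "\<forall>\<^sub>F t in at_bot. \<nu> t \<in> {- e..- e / 2}"
    proof -
      have "\<forall>\<^sub>F t in at_bot. \<nu> t < - e / 2" using order_tendstoD(2)[OF bot, of "- e / 2"] e by simp
      then show ?thesis by eventually_elim (use \<nu> in \<open>force intro: less_imp_le\<close>)
    qed
    show "h (l t, - e) \<in> range (\<lambda>s. (elliptic (L s) e, 2 * Arg (\<xi> (L s))))" for t
    proof -
      obtain s where "L s = - l t" using L(2) by blast
      then show ?thesis unfolding lower_end by (intro image_eqI[of _ _ s]) auto
    qed
  qed (use e in auto)
  moreover have "((\<lambda>t. infdist (h (l t, \<nu> t))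
      (range (\<lambda>s. (elliptic (L s) e, 2 * Arg (\<xi> (L s)) + 2 * pi * of_int \<sigma>)))) \<longlongrightarrow> 0) at_top"
  proof (rule infdist_tendsto_zero[OF _ lR top])
    show "continuous_on ({- R..R} \<times> {e / 2..e}) h" using e by (intro ch) auto
    show "\<forall>\<^sub>F t in at_top. \<nu> t \<in> {e / 2..e}"
    proof -
      have "\<forall>\<^sub>F t in at_top. \<nu> t > e / 2" using order_tendstoD(1)[OF top, of "e / 2"] e by simp
      then show ?thesis by eventually_elim (use \<nu> in \<open>force intro: less_imp_le\<close>)
    qed
    show "h (l t, e) \<in> range (\<lambda>s. (elliptic (L s) e, 2 * Arg (\<xi> (L s)) + 2 * pi * of_int \<sigma>))" for t
    proof -
      obtain s where "L s = l t" using L(1) by blast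
      then show ?thesis unfolding upper_end by (intro image_eqI[of _ _ s]) auto
    qed
  qed (use e in auto)
  ultimately have "winds moon (\<lambda>s. elliptic (L s) e) (\<lambda>t. elliptic (l t) (\<nu> t)) \<sigma>"
    unfolding winds_def h_def prod.case \<zeta>_def[symmetric]
    by (intro exI[of _ "\<lambda>t. 2 * Arg (\<zeta> t)"] exI[of _ "\<lambda>s. 2 * Arg (\<xi> (L s))"] conjI \<theta> \<phi>)
      (simp_all add: \<zeta>_def)
  then show ?thesis using \<sigma> by auto
qed

text \<open>A decreasing \<nu> is reduced to an increasing one by reversing time, which only changes
  the sign of \<open>n\<close>.\<close>

lemma winds_moon:
  fixes l \<nu> L :: "real \<Rightarrow> real"
  assumes e: "0 < e" "e \<le> pi" and cont: "continuous_on UNIV l" "continuous_on UNIV \<nu>" "continuous_on UNIV L"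
    and lR: "\<And>t. \<bar>l t\<bar> \<le> R" and \<nu>: "\<And>t. - e < \<nu> t \<and> \<nu> t < e" and inj: "inj \<nu>"
    and lim: "(\<nu> \<longlongrightarrow> e) at_top \<and> (\<nu> \<longlongrightarrow> - e) at_bot \<or> (\<nu> \<longlongrightarrow> - e) at_top \<and> (\<nu> \<longlongrightarrow> e) at_bot"
    and nz: "\<And>t. \<nu> t = 0 \<Longrightarrow> l t \<noteq> 0"
    and L: "\<And>t. \<exists>s. L s = l t" "\<And>t. \<exists>s. L s = - l t"
  shows "\<exists>n\<in>{1, -1}. winds moon (\<lambda>s. elliptic (L s) e) (\<lambda>t. elliptic (l t) (\<nu> t)) n"
  using lim
proof
  assume "(\<nu> \<longlongrightarrow> e) at_top \<and> (\<nu> \<longlongrightarrow> - e) at_bot"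
  then show ?thesis
    using winds_moon_increasing[OF e cont lR \<nu> inj _ _ nz L] by blast
next
  assume "(\<nu> \<longlongrightarrow> - e) at_top \<and> (\<nu> \<longlongrightarrow> e) at_bot"
  then have lim': "((\<lambda>t. \<nu> (- t)) \<longlongrightarrow> e) at_top" "((\<lambda>t. \<nu> (- t)) \<longlongrightarrow> - e) at_bot"
    by (simp_all add: filterlim_at_bot_mirror)
  have cont': "continuous_on UNIV (\<lambda>t. l (- t))" "continuous_on UNIV (\<lambda>t. \<nu> (- t))"
    by (intro continuous_on_compose2[OF cont(1)] continuous_on_compose2[OF cont(2)] continuous_intros; simp)+
  have inj': "inj (\<lambda>t. \<nu> (- t))" by (rule injI) (use injD[OF inj] in force)
  have "\<exists>n\<in>{1, -1}. winds moon (\<lambda>s. elliptic (L s) e) (\<lambda>t. elliptic (l (- t)) (\<nu> (- t))) n"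
    by (rule winds_moon_increasing[OF e cont' cont(3) lR \<nu> inj' lim' nz L])
  then obtain n where n: "n = 1 \<or> n = -1" 
    "winds moon (\<lambda>s. elliptic (L s) e) (\<lambda>t. elliptic (l (- t)) (\<nu> (- t))) n" by blast
  have "winds moon (\<lambda>s. elliptic (L s) e) (\<lambda>t. elliptic (l t) (\<nu> t)) (- n)"
    by (rule winds_reverse) (rule n(2))
  then show ?thesis using n(1) by auto
qed

text \<open>For |\<nu>| <= e < \<pi> the root about the Earth has positive real part, so its Arg
  never gets near the cut. Its values at (l, -e) and (-l, e) coincide, and both ends lie on the same
  lift.\<close>

lemma winds_earth_zero:
  fixes l \<nu> L :: "real \<Rightarrow> real"
  assumes e: "0 < e" "e < pi" and cont: "continuous_on UNIV l" "continuous_on UNIV \<nu>" "continuous_on UNIV L"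
    and lR: "\<And>t. \<bar>l t\<bar> \<le> R" and \<nu>: "\<And>t. - e < \<nu> t \<and> \<nu> t < e"
    and lim: "(\<nu> \<longlongrightarrow> e) at_top \<and> (\<nu> \<longlongrightarrow> - e) at_bot \<or> (\<nu> \<longlongrightarrow> - e) at_top \<and> (\<nu> \<longlongrightarrow> e) at_bot"
    and L: "\<And>t. \<exists>s. L s = l t" "\<And>t. \<exists>s. L s = - l t"
  shows "winds earth (\<lambda>s. elliptic (L s) e) (\<lambda>t. elliptic (l t) (\<nu> t)) 0"
proof -
  have pos: "Re (cosh_half y z) > 0" if "\<bar>z\<bar> \<le> e" for y z
  proof -
    have "cos (z / 2) > 0" using that e by (intro cos_gt_zero_pi) auto
    then show ?thesis by (simp add: cosh_half_def)
  qed
  define h where "h = (\<lambda>(l, \<nu>). (elliptic l \<nu>, 2 * Arg (cosh_half l \<nu>)))"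
  define S where "S = range (\<lambda>s. (elliptic (L s) e, 2 * Arg (cosh_half (L s) e)))"
  have ch: "continuous_on ({- R..R} \<times> {- e..e}) h"
    unfolding h_def case_prod_beta
  proof (intro continuous_intros not_nonpos_Reals_if_Re pos)
  qed (auto simp: abs_le_iff)
  have end1: "h (l t, e) \<in> S" for t
  proof -
    obtain s where "L s = l t" using L(1) by blast
    then show ?thesis unfolding S_def h_def by (intro image_eqI[of _ _ s]) auto
  qed
  have end2: "h (l t, - e) \<in> S" for t
  proof -
    obtain s where "L s = - l t" using L(2) by blast
    then show ?thesis
      unfolding S_def h_def by (intro image_eqI[of _ _ s]) (auto simp: half_minus elliptic_symmetries)
  qed
  have le: "\<nu> t \<in> {- e..e}" for t using \<nu>[of t] by auto
  have inf: "((\<lambda>t. infdist (h (l t, \<nu> t)) S) \<longlongrightarrow> 0) F" if "(\<nu> \<longlongrightarrow> e) F \<or> (\<nu> \<longlongrightarrow> - e) F" for F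
    using that
  proof
    assume "(\<nu> \<longlongrightarrow> e) F"
    then show ?thesis
      by (rule infdist_tendsto_zero[OF ch lR _ always_eventually _ end1]) (use e le in auto)
  next
    assume "(\<nu> \<longlongrightarrow> - e) F"
    then show ?thesis
      by (rule infdist_tendsto_zero[OF ch lR _ always_eventually _ end2]) (use e le in auto)
  qed
  have "\<bar>\<nu> t\<bar> \<le> e" for t using le[of t] by auto
  then have \<theta>: "polar_angle earth (\<lambda>t. elliptic (l t) (\<nu> t)) (\<lambda>t. 2 * Arg (cosh_half (l t) (\<nu> t)))"
    by (intro polar_angle_square elliptic_square continuous_intros cont not_nonpos_Reals_if_Re pos)
  have \<phi>: "polar_angle earth (\<lambda>s. elliptic (L s) e) (\<lambda>s. 2 * Arg (cosh_half (L s) e))"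
    by (intro polar_angle_square elliptic_square continuous_intros cont not_nonpos_Reals_if_Re pos)
      (use e in auto)
  have "((\<lambda>t. infdist (h (l t, \<nu> t)) S) \<longlongrightarrow> 0) at_bot" "((\<lambda>t. infdist (h (l t, \<nu> t)) S) \<longlongrightarrow> 0) at_top"
    using lim by (intro inf; blast)+
  then show ?thesis
    unfolding winds_def h_def S_def prod.case
    by (intro exI[of _ "\<lambda>t. 2 * Arg (cosh_half (l t) (\<nu> t))"]
        exI[of _ "\<lambda>s. 2 * Arg (cosh_half (L s) e)"] conjI \<theta> \<phi>) simp_all
qed

text \<open>For \<open>l > 0\<close> the point lies on an ellipse, which surrounds the segment between the foci; its
  polar angle about a point of the segment stays within \<open>\<pi>\<close> of \<open>\<nu>\<close>, as both directions lie in the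
  same closed half plane.\<close>

lemma polar_angle_ellipse:
  fixes l \<nu> :: "real \<Rightarrow> real"
  assumes cont: "continuous_on UNIV l" "continuous_on UNIV \<nu>" and l: "\<And>t. l t > 0"
    and P: "P \<in> closed_segment earth moon"
  obtains \<theta> where "polar_angle P (\<lambda>t. elliptic (l t) (\<nu> t)) \<theta>" "\<forall>t. \<bar>\<theta> t - \<nu> t\<bar> \<le> pi"
proof -
  have P: "Im P = 0" "\<bar>Re P\<bar> \<le> 1 / 2"
  proof -
    obtain u where u: "0 \<le> u" "u \<le> 1" "P = (1 - u) *\<^sub>R earth + u *\<^sub>R moon"
      using P unfolding closed_segment_def by blast
    have "Re P = u - 1 / 2" "Im P = 0"
      unfolding u(3) by (simp_all add: earth_def moon_def field_simps)
    with u(1,2) show "Im P = 0" "\<bar>Re P\<bar> \<le> 1 / 2" by linarith+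
  qed
  \<comment> \<open>The direction from \<open>P\<close> turned back by \<nu>: its Arg is the
    deviation of the polar angle from \<nu>, continuous as long as \<open>z\<close> avoids the
    cut.\<close>
  define z where "z = (\<lambda>t. (elliptic (l t) (\<nu> t) - P) * cis (- \<nu> t))"
  have z: "z t \<notin> \<real>\<^sub>\<le>\<^sub>0" for t
  proof
    assume "z t \<in> \<real>\<^sub>\<le>\<^sub>0"
    then obtain r where r: "z t = of_real r" "r \<le> 0" by (auto elim: nonpos_Reals_cases)
    have "elliptic (l t) (\<nu> t) - P = z t * cis (\<nu> t)"
      by (simp add: z_def mult.assoc cis_mult)
    then have Re: "cosh (l t) * cos (\<nu> t) / 2 - Re P = r * cos (\<nu> t)"
      and Im: "sinh (l t) * sin (\<nu> t) / 2 = r * sin (\<nu> t)"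
      using P by (simp_all add: r elliptic_def complex_eq_iff)
    have s: "sinh (l t) > 0" using l by simp
    have "sin (\<nu> t) = 0"
    proof (rule ccontr)
      assume "sin (\<nu> t) \<noteq> 0"
      then have "sinh (l t) / 2 = r" using Im by simp
      then show False using s r by simp
    qed
    then have "cos (\<nu> t) = 1 \<or> cos (\<nu> t) = - 1"
      using sin_cos_squared_add[of "\<nu> t"] by (simp add: power2_eq_1_iff)
    \<comment> \<open>The point is a vertex of the ellipse, at distance cosh l / 2 > 1 / 2 from the
      centre, hence beyond \<open>P\<close>.\<close>
    moreover have "cosh (l t) > 1"
      using cosh_real_ge_1[of "l t"] cosh_real_one_iff[of "l t"] l[of t] by linarith
    ultimately show False using Re P r by (auto simp: abs_le_iff)
  qed
  define \<theta> where "\<theta> = (\<lambda>t. \<nu> t + Arg (z t))"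
  have "continuous_on UNIV z" unfolding z_def by (intro continuous_intros cont)
  then have "continuous_on UNIV \<theta>" unfolding \<theta>_def using z by (intro continuous_intros cont) auto
  moreover have "elliptic (l t) (\<nu> t) - P = of_real (cmod (elliptic (l t) (\<nu> t) - P)) * cis (\<theta> t)" for t
  proof -
    have "elliptic (l t) (\<nu> t) - P = z t * cis (\<nu> t)"
      by (simp add: z_def mult.assoc cis_mult)
    also have "z t = of_real (cmod (z t)) * cis (Arg (z t))"
      using rcis_cmod_Arg[of "z t"] by (simp add: rcis_def)
    also have "cmod (z t) = cmod (elliptic (l t) (\<nu> t) - P)" by (simp add: z_def norm_mult)
    finally show ?thesis by (simp add: \<theta>_def mult.assoc cis_mult add.commute)
  qed
  moreover have "elliptic (l t) (\<nu> t) \<noteq> P" for t using z[of t] by (auto simp: z_def)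
  ultimately have "polar_angle P (\<lambda>t. elliptic (l t) (\<nu> t)) \<theta>" by (simp add: polar_angle_def)
  moreover have "\<bar>\<theta> t - \<nu> t\<bar> \<le> pi" for t
    using mpi_less_Arg[of "z t"] Arg_le_pi[of "z t"] by (simp add: \<theta>_def abs_le_iff)
  ultimately show ?thesis using that by blast
qed

section \<open>Orbits asymptotic to each other\<close>

lemma E\<^sub>l_uminus: "E\<^sub>l c (- l) (- p) = E\<^sub>l c l p" "E\<^sub>l c (- l) p = E\<^sub>l c l p"
  by (simp_all add: E\<^sub>l_def)

lemma cos_eq_cos_cases:
  fixes x y :: real
  assumes "cos x = cos y"
  obtains k :: int where "x = y + 2 * pi * of_int k \<or> x = - y + 2 * pi * of_int k"
proof -
  have "(sin x)\<^sup>2 = (sin y)\<^sup>2" using assms by (simp add: sin_squared_eq)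
  then consider "sin x = sin y \<and> cos x = cos y" | "sin x = sin (- y) \<and> cos x = cos (- y)"
    using assms by (auto simp: power2_eq_iff)
  then show ?thesis
  proof cases
    case 1
    then show ?thesis unfolding sin_cos_eq_iff using that by blast
  next
    case 2
    then obtain k :: int where "x = - y + 2 * pi * of_int k" unfolding sin_cos_eq_iff by blast
    then show ?thesis using that by blast
  qed
qed

lemma orbit_set_energy:
  assumes "w \<in> orbit_set (\<lambda>\<tau>. (l \<tau>, \<nu> \<tau>, pl \<tau>, p\<nu> \<tau>))" "\<And>\<tau>. E\<^sub>l c (l \<tau>) (pl \<tau>) = G"
  shows "E\<^sub>l c (fst w) (fst (snd (snd w))) = G"
  using assms by (auto simp: orbit_set_def same_state_def E\<^sub>l_def)

lemma orbit_set_nonempty: "orbit_set x \<noteq> {}"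
proof -
  have "same_state (x 0) (x 0)"
    by (cases "x 0") (auto simp: same_state_def intro!: exI[of _ 0])
  then have "x 0 \<in> orbit_set x" unfolding orbit_set_def by blast
  then show ?thesis by blast
qed

lemma infdist_less_imp:
  assumes "infdist x A < r" "A \<noteq> {}"
  obtains a where "a \<in> A" "dist x a < r"
proof -
  have "\<exists>a\<in>A. dist x a < r"
    using assms by (simp add: infdist_def cINF_less_iff)
  then show ?thesis using that by blast
qed

text \<open>The level of \<gamma> is bounded, so states close to it lie in a compact box on which
  \<open>E\<^sub>l\<close> is uniformly continuous; two constant values that come arbitrarily close
  are equal. The symmetry \<open>same_state\<close> preserves \<open>E\<^sub>l\<close>, so all of
  \<open>orbit_set\<close> has energy G.\<close>

lemma asymptotic_energy:
  fixes l pl \<nu> p\<nu> :: "real \<Rightarrow> real"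
  assumes c: "c < 0" and \<gamma>: "\<And>\<tau>. E\<^sub>l c (l' \<tau>) (pl' \<tau>) = G" and x: "\<And>\<tau>. E\<^sub>l c (l \<tau>) (pl \<tau>) = G'"
    and lim: "((\<lambda>\<tau>. infdist (l \<tau>, \<nu> \<tau>, pl \<tau>, p\<nu> \<tau>)
       (orbit_set (\<lambda>\<tau>. (l' \<tau>, \<nu>' \<tau>, pl' \<tau>, p\<nu>' \<tau>)))) \<longlongrightarrow> 0) at_top"
  shows "G' = G"
proof (rule ccontr)
  assume "G' \<noteq> G"
  then have eps: "\<bar>G' - G\<bar> > 0" by simp
  obtain R where R: "0 \<le> R" "\<And>l p. E\<^sub>l c l p = G \<Longrightarrow> \<bar>l\<bar> \<le> R \<and> \<bar>p\<bar> \<le> R"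
    using energy_level_bounded[OF c, of G] by blast
  define K where "K = {- (R + 1)..R + 1} \<times> {- (R + 1)..R + 1}"
  have "uniformly_continuous_on K (\<lambda>z. E\<^sub>l c (fst z) (snd z))"
    unfolding K_def E\<^sub>l_def
    by (intro compact_uniformly_continuous compact_Times compact_Icc continuous_intros)
  then obtain d where d: "d > 0"
    "\<And>a b. a \<in> K \<Longrightarrow> b \<in> K \<Longrightarrow> dist b a < d \<Longrightarrow>
      dist (E\<^sub>l c (fst b) (snd b)) (E\<^sub>l c (fst a) (snd a)) < \<bar>G' - G\<bar>"
    using eps unfolding uniformly_continuous_on_def by metis
  let ?S = "orbit_set (\<lambda>\<tau>. (l' \<tau>, \<nu>' \<tau>, pl' \<tau>, p\<nu>' \<tau>))"
  \<comment> \<open>The bound 1 keeps both points in the box, which has margin 1 around the level;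
    \<open>d\<close> is the modulus of continuity.\<close>
  have "\<forall>\<^sub>F \<tau> in at_top. dist (infdist (l \<tau>, \<nu> \<tau>, pl \<tau>, p\<nu> \<tau>) ?S) 0 < min d 1"
    using d(1) by (intro tendstoD[OF lim]) simp
  then obtain \<tau> where \<tau>: "infdist (l \<tau>, \<nu> \<tau>, pl \<tau>, p\<nu> \<tau>) ?S < min d 1"
  proof -
    obtain N where "\<forall>\<tau>\<ge>N. dist (infdist (l \<tau>, \<nu> \<tau>, pl \<tau>, p\<nu> \<tau>) ?S) 0 < min d 1"
      using \<open>\<forall>\<^sub>F \<tau> in at_top. _\<close> unfolding eventually_at_top_linorder by blast
    then have "infdist (l N, \<nu> N, pl N, p\<nu> N) ?S < min d 1" by (simp add: infdist_nonneg)
    then show ?thesis by (rule that)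
  qed
  obtain w where w: "w \<in> ?S" "dist (l \<tau>, \<nu> \<tau>, pl \<tau>, p\<nu> \<tau>) w < min d 1"
    using infdist_less_imp[OF \<tau> orbit_set_nonempty] by blast
  obtain y z q r where w_eq: "w = (y, z, q, r)" by (metis prod.exhaust)
  have E: "E\<^sub>l c y q = G" using orbit_set_energy[OF w(1) \<gamma>] by (simp add: w_eq)
  have "dist (l \<tau>, pl \<tau>) (y, q) \<le> dist (l \<tau>, \<nu> \<tau>, pl \<tau>, p\<nu> \<tau>) w"
    by (simp add: w_eq dist_Pair_Pair)
  then have dd: "dist (l \<tau>, pl \<tau>) (y, q) < d" "dist (l \<tau>, pl \<tau>) (y, q) < 1" using w(2) by auto
  have "dist (l \<tau>) y < 1" "dist (pl \<tau>) q < 1"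
    using dd(2) dist_fst_le[of "(l \<tau>, pl \<tau>)" "(y, q)"] dist_snd_le[of "(l \<tau>, pl \<tau>)" "(y, q)"] by auto
  then have "(l \<tau>, pl \<tau>) \<in> K" "(y, q) \<in> K"
    using R(2)[OF E] by (auto simp: K_def dist_real_def)
  from d(2)[OF this(2,1) dd(1)] show False
    by (simp add: E x dist_real_def)
qed

text \<open>Here asymptoticity is converted into equal separated energies; from then on the orbit is
  treated by conservation laws.\<close>

lemma homoclinicE:
  assumes "c < 0" "homoclinic \<mu> c (\<lambda>\<tau>. (l' \<tau>, \<nu>' \<tau>, pl' \<tau>, p\<nu>' \<tau>)) x" "\<And>\<tau>. E\<^sub>l c (l' \<tau>) (pl' \<tau>) = G"
  obtains l \<nu> pl p\<nu> where "x = (\<lambda>\<tau>. (l \<tau>, \<nu> \<tau>, pl \<tau>, p\<nu> \<tau>))"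
    "motion (W\<^sub>l c) l pl" "motion (W\<^sub>\<nu> \<mu> c) \<nu> p\<nu>"
    "\<forall>\<tau>. E\<^sub>l c (l \<tau>) (pl \<tau>) = G" "\<forall>\<tau>. E\<^sub>\<nu> \<mu> c (\<nu> \<tau>) (p\<nu> \<tau>) = - G"
    "orbit_set x \<noteq> orbit_set (\<lambda>\<tau>. (l' \<tau>, \<nu>' \<tau>, pl' \<tau>, p\<nu>' \<tau>))"
proof -
  have r: "regularized_orbit \<mu> c x"
    and ne: "orbit_set x \<noteq> orbit_set (\<lambda>\<tau>. (l' \<tau>, \<nu>' \<tau>, pl' \<tau>, p\<nu>' \<tau>))"
    and lim: "((\<lambda>\<tau>. infdist (x \<tau>) (orbit_set (\<lambda>\<tau>. (l' \<tau>, \<nu>' \<tau>, pl' \<tau>, p\<nu>' \<tau>)))) \<longlongrightarrow> 0) at_top"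
    using assms(2) unfolding homoclinic_def by auto
  obtain l \<nu> pl p\<nu> G' where o: "x = (\<lambda>\<tau>. (l \<tau>, \<nu> \<tau>, pl \<tau>, p\<nu> \<tau>))"
    "motion (W\<^sub>l c) l pl" "motion (W\<^sub>\<nu> \<mu> c) \<nu> p\<nu>"
    "\<forall>\<tau>. E\<^sub>l c (l \<tau>) (pl \<tau>) = G'" "\<forall>\<tau>. E\<^sub>\<nu> \<mu> c (\<nu> \<tau>) (p\<nu> \<tau>) = - G'"
    by (rule regularized_orbitE[OF r])
  have "G' = G"
    by (rule asymptotic_energy[OF assms(1,3) o(4)[rule_format] lim[unfolded o(1)]])
  then show ?thesis using o ne by (intro that) auto
qed

lemma collision_iff:
  "elliptic l \<nu> = earth \<longleftrightarrow> l = 0 \<and> cos \<nu> = - 1"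
  "elliptic l \<nu> = moon \<longleftrightarrow> l = 0 \<and> cos \<nu> = 1"
proof -
  have "elliptic l \<nu> = earth \<longleftrightarrow> cosh l + cos \<nu> = 0"
    using elliptic_dist_earth[of l \<nu>] by auto
  also have "\<dots> \<longleftrightarrow> cosh l = 1 \<and> cos \<nu> = - 1"
    using cosh_real_ge_1[of l] cos_ge_minus_one[of \<nu>] by linarith
  finally show "elliptic l \<nu> = earth \<longleftrightarrow> l = 0 \<and> cos \<nu> = - 1" by simp
  have "elliptic l \<nu> = moon \<longleftrightarrow> cosh l - cos \<nu> = 0"
    using elliptic_dist_moon[of l \<nu>] by auto
  also have "\<dots> \<longleftrightarrow> cosh l = 1 \<and> cos \<nu> = 1"
    using cosh_real_ge_1[of l] cos_le_one[of \<nu>] by linarith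
  finally show "elliptic l \<nu> = moon \<longleftrightarrow> l = 0 \<and> cos \<nu> = 1" by simp
qed

section \<open>Periodic orbits along a coordinate line \<open>\<nu> = const\<close>\<close>

text \<open>The curve on which \<gamma> lies prescribes only cos \<nu>. Differentiating it forces p
  = 0 unless sin \<nu> vanishes, and in that case sin \<nu> is constant and its derivative
  does.\<close>

lemma motion_cos_const:
  assumes m: "motion W \<nu> p" and u: "\<And>t. cos (\<nu> t) = u"
  shows "p t = 0" "\<nu> t = \<nu> s"
proof -
  have "p t = 0" for t
  proof (cases "u\<^sup>2 = 1")
    case True
    then have s0: "sin (\<nu> t) = 0" for t using sin_squared_eq[of "\<nu> t"] u by simp
    have "((\<lambda>t. sin (\<nu> t)) has_real_derivative cos (\<nu> t) * (4 * p t)) (at t)"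
      by (auto intro!: derivative_eq_intros motionD[OF m])
    moreover have "((\<lambda>t. sin (\<nu> t)) has_real_derivative 0) (at t)" by (simp add: s0)
    ultimately have "cos (\<nu> t) * (4 * p t) = 0" by (rule DERIV_unique)
    then show ?thesis using True u by auto
  next
    case False
    have "((\<lambda>t. cos (\<nu> t)) has_real_derivative - sin (\<nu> t) * (4 * p t)) (at t)"
      by (auto intro!: derivative_eq_intros motionD[OF m])
    moreover have "((\<lambda>t. cos (\<nu> t)) has_real_derivative 0) (at t)" by (simp add: u)
    ultimately have "- sin (\<nu> t) * (4 * p t) = 0" by (rule DERIV_unique)
    moreover have "sin (\<nu> t) \<noteq> 0" using False sin_squared_eq[of "\<nu> t"] u by auto
    ultimately show ?thesis by simp
  qed
  note p = this
  show "p t = 0" by (rule p)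
  have "\<forall>t. (\<nu> has_real_derivative 0) (at t)" using motionD(1)[OF m] by (simp add: p)
  then show "\<nu> t = \<nu> s" by (rule DERIV_isconst_all)
qed

text \<open>The oscillation covers its level, and the identification of (\<lambda>, \<nu>) with
  (-\<lambda>, -\<nu>) supplies the opposite angle. The orbit is thus determined by G and cos e,
  whatever its phase or lift.\<close>

lemma orbit_set_const_angle:
  assumes c: "c < 0" "G + 2 + c > 0" and m: "motion (W\<^sub>l c) l pl" and E: "\<And>\<tau>. E\<^sub>l c (l \<tau>) (pl \<tau>) = G"
  shows "orbit_set (\<lambda>\<tau>. (l \<tau>, e, pl \<tau>, 0)) = {(y, z, q, r). E\<^sub>l c y q = G \<and> cos z = cos e \<and> r = 0}"
    (is "?L = ?R")
proof
  have per: "cos (a + 2 * pi * of_int k) = cos a" for a k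
    using sin_cos_eq_iff[of "a + 2 * pi * of_int k" a] by blast
  show "?L \<subseteq> ?R"
    using per[of "- e"] by (auto simp: orbit_set_def same_state_def E[unfolded E\<^sub>l_def] E\<^sub>l_def per add.commute)
  show "?R \<subseteq> ?L"
  proof
    fix w assume "w \<in> ?R"
    then obtain y z q where w: "w = (y, z, q, 0)" and yq: "E\<^sub>l c y q = G" and z: "cos z = cos e"
      by auto
    obtain k :: int where "z = e + 2 * pi * of_int k \<or> z = - e + 2 * pi * of_int k"
      using cos_eq_cos_cases[OF z] by blast
    then have "(y, z, q, 0) \<in> ?L"
    proof
      assume "z = e + 2 * pi * of_int k"
      moreover obtain t where "l t = y" "pl t = q" using oscillation_covers[OF c m E yq] by blast
      ultimately show ?thesis unfolding orbit_set_def same_state_def by auto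
    next
      assume "z = - e + 2 * pi * of_int k"
      moreover obtain t where "l t = - y" "pl t = - q"
        using oscillation_covers[OF c m E, of "- y" "- q"] yq unfolding E\<^sub>l_uminus(1) by blast
      ultimately show ?thesis unfolding orbit_set_def same_state_def by (auto intro!: exI[of _ t] exI[of _ k])
    qed
    then show "w \<in> ?L" unfolding w .
  qed
qed

lemma regularized_orbitI:
  assumes "motion (W\<^sub>l c) l pl" "motion (W\<^sub>\<nu> \<mu> c) \<nu> p\<nu>"
    "\<And>\<tau>. E\<^sub>l c (l \<tau>) (pl \<tau>) = G" "\<And>\<tau>. E\<^sub>\<nu> \<mu> c (\<nu> \<tau>) (p\<nu> \<tau>) = - G"
  shows "regularized_orbit \<mu> c (\<lambda>\<tau>. (l \<tau>, \<nu> \<tau>, pl \<tau>, p\<nu> \<tau>))"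
  unfolding regularized_orbit_iff using assms by (intro exI conjI refl allI) simp_all

text \<open>Replacing \<nu> by its limit and p by 0 gives a point of
  \<open>orbit_set \<gamma>\<close> for every phase of the \<lambda> factor. The distance to it
  tends to 0 because energy makes p^2 a continuous function of cos \<nu> that vanishes at the rest
  angle. The freedom of phase is what allows a collision to be prescribed.\<close>

lemma homoclinic_const_angleI:
  assumes c: "c < 0" "G + 2 + c > 0"
    and \<gamma>: "motion (W\<^sub>l c) l' pl'" "\<And>\<tau>. E\<^sub>l c (l' \<tau>) (pl' \<tau>) = G" and e: "E\<^sub>\<nu> \<mu> c e 0 = - G"
    and l: "motion (W\<^sub>l c) l pl" "\<And>\<tau>. E\<^sub>l c (l \<tau>) (pl \<tau>) = G"
    and \<nu>: "motion (W\<^sub>\<nu> \<mu> c) \<nu> p" "\<And>\<tau>. E\<^sub>\<nu> \<mu> c (\<nu> \<tau>) (p \<tau>) = - G"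
    and ne: "cos (\<nu> t0) \<noteq> cos e"
    and lim: "(\<nu> \<longlongrightarrow> e1) at_top" "(\<nu> \<longlongrightarrow> e2) at_bot" "cos e1 = cos e" "cos e2 = cos e"
  shows "homoclinic \<mu> c (\<lambda>\<tau>. (l' \<tau>, e, pl' \<tau>, 0)) (\<lambda>\<tau>. (l \<tau>, \<nu> \<tau>, pl \<tau>, p \<tau>))"
proof -
  define S where "S = orbit_set (\<lambda>\<tau>. (l' \<tau>, e, pl' \<tau>, 0::real))"
  have S: "S = {(y, z, q, r). E\<^sub>l c y q = G \<and> cos z = cos e \<and> r = 0}"
    unfolding S_def by (rule orbit_set_const_angle[OF c \<gamma>])
  have inf: "((\<lambda>\<tau>. infdist (l \<tau>, \<nu> \<tau>, pl \<tau>, p \<tau>) S) \<longlongrightarrow> 0) F"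
    if lim: "(\<nu> \<longlongrightarrow> f) F" and f: "cos f = cos e" for f F
  proof -
    have p2: "(p \<tau>)\<^sup>2 = (- G - 2 * (1 - 2 * \<mu>) * cos (\<nu> \<tau>) - c * (cos (\<nu> \<tau>))\<^sup>2) / 2" for \<tau>
      using \<nu>(2)[of \<tau>] unfolding E\<^sub>\<nu>_def by simp
    have "((\<lambda>\<tau>. (p \<tau>)\<^sup>2) \<longlongrightarrow> (- G - 2 * (1 - 2 * \<mu>) * cos f - c * (cos f)\<^sup>2) / 2) F"
      unfolding p2 by (intro tendsto_intros lim) simp
    moreover have "- G - 2 * (1 - 2 * \<mu>) * cos f - c * (cos f)\<^sup>2 = 0"
      using e unfolding f E\<^sub>\<nu>_def by simp
    ultimately have p0: "((\<lambda>\<tau>. (p \<tau>)\<^sup>2) \<longlongrightarrow> 0) F" by simp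
    have d0: "((\<lambda>\<tau>. dist (\<nu> \<tau>) f) \<longlongrightarrow> 0) F" using lim by (rule tendsto_dist_iff[THEN iffD1])
    have "sqrt (0\<^sup>2 + 0) = (0::real)" by simp
    then have lim0: "((\<lambda>\<tau>. sqrt ((dist (\<nu> \<tau>) f)\<^sup>2 + (p \<tau>)\<^sup>2)) \<longlongrightarrow> 0) F"
      using tendsto_real_sqrt[OF tendsto_add[OF tendsto_power[OF d0, of 2] p0]] by (simp only:)
    have up: "infdist (l \<tau>, \<nu> \<tau>, pl \<tau>, p \<tau>) S \<le> sqrt ((dist (\<nu> \<tau>) f)\<^sup>2 + (p \<tau>)\<^sup>2)" for \<tau>
    proof -
      have "(l \<tau>, f, pl \<tau>, 0) \<in> S" unfolding S using l(2) f by simp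
      moreover have "dist (l \<tau>, \<nu> \<tau>, pl \<tau>, p \<tau>) (l \<tau>, f, pl \<tau>, 0) = sqrt ((dist (\<nu> \<tau>) f)\<^sup>2 + (p \<tau>)\<^sup>2)"
        by (simp add: dist_Pair_Pair)
      ultimately show ?thesis
        using infdist_le[of "(l \<tau>, f, pl \<tau>, 0)" S "(l \<tau>, \<nu> \<tau>, pl \<tau>, p \<tau>)"] by simp
    qed
    show ?thesis
      by (rule tendsto_sandwich[OF always_eventually always_eventually tendsto_const lim0])
        (use up in \<open>auto intro: infdist_nonneg\<close>)
  qed
  have "(l t0, \<nu> t0, pl t0, p t0) \<notin> S" unfolding S using ne by simp
  moreover have "(l t0, \<nu> t0, pl t0, p t0) \<in> orbit_set (\<lambda>\<tau>. (l \<tau>, \<nu> \<tau>, pl \<tau>, p \<tau>))"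
    unfolding orbit_set_def same_state_def by (auto intro!: exI[of _ t0] exI[of _ "0::int"])
  ultimately have "orbit_set (\<lambda>\<tau>. (l \<tau>, \<nu> \<tau>, pl \<tau>, p \<tau>)) \<noteq> S" by blast
  then show ?thesis
    unfolding homoclinic_def S_def[symmetric]
    using regularized_orbitI[OF l(1) \<nu>(1) l(2) \<nu>(2)] inf[OF lim(1,3)] inf[OF lim(2,4)] by blast
qed

text \<open>If \<nu> met a rest angle, energy would give p = 0 there, uniqueness would make \<nu>
  constant, and the orbit would have the same orbit set as \<gamma>.\<close>

lemma const_angle_homoclinicE:
  assumes c: "c < 0" "G + 2 + c > 0"
    and \<gamma>: "motion (W\<^sub>l c) l' pl'" "\<And>\<tau>. E\<^sub>l c (l' \<tau>) (pl' \<tau>) = G"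
    and e: "\<And>z. cos z = cos e \<Longrightarrow> E\<^sub>\<nu> \<mu> c z 0 = - G \<and> W\<^sub>\<nu> \<mu> c z = 0"
    and h: "homoclinic \<mu> c (\<lambda>\<tau>. (l' \<tau>, e, pl' \<tau>, 0)) x"
  obtains l \<nu> pl p where "x = (\<lambda>\<tau>. (l \<tau>, \<nu> \<tau>, pl \<tau>, p \<tau>))"
    "motion (W\<^sub>l c) l pl" "motion (W\<^sub>\<nu> \<mu> c) \<nu> p"
    "\<forall>\<tau>. E\<^sub>l c (l \<tau>) (pl \<tau>) = G" "\<forall>\<tau>. E\<^sub>\<nu> \<mu> c (\<nu> \<tau>) (p \<tau>) = - G" "\<forall>\<tau>. cos (\<nu> \<tau>) \<noteq> cos e"
proof -
  obtain l \<nu> pl p where o: "x = (\<lambda>\<tau>. (l \<tau>, \<nu> \<tau>, pl \<tau>, p \<tau>))"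
    "motion (W\<^sub>l c) l pl" "motion (W\<^sub>\<nu> \<mu> c) \<nu> p"
    "\<forall>\<tau>. E\<^sub>l c (l \<tau>) (pl \<tau>) = G" "\<forall>\<tau>. E\<^sub>\<nu> \<mu> c (\<nu> \<tau>) (p \<tau>) = - G"
    "orbit_set x \<noteq> orbit_set (\<lambda>\<tau>. (l' \<tau>, e, pl' \<tau>, 0))"
    by (rule homoclinicE[OF c(1) h \<gamma>(2)])
  have "cos (\<nu> t) \<noteq> cos e" for t
  proof
    assume t: "cos (\<nu> t) = cos e"
    have "2 * (p t)\<^sup>2 = E\<^sub>\<nu> \<mu> c (\<nu> t) (p t) - E\<^sub>\<nu> \<mu> c (\<nu> t) 0" by (simp add: E\<^sub>\<nu>_def)
    also have "\<dots> = 0" using e[OF t] o(5) by simp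
    finally have p: "p t = 0" by simp
    have eq: "\<nu> = (\<lambda>_. \<nu> t)" "p = (\<lambda>_. 0)"
      by (rule motion_\<nu>_unique[OF o(3) motion_const, of _ t]; simp add: e[OF t] p)+
    have "x = (\<lambda>\<tau>. (l \<tau>, \<nu> t, pl \<tau>, 0))"
      unfolding o(1) using fun_cong[OF eq(1)] fun_cong[OF eq(2)] by (intro ext) simp
    then show False
      using o(6) orbit_set_const_angle[OF c o(2) o(4)[rule_format], of "\<nu> t"]
        orbit_set_const_angle[OF c \<gamma>, of e] t by simp
  qed
  then show ?thesis using that[OF o(1-5)] by simp
qed

section \<open>Separatrices within one period of the angle\<close>

lemma angle_window:
  fixes a y :: real
  obtains k :: int where "a \<le> y - 2 * pi * of_int k" "y - 2 * pi * of_int k < a + 2 * pi"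
proof
  let ?k = "\<lfloor>(y - a) / (2 * pi)\<rfloor>"
  have "of_int ?k \<le> (y - a) / (2 * pi)" "(y - a) / (2 * pi) < of_int ?k + 1"
    by (rule of_int_floor_le) linarith
  then have "of_int ?k * (2 * pi) \<le> y - a" "y - a < (of_int ?k + 1) * (2 * pi)"
    by (simp_all only: pos_le_divide_eq pos_divide_less_eq mult_pos_pos zero_less_numeral pi_gt_zero)
  then show "a \<le> y - 2 * pi * of_int ?k" "y - 2 * pi * of_int ?k < a + 2 * pi"
    by (simp_all add: algebra_simps)
qed

lemma motion_inj:
  assumes m: "motion W x p" and p: "\<And>t. p t \<noteq> 0"
  shows "inj x"
proof (rule linorder_injI)
  fix s t :: real assume st: "s < t"
  show "x s \<noteq> x t"
  proof
    assume "x s = x t"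
    then obtain z where "(x has_real_derivative 0) (at z)"
      using Rolle[OF st _ motionD(5)[OF m]] motionD(1)[OF m] real_differentiable_def by blast
    then have "4 * p z = 0" using DERIV_unique[OF motionD(1)[OF m]] by blast
    then show False using p[of z] by simp
  qed
qed

lemma motion_\<nu>_shift_2pi:
  assumes "motion (W\<^sub>\<nu> \<mu> c) \<nu> p"
  shows "motion (W\<^sub>\<nu> \<mu> c) (\<lambda>t. \<nu> t - 2 * pi * of_int k) p"
proof -
  have "sin (z - 2 * pi * of_int k) = sin z \<and> cos (z - 2 * pi * of_int k) = cos z" for z
    unfolding sin_cos_eq_iff by (rule exI[of _ "- k"]) simp
  then show ?thesis
    using assms unfolding motion_def W\<^sub>\<nu>_def by (auto intro!: derivative_eq_intros)
qed

text \<open>The expression assumed positive is 2 p^2 on the level. The motion cannot cross the rest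
  angles \<open>a\<close> and \<open>b\<close>, so it is monotone between them and must tend to
  both.\<close>

lemma separatrix_angle:
  assumes m: "motion (W\<^sub>\<nu> \<mu> c) \<nu> p" and E: "\<And>t. E\<^sub>\<nu> \<mu> c (\<nu> t) (p t) = - G"
    and F: "\<And>z. a < z \<Longrightarrow> z < b \<Longrightarrow> - G - 2 * (1 - 2 * \<mu>) * cos z - c * (cos z)\<^sup>2 > 0"
    and ab: "\<And>t. \<nu> t \<noteq> a" "\<And>t. \<nu> t \<noteq> b" "a < \<nu> 0" "\<nu> 0 < b"
  shows "a < \<nu> t \<and> \<nu> t < b" "inj \<nu>"
    "(\<nu> \<longlongrightarrow> b) at_top \<and> (\<nu> \<longlongrightarrow> a) at_bot \<or> (\<nu> \<longlongrightarrow> a) at_top \<and> (\<nu> \<longlongrightarrow> b) at_bot"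
proof -
  have btw: "a < \<nu> t \<and> \<nu> t < b" for t
    by (rule stays_between[OF motionD(5)[OF m] ab])
  define f where "f = (\<lambda>z. 8 * (- G - 2 * (1 - 2 * \<mu>) * cos z - c * (cos z)\<^sup>2))"
  have p2: "(4 * p t)\<^sup>2 = f (\<nu> t)" for t
    using E[of t] unfolding E\<^sub>\<nu>_def f_def by (simp add: power_mult_distrib algebra_simps)
  show "a < \<nu> t \<and> \<nu> t < b" by (rule btw)
  have "p t \<noteq> 0" for t using p2[of t] F[of "\<nu> t"] btw[of t] by (auto simp: f_def)
  then show "inj \<nu>" by (rule motion_inj[OF m])
  show "(\<nu> \<longlongrightarrow> b) at_top \<and> (\<nu> \<longlongrightarrow> a) at_bot \<or> (\<nu> \<longlongrightarrow> a) at_top \<and> (\<nu> \<longlongrightarrow> b) at_bot"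
  proof (rule separatrix_tendsto[OF m p2 _ _ btw])
    show "continuous_on UNIV f" unfolding f_def by (intro continuous_intros)
    show "0 < f y" if "a < y" "y < b" for y using F[OF that] by (simp add: f_def)
  qed
qed

section \<open>Separatrices of the \<open>\<nu>\<close> motion\<close>

text \<open>\<open>tan (\<nu>/2) = tan (e/2) tanh (\<beta> t)\<close> solves \<open>\<nu>' = \<kappa> (cos \<nu> - cos e)\<close> for \<open>\<beta> = \<kappa> sin e / 2\<close>.\<close>

lemma cos_separatrix_exists:
  assumes e: "0 < e" "e < pi" and \<kappa>: "\<kappa> > 0"
  shows "\<exists>N. N 0 = 0 \<and> (\<forall>t. (N has_real_derivative \<kappa> * (cos (N t) - cos e)) (at t)) \<and>
    (N \<longlongrightarrow> e) at_top \<and> (N \<longlongrightarrow> - e) at_bot"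
proof -
  define b where "b = tan (e / 2)"
  \<comment> \<open>Here (1 + cos e) tan (e/2) = sin e; this form keeps everything rational in
    \<open>b\<close>.\<close>
  define \<beta> where "\<beta> = \<kappa> / 2 * (1 + cos e) * b"
  have b: "b > 0" unfolding b_def using e by (intro tan_gt_zero) auto
  have ce: "cos e = (1 - b\<^sup>2) / (1 + b\<^sup>2)"
  proof -
    have c2: "cos (e / 2) \<noteq> 0" using cos_gt_zero_pi[of "e / 2"] e by auto
    have "cos e = (cos (e / 2))\<^sup>2 - (sin (e / 2))\<^sup>2" using cos_double[of "e / 2"] by simp
    moreover have "(sin (e / 2))\<^sup>2 = b\<^sup>2 * (cos (e / 2))\<^sup>2" using c2 by (simp add: b_def tan_def power_divide)
    moreover have "(cos (e / 2))\<^sup>2 * (1 + b\<^sup>2) = 1"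
      using c2 sin_cos_squared_add[of "e / 2"] \<open>(sin (e / 2))\<^sup>2 = _\<close> by (simp add: algebra_simps)
    ultimately have "cos e * (1 + b\<^sup>2) = 1 - b\<^sup>2" by algebra
    moreover have "1 + b\<^sup>2 > 0" by (simp add: add_pos_nonneg)
    ultimately show ?thesis by (simp add: field_simps)
  qed
  have b2: "1 + b\<^sup>2 > 0" by (simp add: add_pos_nonneg)
  have "1 + cos e > 0" unfolding ce using b2 by (simp add: field_simps)
  then have \<beta>: "\<beta> > 0" using b \<kappa> by (simp add: \<beta>_def)
  define s where "s = (\<lambda>t. b * tanh (\<beta> * t))"
  define N where "N = (\<lambda>t. 2 * arctan (s t))"
  have ds: "(s has_real_derivative b * (1 - (tanh (\<beta> * t))\<^sup>2) * \<beta>) (at t)" for t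
    unfolding s_def by (auto intro!: derivative_eq_intros)
  have cN: "cos (N t) = (1 - (s t)\<^sup>2) / (1 + (s t)\<^sup>2)" for t
  proof -
    have "cos (N t) = 2 * (cos (arctan (s t)))\<^sup>2 - 1" unfolding N_def by (rule cos_double_cos)
    also have "(cos (arctan (s t)))\<^sup>2 = 1 / (1 + (s t)\<^sup>2)"
      by (simp add: cos_arctan power_divide)
    finally show ?thesis using add_pos_nonneg[of 1 "(s t)\<^sup>2"] by (simp add: field_simps)
  qed
  have "(N has_real_derivative \<kappa> * (cos (N t) - cos e)) (at t)" for t
  proof -
    have st: "1 + (s t)\<^sup>2 > 0" by (simp add: add_pos_nonneg)
    have "(N has_real_derivative 2 * (inverse (1 + (s t)\<^sup>2) * (b * (1 - (tanh (\<beta> * t))\<^sup>2) * \<beta>))) (at t)"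
      unfolding N_def by (intro DERIV_cmult DERIV_chain2[OF DERIV_arctan ds])
    also have "2 * (inverse (1 + (s t)\<^sup>2) * (b * (1 - (tanh (\<beta> * t))\<^sup>2) * \<beta>)) =
      \<kappa> * (1 + cos e) * (b\<^sup>2 - (s t)\<^sup>2) / (1 + (s t)\<^sup>2)"
    proof -
      have "2 * (inverse X * (b * (1 - h\<^sup>2) * (\<kappa> / 2 * k * b))) = \<kappa> * k * (b\<^sup>2 - (b * h)\<^sup>2) / X"
        for X h k :: real
        by (cases "X = 0") (simp_all add: field_simps power2_eq_square)
      then show ?thesis unfolding \<beta>_def s_def .
    qed
    also have "\<dots> = \<kappa> * (cos (N t) - cos e)"
    proof -
      have "(1 + (1 - z) / (1 + z)) * (z - S) / (1 + S) = (1 - S) / (1 + S) - (1 - z) / (1 + z)"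
        if "1 + z > 0" "1 + S > 0" for z S :: real
        using that by (simp add: divide_simps) (simp add: algebra_simps)
      from this[OF b2 st] show ?thesis unfolding cN ce
        by (metis mult.assoc times_divide_eq_right)
    qed
    finally show ?thesis .
  qed
  moreover have "(N \<longlongrightarrow> e) at_top \<and> (N \<longlongrightarrow> - e) at_bot"
  proof -
    have \<beta>t: "filterlim (\<lambda>t. \<beta> * t) at_top at_top" "filterlim (\<lambda>t. \<beta> * t) at_bot at_bot"
      using \<beta> by (intro filterlim_tendsto_pos_mult_at_top[OF tendsto_const] filterlim_tendsto_pos_mult_at_bot[OF tendsto_const] filterlim_ident; simp)+
    have "arctan b = e / 2" unfolding b_def using e by (intro arctan_tan) auto
    then have ends: "2 * arctan (b * 1) = e" "2 * arctan (b * - 1) = - e" by (simp_all add: arctan_minus)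
    have "(N \<longlongrightarrow> 2 * arctan (b * 1)) at_top"
      unfolding N_def s_def
      by (intro tendsto_intros filterlim_compose[OF tanh_real_at_top] \<beta>t)
    moreover have "(N \<longlongrightarrow> 2 * arctan (b * - 1)) at_bot"
      unfolding N_def s_def
      by (intro tendsto_intros filterlim_compose[OF tanh_real_at_bot] \<beta>t)
    ultimately show ?thesis unfolding ends by blast
  qed
  moreover have "N 0 = 0" by (simp add: N_def s_def)
  ultimately show ?thesis by blast
qed

text \<open>On the level of the hyperbolic orbit the kinetic term is a perfect square, 2 p^2 = - c
  (cos \<nu> - u)^2. Taking the root gives a first order equation, with \<kappa>^2 = - 8 c because
  \<nu>' = 4 p. Either sign of \<kappa> is allowed.\<close>

lemma motion_if_cos_separatrix:
  assumes "\<kappa>\<^sup>2 = - 8 * c" and cu: "c * u = - (1 - 2 * \<mu>)"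
    and d: "\<And>t. (\<nu> has_real_derivative \<kappa> * (cos (\<nu> t) - u)) (at t)"
  shows "motion (W\<^sub>\<nu> \<mu> c) \<nu> (\<lambda>t. \<kappa> * (cos (\<nu> t) - u) / 4)"
    and "E\<^sub>\<nu> \<mu> c (\<nu> t) (\<kappa> * (cos (\<nu> t) - u) / 4) = (1 - 2 * \<mu>) * u"
proof -
  have m: "1 - 2 * \<mu> = - (c * u)" using cu by simp
  have "((\<lambda>t. \<kappa> * (cos (\<nu> t) - u) / 4) has_real_derivative W\<^sub>\<nu> \<mu> c (\<nu> t)) (at t)" for t
  proof -
    have "((\<lambda>t. \<kappa> * (cos (\<nu> t) - u) / 4) has_real_derivative
      \<kappa> * (- sin (\<nu> t) * (\<kappa> * (cos (\<nu> t) - u))) / 4) (at t)"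
      by (auto intro!: derivative_eq_intros d)
    also have "\<kappa> * (- sin (\<nu> t) * (\<kappa> * (cos (\<nu> t) - u))) / 4 = - \<kappa>\<^sup>2 * (sin (\<nu> t) * (cos (\<nu> t) - u)) / 4"
      by (simp add: power2_eq_square algebra_simps)
    also have "\<dots> = W\<^sub>\<nu> \<mu> c (\<nu> t)"
      unfolding assms(1) W\<^sub>\<nu>_def m by (simp add: field_simps)
    finally show ?thesis .
  qed
  then show "motion (W\<^sub>\<nu> \<mu> c) \<nu> (\<lambda>t. \<kappa> * (cos (\<nu> t) - u) / 4)"
    unfolding motion_def using d by simp
  have "2 * (\<kappa> * (cos (\<nu> t) - u) / 4)\<^sup>2 = - c * (cos (\<nu> t) - u)\<^sup>2"
    by (simp add: power_divide power_mult_distrib assms(1))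
  then show "E\<^sub>\<nu> \<mu> c (\<nu> t) (\<kappa> * (cos (\<nu> t) - u) / 4) = (1 - 2 * \<mu>) * u"
    unfolding E\<^sub>\<nu>_def m by (simp add: power2_eq_square algebra_simps)
qed

lemma hyperbolic_separatrices:
  assumes c: "c < 0" and e: "0 < e" "e < pi" and cu: "c * cos e = - (1 - 2 * \<mu>)"
  shows "\<exists>\<nu> p. motion (W\<^sub>\<nu> \<mu> c) \<nu> p \<and> (\<forall>t. E\<^sub>\<nu> \<mu> c (\<nu> t) (p t) = (1 - 2 * \<mu>) * cos e) \<and>
      \<nu> 0 = 0 \<and> (\<nu> \<longlongrightarrow> e) at_top \<and> (\<nu> \<longlongrightarrow> - e) at_bot"
    "\<exists>\<nu> p. motion (W\<^sub>\<nu> \<mu> c) \<nu> p \<and> (\<forall>t. E\<^sub>\<nu> \<mu> c (\<nu> t) (p t) = (1 - 2 * \<mu>) * cos e) \<and>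
      \<nu> 0 = pi \<and> (\<nu> \<longlongrightarrow> 2 * pi - e) at_top \<and> (\<nu> \<longlongrightarrow> e) at_bot"
proof -
  define \<kappa> where "\<kappa> = sqrt (- 8 * c)"
  have \<kappa>: "\<kappa> > 0" "\<kappa>\<^sup>2 = - 8 * c" "(- \<kappa>)\<^sup>2 = - 8 * c" using c by (simp_all add: \<kappa>_def)
  obtain N where N: "N 0 = 0" "\<forall>t. (N has_real_derivative \<kappa> * (cos (N t) - cos e)) (at t)"
    "(N \<longlongrightarrow> e) at_top" "(N \<longlongrightarrow> - e) at_bot"
    using cos_separatrix_exists[OF e \<kappa>(1)] by (elim exE conjE) (rule that)
  show "\<exists>\<nu> p. motion (W\<^sub>\<nu> \<mu> c) \<nu> p \<and> (\<forall>t. E\<^sub>\<nu> \<mu> c (\<nu> t) (p t) = (1 - 2 * \<mu>) * cos e) \<and>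
      \<nu> 0 = 0 \<and> (\<nu> \<longlongrightarrow> e) at_top \<and> (\<nu> \<longlongrightarrow> - e) at_bot"
    by (rule exI[of _ N], rule exI[of _ "\<lambda>t. \<kappa> * (cos (N t) - cos e) / 4"], intro conjI allI N
        motion_if_cos_separatrix[OF \<kappa>(2) cu N(2)[rule_format]])
  \<comment> \<open>The separatrix through \<pi> is the one through 0 with \<open>pi - e\<close> for
    \<open>e\<close>, translated by \<pi>; both cosines change sign, so \<kappa> does too.\<close>
  have e': "0 < pi - e" "pi - e < pi" using e by auto
  obtain M where M: "M 0 = 0" "\<forall>t. (M has_real_derivative \<kappa> * (cos (M t) - cos (pi - e))) (at t)"
    "(M \<longlongrightarrow> pi - e) at_top" "(M \<longlongrightarrow> - (pi - e)) at_bot"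
    using cos_separatrix_exists[OF e' \<kappa>(1)] by (elim exE conjE) (rule that)
  have d: "((\<lambda>t. pi + M t) has_real_derivative - \<kappa> * (cos (pi + M t) - cos e)) (at t)" for t
    using DERIV_add[OF DERIV_const[of pi] M(2)[rule_format, of t]] by (simp add: cos_diff cos_add algebra_simps)
  have "((\<lambda>t. pi + M t) \<longlongrightarrow> pi + (pi - e)) at_top" "((\<lambda>t. pi + M t) \<longlongrightarrow> pi + - (pi - e)) at_bot"
    by (intro tendsto_intros M)+
  then have lim: "((\<lambda>t. pi + M t) \<longlongrightarrow> 2 * pi - e) at_top" "((\<lambda>t. pi + M t) \<longlongrightarrow> e) at_bot"
    by simp_all
  show "\<exists>\<nu> p. motion (W\<^sub>\<nu> \<mu> c) \<nu> p \<and> (\<forall>t. E\<^sub>\<nu> \<mu> c (\<nu> t) (p t) = (1 - 2 * \<mu>) * cos e) \<and>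
      \<nu> 0 = pi \<and> (\<nu> \<longlongrightarrow> 2 * pi - e) at_top \<and> (\<nu> \<longlongrightarrow> e) at_bot"
    by (rule exI[of _ "\<lambda>t. pi + M t"], rule exI[of _ "\<lambda>t. - \<kappa> * (cos (pi + M t) - cos e) / 4"],
        intro conjI allI lim motion_if_cos_separatrix[OF \<kappa>(3) cu d]) (simp add: M)
qed

text \<open>\<open>cot (\<nu>/2) = - B sinh (\<beta> t)\<close> with \<open>B\<^sup>2 = m / (m + c)\<close>, \<open>\<beta>\<^sup>2 = 8 (m + c)\<close>, \<open>m = 1 - 2 \<mu>\<close>.\<close>

lemma exterior_separatrix:
  assumes c: "c < 0" and m: "1 - 2 * \<mu> + c > 0"
  shows "\<exists>\<nu> p. motion (W\<^sub>\<nu> \<mu> c) \<nu> p \<and> (\<forall>t. E\<^sub>\<nu> \<mu> c (\<nu> t) (p t) = 2 * (1 - 2 * \<mu>) + c) \<and>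
      \<nu> 0 = pi \<and> (\<nu> \<longlongrightarrow> 2 * pi) at_top \<and> (\<nu> \<longlongrightarrow> 0) at_bot"
proof -
  define m where "m = 1 - 2 * \<mu>"
  have mc: "m + c > 0" "m > 0" using c m by (simp_all add: m_def)
  \<comment> \<open>For s = - cot (\<nu>/2) the energy relation becomes s'^2 = 8 (m + (m + c) s^2),
    hence s'' = \<beta>^2 s. With s(0) = 0 the solution is B sinh (\<beta> t), and s'(0)^2 = 8 m
    fixes B.\<close>
  define B where "B = sqrt (m / (m + c))"
  define \<beta> where "\<beta> = sqrt (8 * (m + c))"
  have B: "B > 0" "B\<^sup>2 = m / (m + c)" and \<beta>: "\<beta> > 0" "\<beta>\<^sup>2 = 8 * (m + c)"
    using mc by (simp_all add: B_def \<beta>_def)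
  define s where "s = (\<lambda>t. B * sinh (\<beta> * t))"
  define s' where "s' = (\<lambda>t. B * \<beta> * cosh (\<beta> * t))"
  have ds: "(s has_real_derivative s' t) (at t)" for t
    unfolding s_def s'_def by (auto intro!: derivative_eq_intros)
  have ds': "(s' has_real_derivative \<beta>\<^sup>2 * s t) (at t)" for t
    unfolding s_def s'_def by (auto intro!: derivative_eq_intros simp: power2_eq_square)
  have s'2: "(s' t)\<^sup>2 = 8 * (m + (m + c) * (s t)\<^sup>2)" for t
  proof -
    have "(s' t)\<^sup>2 = \<beta>\<^sup>2 * (B\<^sup>2 + (s t)\<^sup>2)"
      by (simp add: s_def s'_def power_mult_distrib cosh_square_eq algebra_simps)
    also have "\<dots> = 8 * ((m + c) * B\<^sup>2 + (m + c) * (s t)\<^sup>2)" by (simp add: \<beta> algebra_simps)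
    also have "(m + c) * B\<^sup>2 = m" using mc by (simp add: B)
    finally show ?thesis .
  qed
  define \<nu> where "\<nu> = (\<lambda>t. pi + 2 * arctan (s t))"
  define p where "p = (\<lambda>t. s' t / (2 * (1 + (s t)\<^sup>2)))"
  have st: "1 + (s t)\<^sup>2 > 0" for t by (simp add: add_pos_nonneg)
  have trig: "cos (\<nu> t) = ((s t)\<^sup>2 - 1) / (1 + (s t)\<^sup>2)" "sin (\<nu> t) = - 2 * s t / (1 + (s t)\<^sup>2)" for t
  proof -
    have sq: "(sqrt (1 + (s t)\<^sup>2))\<^sup>2 = 1 + (s t)\<^sup>2" using st[of t] by simp
    have "cos (\<nu> t) = 1 - 2 * (cos (arctan (s t)))\<^sup>2"
      unfolding \<nu>_def using cos_double_cos[of "arctan (s t)"] by (simp add: cos_add)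
    also have "(cos (arctan (s t)))\<^sup>2 = 1 / (1 + (s t)\<^sup>2)" by (simp add: cos_arctan power_divide)
    finally show "cos (\<nu> t) = ((s t)\<^sup>2 - 1) / (1 + (s t)\<^sup>2)" using st[of t] by (simp add: field_simps)
    have "sin (\<nu> t) = - 2 * sin (arctan (s t)) * cos (arctan (s t))"
      unfolding \<nu>_def using sin_double[of "arctan (s t)"] by (simp add: sin_add)
    also have "\<dots> = - 2 * s t / (sqrt (1 + (s t)\<^sup>2))\<^sup>2"
      by (simp add: cos_arctan sin_arctan power2_eq_square)
    finally show "sin (\<nu> t) = - 2 * s t / (1 + (s t)\<^sup>2)" by (simp only: sq)
  qed
  have d\<nu>: "(\<nu> has_real_derivative 4 * p t) (at t)" for t
  proof -
    have "(\<nu> has_real_derivative 0 + 2 * (inverse (1 + (s t)\<^sup>2) * s' t)) (at t)"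
      unfolding \<nu>_def by (intro DERIV_add DERIV_const DERIV_cmult DERIV_chain2[OF DERIV_arctan ds])
    also have "0 + 2 * (inverse (1 + (s t)\<^sup>2) * s' t) = 4 * p t"
      unfolding p_def using st[of t] by (simp add: field_simps)
    finally show ?thesis .
  qed
  have dp: "(p has_real_derivative W\<^sub>\<nu> \<mu> c (\<nu> t)) (at t)" for t
  proof -
    have d2: "((\<lambda>t. 2 * (1 + (s t)\<^sup>2)) has_real_derivative 4 * s t * s' t) (at t)"
      by (auto intro!: derivative_eq_intros ds)
    have "(p has_real_derivative (\<beta>\<^sup>2 * s t * (2 * (1 + (s t)\<^sup>2)) - s' t * (4 * s t * s' t))
        / (2 * (1 + (s t)\<^sup>2) * (2 * (1 + (s t)\<^sup>2)))) (at t)"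
      unfolding p_def using st[of t] by (intro DERIV_divide ds' d2) simp
    also have "\<beta>\<^sup>2 * s t * (2 * (1 + (s t)\<^sup>2)) - s' t * (4 * s t * s' t)
      = 2 * s t * (\<beta>\<^sup>2 * (1 + (s t)\<^sup>2) - 2 * (s' t)\<^sup>2)" by (simp add: power2_eq_square algebra_simps)
    also have "\<dots> = 16 * s t * (c - m - (m + c) * (s t)\<^sup>2)"
      unfolding \<beta> s'2 by (simp add: algebra_simps)
    also have "16 * s t * (c - m - (m + c) * (s t)\<^sup>2) / (2 * (1 + (s t)\<^sup>2) * (2 * (1 + (s t)\<^sup>2)))
      = W\<^sub>\<nu> \<mu> c (\<nu> t)"
    proof -
      have "W\<^sub>\<nu> \<mu> c (\<nu> t) = 2 * sin (\<nu> t) * (m + c * cos (\<nu> t))"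
        by (simp add: W\<^sub>\<nu>_def m_def algebra_simps)
      also have "m + c * cos (\<nu> t) = (m * (1 + (s t)\<^sup>2) + c * ((s t)\<^sup>2 - 1)) / (1 + (s t)\<^sup>2)"
        unfolding trig using st[of t] by (simp add: field_simps)
      finally show ?thesis unfolding trig using st[of t] by (simp add: divide_simps) (simp add: algebra_simps)
    qed
    finally show ?thesis .
  qed
  have mot: "motion (W\<^sub>\<nu> \<mu> c) \<nu> p" using d\<nu> dp by (simp add: motion_def)
  have s0: "s 0 = 0" by (simp add: s_def)
  have E0: "E\<^sub>\<nu> \<mu> c (\<nu> 0) (p 0) = 2 * m + c"
  proof -
    have "(p 0)\<^sup>2 = (s' 0)\<^sup>2 / 4" by (simp add: p_def s0 power_divide)
    also have "\<dots> = 2 * m" unfolding s'2 by (simp add: s0)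
    finally show ?thesis by (simp add: E\<^sub>\<nu>_def m_def trig s0)
  qed
  have "(\<nu> \<longlongrightarrow> pi + 2 * (pi / 2)) at_top" "(\<nu> \<longlongrightarrow> pi + 2 * (- (pi / 2))) at_bot"
  proof -
    have \<beta>t: "filterlim (\<lambda>t. \<beta> * t) at_top at_top" "filterlim (\<lambda>t. \<beta> * t) at_bot at_bot"
      using \<beta> by (intro filterlim_tendsto_pos_mult_at_top[OF tendsto_const] filterlim_tendsto_pos_mult_at_bot[OF tendsto_const] filterlim_ident; simp)+
    have "filterlim s at_top at_top" "filterlim s at_bot at_bot"
      unfolding s_def using B(1)
      by (intro filterlim_tendsto_pos_mult_at_top[OF tendsto_const] filterlim_tendsto_pos_mult_at_bot[OF tendsto_const]
        filterlim_compose[OF sinh_real_at_top] filterlim_compose[OF sinh_real_at_bot] \<beta>t; simp)+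
    note * = filterlim_compose[OF tendsto_arctan_at_top this(1)] filterlim_compose[OF tendsto_arctan_at_bot this(2)]
    show "(\<nu> \<longlongrightarrow> pi + 2 * (pi / 2)) at_top" "(\<nu> \<longlongrightarrow> pi + 2 * (- (pi / 2))) at_bot"
      unfolding \<nu>_def by (rule tendsto_add tendsto_mult tendsto_const *)+
  qed
  then have lim: "(\<nu> \<longlongrightarrow> 2 * pi) at_top" "(\<nu> \<longlongrightarrow> 0) at_bot" by simp_all
  show ?thesis
  proof (rule exI[of _ \<nu>], rule exI[of _ p], intro conjI allI mot lim)
    show "E\<^sub>\<nu> \<mu> c (\<nu> t) (p t) = 2 * (1 - 2 * \<mu>) + c" for t
      using motion_energy(2)[OF mot, of t 0] E0 by (simp add: m_def)
    show "\<nu> 0 = pi" by (simp add: \<nu>_def s0)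
  qed
qed

section \<open>The three families\<close>

lemma earth_eq: "earth = - moon"
  by (simp add: earth_def moon_def complex_eq_iff)

lemma position_comp:
  "position \<circ> (\<lambda>\<tau>. (l \<tau>, \<nu> \<tau>, pl \<tau>, p\<nu> \<tau>)) = (\<lambda>\<tau>. elliptic (l \<tau>) (\<nu> \<tau>))"
  by (simp add: position_def fun_eq_iff)

text \<open>A given lift of \<gamma> may rest at - e instead of e, modulo 2 \<pi>; the factor
  \<sigma> absorbs this into the sign of \<lambda>.\<close>

lemma elliptic_base:
  assumes "cos z = cos e"
  obtains \<sigma> :: real where "\<sigma> = 1 \<or> \<sigma> = - 1" "\<forall>l. elliptic l z = elliptic (\<sigma> * l) e"
proof -
  obtain k :: int where "z = e + 2 * pi * of_int k \<or> z = - e + 2 * pi * of_int k"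
    using cos_eq_cos_cases[OF assms] by blast
  then show ?thesis
  proof
    assume "z = e + 2 * pi * of_int k"
    then show ?thesis by (intro that[of 1]) (simp_all add: elliptic_symmetries(3))
  next
    assume "z = - e + 2 * pi * of_int k"
    moreover have "elliptic l (- e + 2 * pi * of_int k) = elliptic (- 1 * l) e" for l
      unfolding elliptic_symmetries(3) elliptic_symmetries(2) by simp
    ultimately show ?thesis by (intro that[of "- 1"]) simp_all
  qed
qed

section \<open>The hyperbolic orbit\<close>

text \<open>In elliptic coordinates, \<open>(l, \<nu>) \<mapsto> (l, \<nu> - \<pi>)\<close> is the point reflection that exchanges the
  primaries, so only passages through the axis beyond the Moon have to be treated.\<close>

lemma hyperbolic_rotation:
  assumes c: "c < 0" "G + 2 + c > 0" and e: "0 < e" "e < pi"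
    and G: "G = - ((1 - 2 * \<mu>) * cos e)" and cu: "c * cos e = - (1 - 2 * \<mu>)"
    and \<gamma>: "motion (W\<^sub>l c) l' pl'" "\<And>\<tau>. E\<^sub>l c (l' \<tau>) (pl' \<tau>) = G" and z: "cos z = cos e"
    and h: "homoclinic \<mu> c (\<lambda>\<tau>. (l' \<tau>, z, pl' \<tau>, 0)) x" and nc: "non_collision x"
  shows "(\<exists>n\<in>{1, -1}. turns moon (\<lambda>\<tau>. (l' \<tau>, z, pl' \<tau>, 0)) x n) \<and> turns earth (\<lambda>\<tau>. (l' \<tau>, z, pl' \<tau>, 0)) x 0 \<or>
    (\<exists>n\<in>{1, -1}. turns earth (\<lambda>\<tau>. (l' \<tau>, z, pl' \<tau>, 0)) x n) \<and> turns moon (\<lambda>\<tau>. (l' \<tau>, z, pl' \<tau>, 0)) x 0"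
proof -
  have m: "1 - 2 * \<mu> = - (c * cos e)" using cu by simp
  have F: "- G - 2 * (1 - 2 * \<mu>) * cos y - c * (cos y)\<^sup>2 = - c * (cos y - cos e)\<^sup>2" for y
    unfolding G m by (simp add: power2_eq_square algebra_simps)
  have eq: "E\<^sub>\<nu> \<mu> c y 0 = - G \<and> W\<^sub>\<nu> \<mu> c y = 0" if "cos y = cos z" for y
    using F[of y] m that z by (simp add: E\<^sub>\<nu>_def W\<^sub>\<nu>_def)
  obtain l \<nu> pl p where x: "x = (\<lambda>\<tau>. (l \<tau>, \<nu> \<tau>, pl \<tau>, p \<tau>))"
    and ml: "motion (W\<^sub>l c) l pl" and m\<nu>: "motion (W\<^sub>\<nu> \<mu> c) \<nu> p"
    and El: "\<forall>\<tau>. E\<^sub>l c (l \<tau>) (pl \<tau>) = G" and E\<nu>: "\<forall>\<tau>. E\<^sub>\<nu> \<mu> c (\<nu> \<tau>) (p \<tau>) = - G"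
    and ne: "\<forall>\<tau>. cos (\<nu> \<tau>) \<noteq> cos z"
    by (rule const_angle_homoclinicE[OF c \<gamma> eq h])
  obtain \<sigma> :: real where \<sigma>: "\<sigma> = 1 \<or> \<sigma> = - 1" "\<forall>l. elliptic l z = elliptic (\<sigma> * l) e"
    by (rule elliptic_base[OF z])
  obtain R where R: "0 \<le> R" "\<And>l p. E\<^sub>l c l p = G \<Longrightarrow> \<bar>l\<bar> \<le> R \<and> \<bar>p\<bar> \<le> R"
    using energy_level_bounded[OF c(1), of G] by blast
  have lR: "\<bar>l t\<bar> \<le> R" for t using R(2)[OF El[rule_format]] by blast
  have cov: "\<exists>s. \<rho> * l' s = y" if "\<rho> = 1 \<or> \<rho> = - 1" "y = l t \<or> y = - l t" for \<rho> y t
  proof -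
    have "E\<^sub>l c (\<rho> * y) (pl t) = G"
      using that El by (auto simp: E\<^sub>l_uminus)
    then obtain s where "l' s = \<rho> * y" using oscillation_covers[OF c \<gamma>] by blast
    then show ?thesis using that(1) by (intro exI[of _ s]) auto
  qed
  \<comment> \<open>A period starting at - e is split by the rest angle e into two intervals: one
    around \<nu> = 0, where the Moon is passed, and one around \<nu> = \<pi>, where the Earth
    is.\<close>
  obtain k :: int where k: "- e \<le> \<nu> 0 - 2 * pi * of_int k" "\<nu> 0 - 2 * pi * of_int k < - e + 2 * pi"
    by (rule angle_window)
  define N where "N = (\<lambda>t. \<nu> t - 2 * pi * of_int k)"
  have mN: "motion (W\<^sub>\<nu> \<mu> c) N p" unfolding N_def by (rule motion_\<nu>_shift_2pi[OF m\<nu>])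
  have cN: "cos (N t) = cos (\<nu> t)" for t
    using sin_cos_eq_iff[of "\<nu> t" "N t"] unfolding N_def by (metis diff_add_cancel)
  have EN: "E\<^sub>\<nu> \<mu> c (N t) (p t) = - G" for t using E\<nu> unfolding E\<^sub>\<nu>_def cN by blast
  have eN: "elliptic (l t) (\<nu> t) = elliptic (l t) (N t)" for t
    using elliptic_symmetries(3)[of "l t" "N t" k] by (simp add: N_def)
  have neN: "N t \<noteq> e" "N t \<noteq> - e" "N t \<noteq> 2 * pi - e" for t
    using ne[rule_format, of t] z unfolding cN[symmetric] by (auto simp: cos_diff)
  have nz: "l t \<noteq> 0" if "cos (N t) = 1 \<or> cos (N t) = - 1" for t
  proof
    assume "l t = 0"
    then have "elliptic (l t) (\<nu> t) = earth \<or> elliptic (l t) (\<nu> t) = moon"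
      using that by (auto simp: collision_iff cN)
    then show False using nc unfolding non_collision_def collides_def x position_def by auto
  qed
  note cl = motionD(5)[OF ml] and cL = motionD(5)[OF \<gamma>(1)] and cNu = motionD(5)[OF mN]
  have g: "position \<circ> (\<lambda>\<tau>. (l' \<tau>, z, pl' \<tau>, 0)) = (\<lambda>\<tau>. elliptic (\<sigma> * l' \<tau>) e)"
    by (simp add: position_def fun_eq_iff \<sigma>(2)[rule_format])
  have q: "position \<circ> x = (\<lambda>\<tau>. elliptic (l \<tau>) (N \<tau>))"
    unfolding x position_comp eN ..
  consider "- e < N 0" "N 0 < e" | "e < N 0" "N 0 < 2 * pi - e"
    using k neN[of 0] unfolding N_def by linarith
  then show ?thesis
  proof cases
    case 1
    have pos: "0 < - G - 2 * (1 - 2 * \<mu>) * cos y - c * (cos y)\<^sup>2" if "- e < y" "y < e" for y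
    proof -
      have "cos e < cos \<bar>y\<bar>" using that e by (intro cos_monotone_0_pi) auto
      then show ?thesis using c unfolding F by (auto intro!: mult_neg_pos)
    qed
    note sep = separatrix_angle[OF mN EN pos neN(2,1) 1]
    have cont: "continuous_on UNIV (\<lambda>\<tau>. \<sigma> * l' \<tau>)" by (intro continuous_intros cL)
    have cv: "\<exists>s. \<sigma> * l' s = l t" "\<exists>s. \<sigma> * l' s = - l t" for t
      using cov[OF \<sigma>(1)] by blast+
    have "\<exists>n\<in>{1, -1}. winds moon (\<lambda>\<tau>. elliptic (\<sigma> * l' \<tau>) e) (\<lambda>\<tau>. elliptic (l \<tau>) (N \<tau>)) n"
      by (rule winds_moon[OF e(1) less_imp_le[OF e(2)] cl cNu cont lR sep nz cv]) simp_all
    moreover have "winds earth (\<lambda>\<tau>. elliptic (\<sigma> * l' \<tau>) e) (\<lambda>\<tau>. elliptic (l \<tau>) (N \<tau>)) 0"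
      by (rule winds_earth_zero[OF e cl cNu cont lR sep(1,3) cv])
    ultimately show ?thesis unfolding turns_iff_winds g q by blast
  next
    case 2
    have pos: "0 < - G - 2 * (1 - 2 * \<mu>) * cos y - c * (cos y)\<^sup>2" if "e < y" "y < 2 * pi - e" for y
    proof -
      have "cos (pi - e) < cos \<bar>y - pi\<bar>" using that e by (intro cos_monotone_0_pi) auto
      then have "cos y \<noteq> cos e" by (simp add: cos_diff)
      then show ?thesis using c unfolding F by (auto intro!: mult_neg_pos)
    qed
    note sep = separatrix_angle[OF mN EN pos neN(1,3) 2]
    define e' where "e' = pi - e"
    have e': "0 < e'" "e' < pi" using e by (simp_all add: e'_def)
    define M where "M = (\<lambda>t. N t - pi)"
    have cM: "continuous_on UNIV M" unfolding M_def by (intro continuous_intros cNu)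
    have iM: "inj M" using sep(2) by (auto simp: M_def inj_def)
    have bM: "- e' < M t \<and> M t < e'" for t using sep(1)[of t] by (auto simp: M_def e'_def)
    have limM: "(M \<longlongrightarrow> e') at_top \<and> (M \<longlongrightarrow> - e') at_bot \<or> (M \<longlongrightarrow> - e') at_top \<and> (M \<longlongrightarrow> e') at_bot"
    proof -
      have "(M \<longlongrightarrow> e') f" if "(N \<longlongrightarrow> 2 * pi - e) f" for f
        using tendsto_diff[OF that tendsto_const[of pi]] by (simp add: M_def[abs_def] e'_def)
      moreover have "(M \<longlongrightarrow> - e') f" if "(N \<longlongrightarrow> e) f" for f
        using tendsto_diff[OF that tendsto_const[of pi]] by (simp add: M_def[abs_def] e'_def)
      ultimately show ?thesis using sep(3) by blast
    qed
    have nzM: "l t \<noteq> 0" if "M t = 0" for t using nz[of t] that by (simp add: M_def)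
    \<comment> \<open>Subtracting \<pi> moves the rest angle e to - e'; returning to e' reverses
      \<lambda>, hence the new sign.\<close>
    have \<sigma>': "- \<sigma> = 1 \<or> - \<sigma> = - 1" using \<sigma>(1) by auto
    have cont: "continuous_on UNIV (\<lambda>\<tau>. - \<sigma> * l' \<tau>)" by (intro continuous_intros cL)
    have cv: "\<exists>s. - \<sigma> * l' s = l t" "\<exists>s. - \<sigma> * l' s = - l t" for t
      using cov[OF \<sigma>'] by blast+
    have g': "elliptic (\<sigma> * l' \<tau>) e = - elliptic (- \<sigma> * l' \<tau>) e'" for \<tau>
    proof -
      have "- elliptic (\<sigma> * l' \<tau>) e = elliptic (- (\<sigma> * l' \<tau>)) e'"
        using elliptic_symmetries(4)[of "\<sigma> * l' \<tau>" e] elliptic_symmetries(2)[of "\<sigma> * l' \<tau>" e']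
        by (simp add: e'_def)
      from arg_cong[OF this, of uminus] show ?thesis by simp
    qed
    have q': "elliptic (l \<tau>) (N \<tau>) = - elliptic (l \<tau>) (M \<tau>)" for \<tau>
      using elliptic_symmetries(4)[of "l \<tau>" "N \<tau>"] by (simp add: M_def)
    have "\<exists>n\<in>{1, -1}. winds moon (\<lambda>\<tau>. elliptic (- \<sigma> * l' \<tau>) e') (\<lambda>\<tau>. elliptic (l \<tau>) (M \<tau>)) n"
      by (rule winds_moon[OF e'(1) less_imp_le[OF e'(2)] cl cM cont lR bM iM limM nzM cv])
    then have "\<exists>n\<in>{1, -1}. winds earth (\<lambda>\<tau>. elliptic (\<sigma> * l' \<tau>) e) (\<lambda>\<tau>. elliptic (l \<tau>) (N \<tau>)) n"
      unfolding g' q' earth_eq using winds_uminus by blast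
    moreover have "winds earth (\<lambda>\<tau>. elliptic (- \<sigma> * l' \<tau>) e') (\<lambda>\<tau>. elliptic (l \<tau>) (M \<tau>)) 0"
      by (rule winds_earth_zero[OF e' cl cM cont lR bM limM cv])
    then have "winds (- earth) (\<lambda>\<tau>. - elliptic (- \<sigma> * l' \<tau>) e') (\<lambda>\<tau>. - elliptic (l \<tau>) (M \<tau>)) 0"
      by (rule winds_uminus)
    then have "winds moon (\<lambda>\<tau>. elliptic (\<sigma> * l' \<tau>) e) (\<lambda>\<tau>. elliptic (l \<tau>) (N \<tau>)) 0"
      unfolding g' q' by (simp add: earth_eq)
    ultimately show ?thesis unfolding turns_iff_winds g q by blast
  qed
qed

lemma hyperbolic_part:
  assumes \<mu>: "0 < \<mu>" "\<mu> \<le> 1/2" and cJ: "c_J \<mu> < c" and ch: "c < c_h \<mu>"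
  shows "(\<exists>\<gamma>. hyperbolic_orbit \<mu> c \<gamma>) \<and>
        (\<forall>\<gamma>. hyperbolic_orbit \<mu> c \<gamma> \<longrightarrow>
          (\<exists>x. homoclinic \<mu> c \<gamma> x \<and> collides x earth) \<and>
          (\<exists>x. homoclinic \<mu> c \<gamma> x \<and> collides x moon) \<and>
          (\<forall>x. homoclinic \<mu> c \<gamma> x \<and> non_collision x \<longrightarrow>
             rotates_once earth \<gamma> x \<and> turns moon \<gamma> x 0 \<or>
             rotates_once moon \<gamma> x \<and> turns earth \<gamma> x 0))"
proof -
  define m where "m = 1 - 2 * \<mu>"
  have m: "0 \<le> m" "m < - c" using \<mu> ch by (simp_all add: m_def c_h_def)
  then have c: "c < 0" by linarith
  define u where "u = - m / c"
  have u: "0 \<le> u" "u < 1" "c * u = - m" using m c by (simp_all add: u_def field_simps)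
  define e where "e = arccos u"
  have ce: "cos e = u" unfolding e_def using u by (intro cos_arccos) auto
  have e: "0 < e" "e < pi" unfolding e_def using u by (intro arccos_lt_bounded[THEN conjunct1] arccos_lt_bounded[THEN conjunct2]; simp)+
  define G where "G = - (m * u)"
  \<comment> \<open>Since c cos e = - m, c (G + 2 + c) equals (1 + c)^2 - 4 \<mu> (1 - \<mu>), which
    is negative iff |1 + c| < 2 w. The lower bound on 1 + c is the condition at \<open>c_J\<close>;
    the upper one follows from c < \<open>c_h\<close>, as 1 + c < 2 \<mu> and \<mu> <= w.\<close>
  have cG: "G + 2 + c > 0"
  proof -
    define w where "w = sqrt (\<mu> * (1 - \<mu>))"
    have w2: "w\<^sup>2 = \<mu> * (1 - \<mu>)" unfolding w_def using \<mu> by simp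
    have "\<mu> * \<mu> \<le> \<mu> * (1 - \<mu>)" using \<mu> by (intro mult_left_mono) auto
    then have "\<mu> \<le> w" unfolding w_def using \<mu> by (simp add: real_le_rsqrt power2_eq_square)
    then have b: "1 + c < 2 * w" "- (2 * w) < 1 + c"
      using m(2) cJ by (simp_all add: m_def c_J_def w_def)
    then have "\<bar>1 + c\<bar> < 2 * w" by linarith
    then have "(1 + c)\<^sup>2 < (2 * w)\<^sup>2" by (metis abs_ge_zero power2_abs power_strict_mono zero_less_numeral)
    also have "(2 * w)\<^sup>2 = 4 * w\<^sup>2" by (simp add: power_mult_distrib)
    also have "\<dots> = 1 - m\<^sup>2" unfolding w2 m_def by (simp add: power2_eq_square algebra_simps)
    finally have "1 + 2 * c + c\<^sup>2 + m\<^sup>2 < 1" by (simp add: power2_eq_square algebra_simps)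
    moreover have "c * (G + 2 + c) = - (m * (c * u)) + 2 * c + c\<^sup>2"
      by (simp add: G_def power2_eq_square algebra_simps)
    ultimately have "c * (G + 2 + c) < 0"
      unfolding u(3) by (simp add: power2_eq_square)
    then show ?thesis using c by (simp add: mult_less_0_iff)
  qed
  have G: "G = - ((1 - 2 * \<mu>) * cos e)" and cu: "c * cos e = - (1 - 2 * \<mu>)"
    using u(3) by (simp_all add: G_def m_def ce)
  have eqE: "E\<^sub>\<nu> \<mu> c z 0 = - G" "W\<^sub>\<nu> \<mu> c z = 0" if "cos z = u" for z
  proof -
    have "c * u\<^sup>2 = (c * u) * u" by (simp add: power2_eq_square)
    also have "\<dots> = - m * u" by (simp only: u(3))
    finally have "c * u\<^sup>2 = - m * u" .
    then show "E\<^sub>\<nu> \<mu> c z 0 = - G" using that by (simp add: E\<^sub>\<nu>_def G_def m_def[symmetric])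
    have "W\<^sub>\<nu> \<mu> c z = 2 * sin z * (m + c * u)" by (simp add: W\<^sub>\<nu>_def that m_def algebra_simps)
    then show "W\<^sub>\<nu> \<mu> c z = 0" by (simp add: u(3))
  qed
  obtain l0 pl0 where o: "motion (W\<^sub>l c) l0 pl0" "\<forall>t. E\<^sub>l c (l0 t) (pl0 t) = G"
    "\<forall>y q. E\<^sub>l c y q = G \<longrightarrow> (\<exists>t. l0 t = y \<and> pl0 t = q)"
    using oscillation_exists[OF c cG] by (elim exE conjE) (rule that)
  have dist: "cmod (position (l, \<nu>, pl, p) - earth) - cmod (position (l, \<nu>, pl, p) - moon) = cos \<nu>" for l \<nu> pl p
    by (simp add: position_def elliptic_dist_earth elliptic_dist_moon field_simps)
  have hyp: "- (1 - 2 * \<mu>) / c = u" by (simp add: u_def m_def)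
  have ex: "\<exists>\<gamma>. hyperbolic_orbit \<mu> c \<gamma>"
  proof
    show "hyperbolic_orbit \<mu> c (\<lambda>\<tau>. (l0 \<tau>, e, pl0 \<tau>, 0))"
      unfolding hyperbolic_orbit_def dist hyp
      using regularized_orbitI[OF o(1) motion_const o(2)[rule_format]] eqE[OF ce] ce by simp
  qed
  obtain l1 pl1 where l1: "motion (W\<^sub>l c) l1 pl1" "\<forall>t. E\<^sub>l c (l1 t) (pl1 t) = G" "l1 0 = 0"
    using oscillation_through_zero[OF c cG] by (elim exE conjE) (rule that)
  have "(\<exists>x. homoclinic \<mu> c \<gamma> x \<and> collides x earth) \<and> (\<exists>x. homoclinic \<mu> c \<gamma> x \<and> collides x moon) \<and>
     (\<forall>x. homoclinic \<mu> c \<gamma> x \<and> non_collision x \<longrightarrow>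
        rotates_once earth \<gamma> x \<and> turns moon \<gamma> x 0 \<or> rotates_once moon \<gamma> x \<and> turns earth \<gamma> x 0)"
    if \<gamma>: "hyperbolic_orbit \<mu> c \<gamma>" for \<gamma>
  proof -
    have r: "regularized_orbit \<mu> c \<gamma>" using \<gamma> by (simp add: hyperbolic_orbit_def)
    obtain l \<nu> pl p G' where g: "\<gamma> = (\<lambda>\<tau>. (l \<tau>, \<nu> \<tau>, pl \<tau>, p \<tau>))"
      "motion (W\<^sub>l c) l pl" "motion (W\<^sub>\<nu> \<mu> c) \<nu> p"
      "\<forall>\<tau>. E\<^sub>l c (l \<tau>) (pl \<tau>) = G'" "\<forall>\<tau>. E\<^sub>\<nu> \<mu> c (\<nu> \<tau>) (p \<tau>) = - G'"
      by (rule regularized_orbitE[OF r])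
    have cos\<nu>: "cos (\<nu> t) = u" for t
      using \<gamma> unfolding hyperbolic_orbit_def g(1) dist hyp by blast
    define z where "z = \<nu> 0"
    have \<nu>: "\<nu> = (\<lambda>_. z)" "p = (\<lambda>_. 0)"
      using motion_cos_const[OF g(3) cos\<nu>] by (auto simp: z_def fun_eq_iff)
    have z: "cos z = cos e" using cos\<nu>[of 0] by (simp add: z_def ce)
    have "G' = G" using g(5)[rule_format, of 0] eqE(1)[of z] z unfolding \<nu> ce by simp
    then have El: "E\<^sub>l c (l \<tau>) (pl \<tau>) = G" for \<tau> using g(4) by blast
    have \<gamma>eq: "\<gamma> = (\<lambda>\<tau>. (l \<tau>, z, pl \<tau>, 0))" unfolding g(1) \<nu> ..
    have Ez: "E\<^sub>\<nu> \<mu> c z 0 = - G" using eqE(1) z ce by simp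
    \<comment> \<open>A separatrix at angle y at time 0 is paired with the \<lambda> phase that
      vanishes at time 0, so the orbit passes through \<open>elliptic 0 y\<close>, a primary for y =
      0 and y = \<pi>.\<close>
    have hom: "\<exists>x. homoclinic \<mu> c \<gamma> x \<and> collides x (elliptic 0 y)"
      if ex: "\<exists>N q. motion (W\<^sub>\<nu> \<mu> c) N q \<and> (\<forall>t. E\<^sub>\<nu> \<mu> c (N t) (q t) = (1 - 2 * \<mu>) * cos e) \<and>
        N 0 = y \<and> (N \<longlongrightarrow> e1) at_top \<and> (N \<longlongrightarrow> e2) at_bot" "cos y \<noteq> cos e" "cos e1 = cos e" "cos e2 = cos e"
      for y e1 e2
    proof -
      obtain N q where N: "motion (W\<^sub>\<nu> \<mu> c) N q" "\<forall>t. E\<^sub>\<nu> \<mu> c (N t) (q t) = (1 - 2 * \<mu>) * cos e"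
        "N 0 = y" "(N \<longlongrightarrow> e1) at_top" "(N \<longlongrightarrow> e2) at_bot"
        using ex by auto
      have EN: "E\<^sub>\<nu> \<mu> c (N t) (q t) = - G" for t using N(2) by (simp add: G)
      have "cos (N 0) \<noteq> cos z" "cos e1 = cos z" "cos e2 = cos z" using that N(3) z by simp_all
      then have "homoclinic \<mu> c \<gamma> (\<lambda>\<tau>. (l1 \<tau>, N \<tau>, pl1 \<tau>, q \<tau>))"
        unfolding \<gamma>eq
        by (intro homoclinic_const_angleI[OF c cG g(2) El Ez l1(1) l1(2)[rule_format] N(1) EN _ N(4,5)])
      moreover have "collides (\<lambda>\<tau>. (l1 \<tau>, N \<tau>, pl1 \<tau>, q \<tau>)) (elliptic 0 y)"
        unfolding collides_def position_def by (intro exI[of _ 0]) (simp add: l1 N)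
      ultimately show ?thesis by blast
    qed
    have cos2: "cos (2 * pi - e) = cos e" by (simp add: cos_diff)
    have "\<exists>x. homoclinic \<mu> c \<gamma> x \<and> collides x (elliptic 0 0)"
      by (rule hom[OF hyperbolic_separatrices(1)[OF c e cu]]) (use u ce in auto)
    moreover have "elliptic 0 0 = moon" by (simp add: collision_iff)
    moreover have "\<exists>x. homoclinic \<mu> c \<gamma> x \<and> collides x (elliptic 0 pi)"
      by (rule hom[OF hyperbolic_separatrices(2)[OF c e cu]]) (use u ce cos2 in auto)
    moreover have "elliptic 0 pi = earth" by (simp add: collision_iff)
    moreover have "rotates_once earth \<gamma> x \<and> turns moon \<gamma> x 0 \<or> rotates_once moon \<gamma> x \<and> turns earth \<gamma> x 0"
      if "homoclinic \<mu> c \<gamma> x" "non_collision x" for x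
      using hyperbolic_rotation[OF c cG e G cu g(2) El z that(1)[unfolded \<gamma>eq] that(2)]
      unfolding \<gamma>eq[symmetric] rotates_once_def by blast
    ultimately show ?thesis by simp
  qed
  then show ?thesis using ex by blast
qed

section \<open>The exterior collision orbit near the Moon\<close>

text \<open>A collision with the Moon would need cos \<nu> = 1, the rest value that is never
  attained. The separatrix joins 0 to 2 \<pi>, because 2 p^2 factors as (1 - cos \<nu>) (2 m + c (1
  + cos \<nu>)) with m = 1 - 2 \<mu> and m + c > 0. Reflecting in the origin reduces the passage at
  \<pi> to the count about the Moon with limit angle \<pi>.\<close>

lemma exterior_rotation:
  assumes c: "c < 0" "G + 2 + c > 0" and mc: "1 - 2 * \<mu> + c > 0" and G: "G = - (2 * (1 - 2 * \<mu>) + c)"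
    and \<gamma>: "motion (W\<^sub>l c) l' pl'" "\<And>\<tau>. E\<^sub>l c (l' \<tau>) (pl' \<tau>) = G" and z: "cos z = 1"
    and h: "homoclinic \<mu> c (\<lambda>\<tau>. (l' \<tau>, z, pl' \<tau>, 0)) x"
  shows "\<not> collides x moon"
    and "non_collision x \<Longrightarrow> \<exists>n\<in>{1, -1}. turns earth (\<lambda>\<tau>. (l' \<tau>, z, pl' \<tau>, 0)) x n"
proof -
  have F: "- G - 2 * (1 - 2 * \<mu>) * cos y - c * (cos y)\<^sup>2
      = (1 - cos y) * (2 * (1 - 2 * \<mu>) + c * (1 + cos y))" for y
    unfolding G by (simp add: power2_eq_square algebra_simps)
  have z0: "cos z = cos 0" using z by simp
  have eq: "E\<^sub>\<nu> \<mu> c y 0 = - G \<and> W\<^sub>\<nu> \<mu> c y = 0" if "cos y = cos z" for y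
  proof -
    have "sin y = 0" using that z sin_cos_squared_add[of y] by simp
    then show ?thesis using that z by (simp add: E\<^sub>\<nu>_def W\<^sub>\<nu>_def G)
  qed
  obtain l \<nu> pl p where x: "x = (\<lambda>\<tau>. (l \<tau>, \<nu> \<tau>, pl \<tau>, p \<tau>))"
    and ml: "motion (W\<^sub>l c) l pl" and m\<nu>: "motion (W\<^sub>\<nu> \<mu> c) \<nu> p"
    and El: "\<forall>\<tau>. E\<^sub>l c (l \<tau>) (pl \<tau>) = G" and E\<nu>: "\<forall>\<tau>. E\<^sub>\<nu> \<mu> c (\<nu> \<tau>) (p \<tau>) = - G"
    and ne: "\<forall>\<tau>. cos (\<nu> \<tau>) \<noteq> cos z"
    by (rule const_angle_homoclinicE[OF c \<gamma> eq h])
  show "\<not> collides x moon"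
    using ne z by (simp add: collides_def x position_def collision_iff)
  assume nc: "non_collision x"
  obtain \<sigma> :: real where \<sigma>: "\<sigma> = 1 \<or> \<sigma> = - 1" "\<forall>l. elliptic l z = elliptic (\<sigma> * l) 0"
    by (rule elliptic_base[OF z0])
  obtain R where R: "0 \<le> R" "\<And>l p. E\<^sub>l c l p = G \<Longrightarrow> \<bar>l\<bar> \<le> R \<and> \<bar>p\<bar> \<le> R"
    using energy_level_bounded[OF c(1), of G] by blast
  have lR: "\<bar>l t\<bar> \<le> R" for t using R(2)[OF El[rule_format]] by blast
  have cov: "\<exists>s. - \<sigma> * l' s = y" if "y = l t \<or> y = - l t" for y t
  proof -
    have "E\<^sub>l c (- \<sigma> * y) (pl t) = G"
      using that El \<sigma>(1) by (auto simp: E\<^sub>l_uminus)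
    then obtain s where "l' s = - \<sigma> * y" using oscillation_covers[OF c \<gamma>] by blast
    then show ?thesis using \<sigma>(1) by (intro exI[of _ s]) auto
  qed
  have cv: "\<exists>s. - \<sigma> * l' s = l t" "\<exists>s. - \<sigma> * l' s = - l t" for t
    using cov by blast+
  obtain k :: int where k: "0 \<le> \<nu> 0 - 2 * pi * of_int k" "\<nu> 0 - 2 * pi * of_int k < 0 + 2 * pi"
    by (rule angle_window)
  define N where "N = (\<lambda>t. \<nu> t - 2 * pi * of_int k)"
  have mN: "motion (W\<^sub>\<nu> \<mu> c) N p" unfolding N_def by (rule motion_\<nu>_shift_2pi[OF m\<nu>])
  have cN: "cos (N t) = cos (\<nu> t)" for t
    using sin_cos_eq_iff[of "\<nu> t" "N t"] unfolding N_def by (metis diff_add_cancel)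
  have EN: "E\<^sub>\<nu> \<mu> c (N t) (p t) = - G" for t using E\<nu> unfolding E\<^sub>\<nu>_def cN by blast
  have eN: "elliptic (l t) (\<nu> t) = elliptic (l t) (N t)" for t
    using elliptic_symmetries(3)[of "l t" "N t" k] by (simp add: N_def)
  have neN: "N t \<noteq> 0" "N t \<noteq> 2 * pi" for t
    using ne[rule_format, of t] z unfolding cN[symmetric] by auto
  have btw0: "0 < N 0" "N 0 < 2 * pi" using k neN(1)[of 0] unfolding N_def by simp_all
  have pos: "0 < - G - 2 * (1 - 2 * \<mu>) * cos y - c * (cos y)\<^sup>2" if "0 < y" "y < 2 * pi" for y
  proof -
    have "cos \<bar>y - pi\<bar> > cos pi" using that by (intro cos_monotone_0_pi) auto
    then have "cos y < 1" by (simp add: cos_diff)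
    moreover have "2 * (1 - 2 * \<mu>) + c * (1 + cos y) > 0"
    proof -
      have "0 < 2 * (1 - 2 * \<mu>) + c * 2" using mc by simp
      also have "\<dots> \<le> 2 * (1 - 2 * \<mu>) + c * (1 + cos y)"
        using c by (intro add_left_mono mult_left_mono_neg) auto
      finally show ?thesis .
    qed
    ultimately show ?thesis unfolding F by simp
  qed
  note sep = separatrix_angle[OF mN EN pos neN btw0]
  define M where "M = (\<lambda>t. N t - pi)"
  have cM: "continuous_on UNIV M" unfolding M_def by (intro continuous_intros motionD(5)[OF mN])
  have iM: "inj M" using sep(2) by (auto simp: M_def inj_def)
  have bM: "- pi < M t \<and> M t < pi" for t using sep(1)[of t] by (auto simp: M_def)
  have limM: "(M \<longlongrightarrow> pi) at_top \<and> (M \<longlongrightarrow> - pi) at_bot \<or> (M \<longlongrightarrow> - pi) at_top \<and> (M \<longlongrightarrow> pi) at_bot"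
  proof -
    have "(M \<longlongrightarrow> pi) f" if "(N \<longlongrightarrow> 2 * pi) f" for f
      using tendsto_diff[OF that tendsto_const[of pi]] by (simp add: M_def[abs_def])
    moreover have "(M \<longlongrightarrow> - pi) f" if "(N \<longlongrightarrow> 0) f" for f
      using tendsto_diff[OF that tendsto_const[of pi]] by (simp add: M_def[abs_def])
    ultimately show ?thesis using sep(3) by blast
  qed
  have nzM: "l t \<noteq> 0" if "M t = 0" for t
  proof
    assume "l t = 0"
    moreover have "cos (\<nu> t) = - 1" using that unfolding cN[symmetric] by (simp add: M_def)
    ultimately have "position (x t) = earth" by (simp add: x position_def collision_iff)
    then show False using nc by (auto simp: non_collision_def collides_def)
  qed
  have cont: "continuous_on UNIV (\<lambda>\<tau>. - \<sigma> * l' \<tau>)" by (intro continuous_intros motionD(5)[OF \<gamma>(1)])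
  have g: "position \<circ> (\<lambda>\<tau>. (l' \<tau>, z, pl' \<tau>, 0)) = (\<lambda>\<tau>. - elliptic (- \<sigma> * l' \<tau>) pi)"
  proof -
    have "elliptic y 0 = - elliptic (- y) pi" for y by (simp add: elliptic_def complex_eq_iff)
    from this[of "\<sigma> * l' _"] show ?thesis unfolding position_comp \<sigma>(2)[rule_format] by simp
  qed
  have q: "position \<circ> x = (\<lambda>\<tau>. - elliptic (l \<tau>) (M \<tau>))"
    unfolding x position_comp eN M_def elliptic_symmetries(4) by simp
  have "\<exists>n\<in>{1, -1}. winds moon (\<lambda>\<tau>. elliptic (- \<sigma> * l' \<tau>) pi) (\<lambda>\<tau>. elliptic (l \<tau>) (M \<tau>)) n"
    by (rule winds_moon[OF pi_gt_zero order_refl motionD(5)[OF ml] cM cont lR bM iM limM nzM cv])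
  then show "\<exists>n\<in>{1, -1}. turns earth (\<lambda>\<tau>. (l' \<tau>, z, pl' \<tau>, 0)) x n"
    unfolding turns_iff_winds g q earth_eq using winds_uminus by blast
qed

lemma exterior_part:
  assumes \<mu>: "0 < \<mu>" "\<mu> < 1/2" and ch: "c_h \<mu> < c" and c: "c < 0"
  shows "(\<exists>\<gamma>. exterior_collision_orbit_moon \<mu> c \<gamma>) \<and>
        (\<forall>\<gamma>. exterior_collision_orbit_moon \<mu> c \<gamma> \<longrightarrow>
          (\<exists>x. homoclinic \<mu> c \<gamma> x \<and> collides x earth) \<and>
          (\<forall>x. homoclinic \<mu> c \<gamma> x \<longrightarrow> \<not> collides x moon) \<and>
          (\<forall>x. homoclinic \<mu> c \<gamma> x \<and> non_collision x \<longrightarrow> rotates_once earth \<gamma> x))"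
proof -
  have mc: "1 - 2 * \<mu> + c > 0" using ch by (simp add: c_h_def)
  define G where "G = - (2 * (1 - 2 * \<mu>) + c)"
  \<comment> \<open>The sum is 4 \<mu>.\<close>
  have cG: "G + 2 + c > 0" using \<mu> by (simp add: G_def)
  have eqE: "E\<^sub>\<nu> \<mu> c z 0 = - G" "W\<^sub>\<nu> \<mu> c z = 0" if "cos z = 1" for z
  proof -
    have "sin z = 0" using that sin_cos_squared_add[of z] by simp
    then show "W\<^sub>\<nu> \<mu> c z = 0" by (simp add: W\<^sub>\<nu>_def)
    show "E\<^sub>\<nu> \<mu> c z 0 = - G" using that by (simp add: E\<^sub>\<nu>_def G_def)
  qed
  obtain l0 pl0 where o: "motion (W\<^sub>l c) l0 pl0" "\<forall>t. E\<^sub>l c (l0 t) (pl0 t) = G"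
    "\<forall>y q. E\<^sub>l c y q = G \<longrightarrow> (\<exists>t. l0 t = y \<and> pl0 t = q)"
    using oscillation_exists[OF c cG] by (elim exE conjE) (rule that)
  have ex: "\<exists>\<gamma>. exterior_collision_orbit_moon \<mu> c \<gamma>"
  proof
    show "exterior_collision_orbit_moon \<mu> c (\<lambda>\<tau>. (l0 \<tau>, 0, pl0 \<tau>, 0))"
      unfolding exterior_collision_orbit_moon_def
      using regularized_orbitI[OF o(1) motion_const o(2)[rule_format]] eqE[of 0] cosh_real_ge_1
      by (simp add: position_def elliptic_def)
  qed
  obtain l1 pl1 where l1: "motion (W\<^sub>l c) l1 pl1" "\<forall>t. E\<^sub>l c (l1 t) (pl1 t) = G" "l1 0 = 0"
    using oscillation_through_zero[OF c cG] by (elim exE conjE) (rule that)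
  obtain N q where N: "motion (W\<^sub>\<nu> \<mu> c) N q" "\<forall>t. E\<^sub>\<nu> \<mu> c (N t) (q t) = 2 * (1 - 2 * \<mu>) + c"
    "N 0 = pi" "(N \<longlongrightarrow> 2 * pi) at_top" "(N \<longlongrightarrow> 0) at_bot"
    using exterior_separatrix[OF c mc] by (elim exE conjE) (rule that)
  have EN: "E\<^sub>\<nu> \<mu> c (N t) (q t) = - G" for t using N(2) by (simp add: G_def)
  have "(\<exists>x. homoclinic \<mu> c \<gamma> x \<and> collides x earth) \<and> (\<forall>x. homoclinic \<mu> c \<gamma> x \<longrightarrow> \<not> collides x moon) \<and>
     (\<forall>x. homoclinic \<mu> c \<gamma> x \<and> non_collision x \<longrightarrow> rotates_once earth \<gamma> x)"
    if \<gamma>: "exterior_collision_orbit_moon \<mu> c \<gamma>" for \<gamma>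
  proof -
    have r: "regularized_orbit \<mu> c \<gamma>" using \<gamma> by (simp add: exterior_collision_orbit_moon_def)
    obtain l \<nu> pl p G' where g: "\<gamma> = (\<lambda>\<tau>. (l \<tau>, \<nu> \<tau>, pl \<tau>, p \<tau>))"
      "motion (W\<^sub>l c) l pl" "motion (W\<^sub>\<nu> \<mu> c) \<nu> p"
      "\<forall>\<tau>. E\<^sub>l c (l \<tau>) (pl \<tau>) = G'" "\<forall>\<tau>. E\<^sub>\<nu> \<mu> c (\<nu> \<tau>) (p \<tau>) = - G'"
      by (rule regularized_orbitE[OF r])
    have cos\<nu>: "cos (\<nu> t) = 1" for t
    proof -
      have *: "sinh (l t) * sin (\<nu> t) = 0" "cosh (l t) * cos (\<nu> t) \<ge> 1"
        using \<gamma> unfolding exterior_collision_orbit_moon_def g(1) position_def elliptic_def by simp_all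
      \<comment> \<open>Either \<lambda> = 0, and the Moon is the only admissible point of the
        segment, or the point is on the outer axis, where the sign of its abscissa decides.\<close>
      have "cosh (l t) = 1 \<or> sin (\<nu> t) = 0" using *(1) by simp
      then show ?thesis
      proof
        assume "cosh (l t) = 1"
        then show ?thesis using *(2) cos_le_one[of "\<nu> t"] by simp
      next
        assume "sin (\<nu> t) = 0"
        then have "cos (\<nu> t) = 1 \<or> cos (\<nu> t) = - 1"
          using sin_cos_squared_add[of "\<nu> t"] by (simp add: power2_eq_1_iff)
        then show ?thesis using *(2) cosh_real_ge_1[of "l t"] by auto
      qed
    qed
    define z where "z = \<nu> 0"
    have \<nu>: "\<nu> = (\<lambda>_. z)" "p = (\<lambda>_. 0)"
      using motion_cos_const[OF g(3) cos\<nu>] by (auto simp: z_def fun_eq_iff)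
    have z: "cos z = 1" using cos\<nu>[of 0] by (simp add: z_def)
    have "G' = G" using g(5)[rule_format, of 0] eqE(1)[OF z] unfolding \<nu> by simp
    then have El: "E\<^sub>l c (l \<tau>) (pl \<tau>) = G" for \<tau> using g(4) by blast
    have \<gamma>eq: "\<gamma> = (\<lambda>\<tau>. (l \<tau>, z, pl \<tau>, 0))" unfolding g(1) \<nu> ..
    have ends: "cos (N 0) \<noteq> cos z" "cos (2 * pi) = cos z" "cos 0 = cos z" using N(3) z by simp_all
    have "homoclinic \<mu> c \<gamma> (\<lambda>\<tau>. (l1 \<tau>, N \<tau>, pl1 \<tau>, q \<tau>))"
      unfolding \<gamma>eq
      by (rule homoclinic_const_angleI[OF c cG g(2) El eqE(1)[OF z] l1(1) l1(2)[rule_format] N(1) EN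
            ends(1) N(4,5) ends(2,3)])
    moreover have "collides (\<lambda>\<tau>. (l1 \<tau>, N \<tau>, pl1 \<tau>, q \<tau>)) earth"
      unfolding collides_def position_def by (intro exI[of _ 0]) (simp add: l1 N collision_iff)
    moreover have "\<not> collides x moon" if "homoclinic \<mu> c \<gamma> x" for x
      using exterior_rotation(1)[OF c cG mc G_def g(2) El z that[unfolded \<gamma>eq]] .
    moreover have "rotates_once earth \<gamma> x" if "homoclinic \<mu> c \<gamma> x" "non_collision x" for x
      using exterior_rotation(2)[OF c cG mc G_def g(2) El z that(1)[unfolded \<gamma>eq] that(2)]
      unfolding \<gamma>eq[symmetric] rotates_once_def by blast
    ultimately show ?thesis by blast
  qed
  then show ?thesis using ex by blast
qed

section \<open>The double-collision orbit\<close>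

text \<open>With u = cos \<nu> and m = 1 - 2 \<mu>, the left side is the combination of 2 - 2 m u
  and 1 - 2 m u + u^2 with weights 1 + c and - c. The first is at least 4 \<mu>, the second at least
  (1 - |u|)^2. The threshold \<open>c_e\<close> = -1 is where the weight 1 + c becomes
  positive.\<close>

lemma \<nu>_kinetic_bound:
  fixes \<nu> :: real
  assumes \<mu>: "0 < \<mu>" "\<mu> \<le> 1/2" and c: "- 1 < c" "c < 0"
  shows "2 + c - 2 * (1 - 2 * \<mu>) * cos \<nu> - c * (cos \<nu>)\<^sup>2 \<ge> 4 * \<mu> * (1 + c)"
proof -
  let ?u = "cos \<nu>" and ?m = "1 - 2 * \<mu>"
  have m: "0 \<le> ?m" using \<mu> by simp
  have "?m * ?u \<le> ?m * 1" using m by (intro mult_left_mono) auto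
  then have 1: "2 - 2 * (?m * ?u) \<ge> 4 * \<mu>" by simp
  have "?m * ?u \<le> \<bar>?u\<bar>"
  proof -
    have "?m * ?u \<le> ?m * \<bar>?u\<bar>" using m by (intro mult_left_mono) auto
    also have "\<dots> \<le> 1 * \<bar>?u\<bar>" using \<mu> by (intro mult_right_mono) auto
    finally show ?thesis by simp
  qed
  then have 2: "1 - 2 * (?m * ?u) + ?u\<^sup>2 \<ge> 0"
    using zero_le_power2[of "1 - \<bar>?u\<bar>"] by (simp add: power2_eq_square algebra_simps)
  have "2 + c - 2 * ?m * ?u - c * ?u\<^sup>2 = (1 + c) * (2 - 2 * (?m * ?u)) + - c * (1 - 2 * (?m * ?u) + ?u\<^sup>2)"
    by (simp add: algebra_simps)
  moreover have "(1 + c) * (2 - 2 * (?m * ?u)) \<ge> (1 + c) * (4 * \<mu>)"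
    using 1 c by (intro mult_left_mono) auto
  moreover have "- c * (1 - 2 * (?m * ?u) + ?u\<^sup>2) \<ge> 0" using 2 c by (intro mult_nonneg_nonneg) auto
  ultimately show ?thesis by (simp add: algebra_simps)
qed

text \<open>The kinetic bound keeps |p| above sqrt (2 \<mu> (1 + c)), so \<nu> never turns back and
  moves with speed bounded below.\<close>

lemma \<nu>_rotation:
  assumes \<mu>: "0 < \<mu>" "\<mu> \<le> 1/2" and c: "- 1 < c" "c < 0"
    and m: "motion (W\<^sub>\<nu> \<mu> c) \<nu> p" and E: "\<And>t. E\<^sub>\<nu> \<mu> c (\<nu> t) (p t) = 2 + c"
  shows "(\<forall>t. 0 < p t) \<and> filterlim \<nu> at_top at_top \<and> filterlim \<nu> at_bot at_bot \<or>
    (\<forall>t. p t < 0) \<and> filterlim \<nu> at_bot at_top \<and> filterlim \<nu> at_top at_bot"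
proof -
  define \<delta> where "\<delta> = sqrt (2 * \<mu> * (1 + c))"
  have \<delta>: "\<delta> > 0" using \<mu> c by (simp add: \<delta>_def)
  have ge: "\<bar>p t\<bar> \<ge> \<delta>" for t
  proof -
    have "2 * (p t)\<^sup>2 = 2 + c - 2 * (1 - 2 * \<mu>) * cos (\<nu> t) - c * (cos (\<nu> t))\<^sup>2"
      using E[of t] by (simp add: E\<^sub>\<nu>_def)
    then have "2 * \<mu> * (1 + c) \<le> \<bar>p t\<bar>\<^sup>2" using \<nu>_kinetic_bound[OF \<mu> c, of "\<nu> t"] by simp
    then show ?thesis unfolding \<delta>_def by (intro real_le_lsqrt) auto
  qed
  have "p t \<noteq> 0" for t using ge[of t] \<delta> by auto
  then consider "\<forall>t. p t > 0" | "\<forall>t. p t < 0"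
    using nonzero_continuous_sign[OF motionD(6)[OF m]] by blast
  then show ?thesis
  proof cases
    case 1
    then have "4 * p t \<ge> \<delta>" for t using ge[of t] by (simp add: abs_of_pos)
        (use \<delta> in linarith)
    from filterlim_deriv_ge[OF motionD(1)[OF m] this \<delta>] show ?thesis using 1 by blast
  next
    case 2
    have d: "((\<lambda>t. - \<nu> t) has_real_derivative - (4 * p t)) (at t)" for t
      by (rule DERIV_minus[OF motionD(1)[OF m]])
    have "- (4 * p t) \<ge> \<delta>" for t using ge[of t] 2[rule_format, of t] by linarith
    from filterlim_deriv_ge[OF d this \<delta>] show ?thesis
      unfolding filterlim_uminus_at_top[symmetric] filterlim_uminus_at_bot[symmetric] using 2 by blast
  qed
qed

text \<open>The level has a component for each sign of p. The orbit covers one of them because \<nu>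
  is onto, and the identification of (\<nu>, p) with (-\<nu>, -p) covers the other. Orbits run in
  either sense thus have the same set.\<close>

lemma double_collision_orbit_set:
  assumes \<mu>: "0 < \<mu>" "\<mu> \<le> 1/2" and c: "- 1 < c" "c < 0"
    and m: "motion (W\<^sub>\<nu> \<mu> c) \<nu> p" and E: "\<And>t. E\<^sub>\<nu> \<mu> c (\<nu> t) (p t) = 2 + c"
  shows "orbit_set (\<lambda>\<tau>. (0, \<nu> \<tau>, 0, p \<tau>)) = {(y, z, q, r). y = 0 \<and> q = 0 \<and> E\<^sub>\<nu> \<mu> c z r = 2 + c}"
    (is "?L = ?R")
proof
  have per: "E\<^sub>\<nu> \<mu> c (a + 2 * pi * of_int k) r = E\<^sub>\<nu> \<mu> c a r" "E\<^sub>\<nu> \<mu> c (- a) (- r) = E\<^sub>\<nu> \<mu> c a r" for a k r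
    using sin_cos_eq_iff[of "a + 2 * pi * of_int k" a] by (auto simp: E\<^sub>\<nu>_def)
  show "?L \<subseteq> ?R"
  proof
    fix w assume "w \<in> ?L"
    then obtain \<tau> and k :: int where "w = (0, \<nu> \<tau> + 2 * pi * of_int k, 0, p \<tau>) \<or>
        w = (0, - \<nu> \<tau> + 2 * pi * of_int k, 0, - p \<tau>)"
      by (auto simp: orbit_set_def same_state_def)
    then show "w \<in> ?R" by (elim disjE) (simp_all only: mem_Collect_eq prod.case per E simp_thms)
  qed
  have surj: "\<exists>t. \<nu> t = z" for z
  proof -
    have hi: "\<exists>b. z \<le> \<nu> b" if "filterlim \<nu> at_top F" "F \<noteq> bot" for F
      using that eventually_happens'[OF that(2)] unfolding filterlim_at_top by blast
    have lo: "\<exists>a. \<nu> a \<le> z" if "filterlim \<nu> at_bot F" "F \<noteq> bot" for F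
      using that eventually_happens'[OF that(2)] unfolding filterlim_at_bot by blast
    have "\<exists>b. z \<le> \<nu> b" "\<exists>a. \<nu> a \<le> z"
      using \<nu>_rotation[OF \<mu> c m E] hi lo trivial_limit_at_top_linorder trivial_limit_at_bot_linorder
      by blast+
    then obtain a b where "\<nu> a \<le> z" "z \<le> \<nu> b" by blast
    moreover have "connected (range \<nu>)" using motionD(5)[OF m] by (intro connected_continuous_image) auto
    ultimately have "z \<in> range \<nu>" using connected_contains_Icc[of "range \<nu>" "\<nu> a" "\<nu> b"] by auto
    then show ?thesis by auto
  qed
  have sgn: "(\<forall>t. 0 < p t) \<or> (\<forall>t. p t < 0)" using \<nu>_rotation[OF \<mu> c m E] by blast
  show "?R \<subseteq> ?L"
  proof
    fix w assume "w \<in> ?R"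
    then obtain z r where w: "w = (0, z, 0, r)" and zr: "E\<^sub>\<nu> \<mu> c z r = 2 + c" by auto
    obtain t where t: "\<nu> t = z" using surj by blast
    obtain t' where t': "\<nu> t' = - z" using surj by blast
    have "(p t)\<^sup>2 = r\<^sup>2" "(p t')\<^sup>2 = r\<^sup>2" using E[of t] E[of t'] zr by (simp_all add: E\<^sub>\<nu>_def t t')
    then have "p t = r \<or> p t = - r" "p t' = r \<or> p t' = - r" by (simp_all add: power2_eq_iff)
    moreover have "0 < p t \<and> 0 < p t' \<or> p t < 0 \<and> p t' < 0" using sgn by blast
    ultimately have "p t = r \<or> p t' = - r" by auto
    then have "\<exists>\<tau>. same_state (0, \<nu> \<tau>, 0, p \<tau>) w"
    proof
      assume "p t = r"
      then show ?thesis unfolding w same_state_def by (auto intro!: exI[of _ t] exI[of _ "0::int"] simp: t)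
    next
      assume "p t' = - r"
      then show ?thesis unfolding w same_state_def by (auto intro!: exI[of _ t'] exI[of _ "0::int"] simp: t')
    qed
    then show "w \<in> ?L" by (simp add: orbit_set_def)
  qed
qed

text \<open>On this level p never vanishes, so its positive root gives a first order equation with
  bounded positive speed.\<close>

lemma \<nu>_rotation_exists:
  assumes \<mu>: "0 < \<mu>" "\<mu> \<le> 1/2" and c: "- 1 < c" "c < 0"
  shows "\<exists>\<nu> p. motion (W\<^sub>\<nu> \<mu> c) \<nu> p \<and> (\<forall>t. E\<^sub>\<nu> \<mu> c (\<nu> t) (p t) = 2 + c)"
proof -
  define f where "f = (\<lambda>z. (2 + c - 2 * (1 - 2 * \<mu>) * cos z - c * (cos z)\<^sup>2) / 2)"
  have f: "f z > 0" for z
  proof -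
    have "4 * \<mu> * (1 + c) > 0" using \<mu> c by simp
    then show ?thesis using \<nu>_kinetic_bound[OF \<mu> c, of z] by (simp add: f_def)
  qed
  define g where "g = (\<lambda>z. 4 * sqrt (f z))"
  have cg: "continuous_on UNIV g" unfolding g_def f_def by (intro continuous_intros) auto
  have gM: "g z \<le> 4 * sqrt 4" for z
  proof -
    have "\<bar>(1 - 2 * \<mu>) * cos z\<bar> \<le> 1 * 1" unfolding abs_mult using \<mu> by (intro mult_mono) (auto simp: abs_le_iff)
    then have "- ((1 - 2 * \<mu>) * cos z) \<le> 1" by linarith
    moreover have "(cos z)\<^sup>2 \<le> 1" by (simp add: abs_square_le_1)
    then have "- c * (cos z)\<^sup>2 \<le> - c * 1" using c by (intro mult_left_mono) auto
    ultimately have "2 + c - 2 * ((1 - 2 * \<mu>) * cos z) - c * (cos z)\<^sup>2 \<le> 8" using c by linarith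
    then have "f z \<le> 4" by (simp add: f_def algebra_simps)
    then show ?thesis unfolding g_def by (intro mult_left_mono real_sqrt_le_mono) auto
  qed
  have gpos: "0 < g z" for z using f by (simp add: g_def)
  obtain \<nu> where \<nu>: "\<And>t. (\<nu> has_real_derivative g (\<nu> t)) (at t)" "surj \<nu>"
    using autonomous_ode_surj[OF cg gpos gM] by metis
  define p where "p = (\<lambda>t. sqrt (f (\<nu> t)))"
  have p: "p t > 0" for t using f by (simp add: p_def)
  have d\<nu>: "(\<nu> has_real_derivative 4 * p t) (at t)" for t using \<nu>(1)[of t] by (simp add: g_def p_def)
  have "(p has_real_derivative W\<^sub>\<nu> \<mu> c (\<nu> t)) (at t)" for t
  proof -
    have "((\<lambda>t. f (\<nu> t)) has_real_derivative
        ((2 * (1 - 2 * \<mu>) * sin (\<nu> t) + 2 * c * cos (\<nu> t) * sin (\<nu> t)) / 2 * (4 * p t))) (at t)"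
      unfolding f_def by (auto intro!: derivative_eq_intros d\<nu> simp: field_simps)
    from DERIV_chain2[OF DERIV_real_sqrt[OF f] this]
    have "(p has_real_derivative inverse (p t) / 2 * (W\<^sub>\<nu> \<mu> c (\<nu> t) / 2 * (4 * p t))) (at t)"
      unfolding p_def W\<^sub>\<nu>_def .
    also have "inverse (p t) / 2 * (W\<^sub>\<nu> \<mu> c (\<nu> t) / 2 * (4 * p t)) = W\<^sub>\<nu> \<mu> c (\<nu> t)"
      using p[of t] by (simp add: field_simps)
    finally show ?thesis .
  qed
  then have "motion (W\<^sub>\<nu> \<mu> c) \<nu> p" using d\<nu> by (simp add: motion_def)
  moreover have "E\<^sub>\<nu> \<mu> c (\<nu> t) (p t) = 2 + c" for t
  proof -
    have "(p t)\<^sup>2 = f (\<nu> t)" unfolding p_def using f[of "\<nu> t"] by simp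
    then show ?thesis by (simp add: E\<^sub>\<nu>_def f_def)
  qed
  ultimately show ?thesis by blast
qed

lemma rotates_around_orbit_positive:
  assumes \<gamma>: "\<And>s. position (\<gamma> s) \<in> closed_segment earth moon"
    and q: "\<And>t. position (x t) = elliptic (l t) (\<nu> t)" and l: "\<And>t. 0 < l t"
    and cont: "continuous_on UNIV l" "continuous_on UNIV \<nu>"
    and lim: "filterlim \<nu> at_top at_top \<and> filterlim \<nu> at_bot at_bot \<or>
      filterlim \<nu> at_bot at_top \<and> filterlim \<nu> at_top at_bot"
  shows "rotates_around_orbit \<gamma> x"
  unfolding rotates_around_orbit_def
proof
  fix s
  obtain \<theta> where \<theta>: "polar_angle (position (\<gamma> s)) (\<lambda>t. elliptic (l t) (\<nu> t)) \<theta>" "\<forall>t. \<bar>\<theta> t - \<nu> t\<bar> \<le> pi"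
    by (rule polar_angle_ellipse[OF cont l \<gamma>])
  have b: "- pi + \<nu> t \<le> \<theta> t" "- pi + - \<nu> t \<le> - \<theta> t" for t
    using \<theta>(2)[rule_format, of t] by linarith+
  have top: "filterlim \<theta> at_top F" if "filterlim \<nu> at_top F" for F
  proof (rule filterlim_at_top_mono[OF filterlim_tendsto_add_at_top[OF tendsto_const[of "- pi"] that]])
    show "\<forall>\<^sub>F t in F. - pi + \<nu> t \<le> \<theta> t"
      by (intro always_eventually allI b)
  qed
  have bot: "filterlim \<theta> at_bot F" if "filterlim \<nu> at_bot F" for F
  proof -
    have "filterlim (\<lambda>t. - \<nu> t) at_top F" using that by (simp add: filterlim_uminus_at_bot)
    then have "filterlim (\<lambda>t. - pi + - \<nu> t) at_top F" by (rule filterlim_tendsto_add_at_top[OF tendsto_const])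
    then have "filterlim (\<lambda>t. - \<theta> t) at_top F"
    proof (rule filterlim_at_top_mono)
      show "\<forall>\<^sub>F t in F. - pi + - \<nu> t \<le> - \<theta> t"
        by (intro always_eventually allI b)
    qed
    then show ?thesis by (simp add: filterlim_uminus_at_bot)
  qed
  have "position \<circ> x = (\<lambda>t. elliptic (l t) (\<nu> t))" using q by auto
  then show "\<exists>\<theta>. polar_angle (position (\<gamma> s)) (position \<circ> x) \<theta> \<and>
     (filterlim \<theta> at_top at_top \<and> filterlim \<theta> at_bot at_bot \<or>
      filterlim \<theta> at_bot at_top \<and> filterlim \<theta> at_top at_bot)"
    using \<theta>(1) lim top bot by (intro exI[of _ \<theta>]) auto
qed

lemma double_collision_part:
  assumes \<mu>: "0 < \<mu>" "\<mu> \<le> 1/2" and ce: "c_e < c" and c: "c < 0"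
  shows "(\<exists>\<gamma>. double_collision_orbit \<mu> c \<gamma>) \<and>
        (\<forall>\<gamma>. double_collision_orbit \<mu> c \<gamma> \<longrightarrow>
          (\<forall>x. homoclinic \<mu> c \<gamma> x \<longrightarrow> rotates_around_orbit \<gamma> x) \<and>
          (\<forall>x. homoclinic \<mu> c \<gamma> x \<longrightarrow> non_collision x))"
proof -
  have c1: "- 1 < c" using ce by (simp add: c_e_def)
  have W0: "W\<^sub>l c 0 = 0" by (simp add: W\<^sub>l_def)
  have m0: "motion (W\<^sub>l c) (\<lambda>_. 0) (\<lambda>_. 0)" using W0 by (rule motion_const)
  have E0: "E\<^sub>l c 0 0 = - (2 + c)" by (simp add: E\<^sub>l_def)
  have seg: "elliptic l \<nu> \<in> closed_segment earth moon \<longleftrightarrow> l = 0" for l \<nu>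
  proof
    assume "elliptic l \<nu> \<in> closed_segment earth moon"
    then obtain u where u: "0 \<le> u" "u \<le> 1" "elliptic l \<nu> = (1 - u) *\<^sub>R earth + u *\<^sub>R moon"
      unfolding closed_segment_def by blast
    have "sinh l * sin \<nu> = 0" "cosh l * cos \<nu> = 2 * u - 1"
      using u(3) by (simp_all add: complex_eq_iff elliptic_def earth_def moon_def field_simps)
    moreover from this have "cos \<nu> = 1 \<or> cos \<nu> = - 1" if "l \<noteq> 0"
      using that sin_cos_squared_add[of \<nu>] by (simp add: power2_eq_1_iff)
    \<comment> \<open>Off \<lambda> = 0 a point of the axis has |cos \<nu>| = 1, and being between
      the primaries would bound cosh l by 1.\<close>
    ultimately have "cosh l \<le> 1" if "l \<noteq> 0" using that u(1,2) by auto
    then show "l = 0" using cosh_real_ge_1[of l] by fastforce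
  next
    assume "l = 0"
    then have "elliptic l \<nu> = (1 - (1 + cos \<nu>) / 2) *\<^sub>R earth + ((1 + cos \<nu>) / 2) *\<^sub>R moon"
      by (simp add: complex_eq_iff elliptic_def earth_def moon_def field_simps)
    moreover have "0 \<le> 1 + cos \<nu>" using cos_ge_minus_one[of \<nu>] by linarith
    then have "0 \<le> (1 + cos \<nu>) / 2" "(1 + cos \<nu>) / 2 \<le> 1" by simp_all
    ultimately show "elliptic l \<nu> \<in> closed_segment earth moon"
      unfolding closed_segment_def by blast
  qed
  obtain \<nu>0 p0 where n: "motion (W\<^sub>\<nu> \<mu> c) \<nu>0 p0" "\<forall>t. E\<^sub>\<nu> \<mu> c (\<nu>0 t) (p0 t) = 2 + c"
    using \<nu>_rotation_exists[OF \<mu> c1 c] by (elim exE conjE) (rule that)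
  have "double_collision_orbit \<mu> c (\<lambda>\<tau>. (0, \<nu>0 \<tau>, 0, p0 \<tau>))"
    unfolding double_collision_orbit_def
    using regularized_orbitI[OF m0 n(1), of "- (2 + c)"] n(2) E0
    by (simp add: position_def seg)
  moreover have "rotates_around_orbit \<gamma> x \<and> non_collision x"
    if \<gamma>: "double_collision_orbit \<mu> c \<gamma>" and h: "homoclinic \<mu> c \<gamma> x" for \<gamma> x
  proof -
    have r: "regularized_orbit \<mu> c \<gamma>" and pos: "\<And>\<tau>. position (\<gamma> \<tau>) \<in> closed_segment earth moon"
      using \<gamma> by (simp_all add: double_collision_orbit_def)
    obtain l' \<nu>' pl' p' G' where g: "\<gamma> = (\<lambda>\<tau>. (l' \<tau>, \<nu>' \<tau>, pl' \<tau>, p' \<tau>))"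
      "motion (W\<^sub>l c) l' pl'" "motion (W\<^sub>\<nu> \<mu> c) \<nu>' p'"
      "\<forall>\<tau>. E\<^sub>l c (l' \<tau>) (pl' \<tau>) = G'" "\<forall>\<tau>. E\<^sub>\<nu> \<mu> c (\<nu>' \<tau>) (p' \<tau>) = - G'"
      by (rule regularized_orbitE[OF r])
    have l'0: "l' t = 0" for t using pos[of t] unfolding g(1) position_def by (simp add: seg)
    have pl'0: "pl' t = 0" for t
    proof -
      have "l' = (\<lambda>_. 0)" using l'0 by (rule ext)
      then have "(l' has_real_derivative 0) (at t)" by simp
      then have "4 * pl' t = 0" using DERIV_unique[OF motionD(1)[OF g(2)]] by blast
      then show ?thesis by simp
    qed
    have G': "G' = - (2 + c)" using g(4)[rule_format, of 0] E0 by (simp add: l'0 pl'0)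
    have \<gamma>eq: "\<gamma> = (\<lambda>\<tau>. (0, \<nu>' \<tau>, 0, p' \<tau>))" unfolding g(1) l'0 pl'0 ..
    obtain l \<nu> pl p where x: "x = (\<lambda>\<tau>. (l \<tau>, \<nu> \<tau>, pl \<tau>, p \<tau>))"
      "motion (W\<^sub>l c) l pl" "motion (W\<^sub>\<nu> \<mu> c) \<nu> p"
      "\<forall>\<tau>. E\<^sub>l c (l \<tau>) (pl \<tau>) = G'" "\<forall>\<tau>. E\<^sub>\<nu> \<mu> c (\<nu> \<tau>) (p \<tau>) = - G'"
      "orbit_set x \<noteq> orbit_set (\<lambda>\<tau>. (l' \<tau>, \<nu>' \<tau>, pl' \<tau>, p' \<tau>))"
      by (rule homoclinicE[OF c h[unfolded g(1)] g(4)[rule_format]])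
    have E\<nu>: "E\<^sub>\<nu> \<mu> c (\<nu> t) (p t) = 2 + c" "E\<^sub>\<nu> \<mu> c (\<nu>' t) (p' t) = 2 + c" for t
      using x(5) g(5) by (simp_all add: G')
    \<comment> \<open>At \<lambda> = 0 this level leaves only zero momentum, so the \<lambda> motion
      would rest at the saddle forever and the orbit would have the orbit set of \<gamma>.\<close>
    have l0: "l t \<noteq> 0" for t
    proof
      assume lt: "l t = 0"
      have "2 * (pl t)\<^sup>2 = E\<^sub>l c (l t) (pl t) - E\<^sub>l c 0 0" by (simp add: E\<^sub>l_def lt)
      also have "\<dots> = 0" using x(4) by (simp add: E0 G')
      finally have plt: "pl t = 0" by simp
      have eq: "l = (\<lambda>_. 0)" "pl = (\<lambda>_. 0)"
        by (rule motion_l_unique[OF c x(2) m0, of t]; simp add: lt plt)+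
      have "x = (\<lambda>\<tau>. (0, \<nu> \<tau>, 0, p \<tau>))" unfolding x(1) eq ..
      then have "orbit_set x = orbit_set \<gamma>"
        unfolding \<gamma>eq using double_collision_orbit_set[OF \<mu> c1 c x(3) E\<nu>(1)]
          double_collision_orbit_set[OF \<mu> c1 c g(3) E\<nu>(2)] by simp
      then show False using x(6) unfolding g(1) by blast
    qed
    have "non_collision x"
      using l0 by (simp add: non_collision_def collides_def x(1) position_def collision_iff)
    moreover have "rotates_around_orbit \<gamma> x"
    proof -
      have lim: "filterlim \<nu> at_top at_top \<and> filterlim \<nu> at_bot at_bot \<or>
          filterlim \<nu> at_bot at_top \<and> filterlim \<nu> at_top at_bot"
        using \<nu>_rotation[OF \<mu> c1 c x(3) E\<nu>(1)] by blast
      note cont = motionD(5)[OF x(2)] motionD(5)[OF x(3)]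
      consider "\<forall>t. l t > 0" | "\<forall>t. l t < 0"
        using nonzero_continuous_sign[OF cont(1) l0] by blast
      then show ?thesis
      proof cases
        case 1
        show ?thesis
          by (rule rotates_around_orbit_positive[OF pos _ _ cont lim]) (simp_all add: x(1) position_def 1)
      next
        case 2
        \<comment> \<open>For negative \<lambda> the other lift of the orbit is used, which reverses
          \<nu> and exchanges its two limits.\<close>
        have q: "position (x t) = elliptic (- l t) (- \<nu> t)" for t
          by (simp add: x(1) position_def elliptic_symmetries(1))
        have lim': "filterlim (\<lambda>t. - \<nu> t) at_top at_top \<and> filterlim (\<lambda>t. - \<nu> t) at_bot at_bot \<or>
          filterlim (\<lambda>t. - \<nu> t) at_bot at_top \<and> filterlim (\<lambda>t. - \<nu> t) at_top at_bot"
          unfolding filterlim_uminus_at_top[symmetric] filterlim_uminus_at_bot[symmetric]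
          using lim by blast
        show ?thesis
          by (rule rotates_around_orbit_positive[OF pos q _ continuous_on_minus[OF cont(1)]
                continuous_on_minus[OF cont(2)] lim']) (simp add: 2)
      qed
    qed
    ultimately show ?thesis by blast
  qed
  ultimately show ?thesis by blast
qed

theorem mainTheorem1:
  fixes \<mu> :: real
  assumes "0 < \<mu>" and "\<mu> \<le> 1/2"
  shows
    "(\<forall>c. c_J \<mu> < c \<and> c < c_h \<mu> \<longrightarrow>
        (\<exists>\<gamma>. hyperbolic_orbit \<mu> c \<gamma>) \<and>
        (\<forall>\<gamma>. hyperbolic_orbit \<mu> c \<gamma> \<longrightarrow>
          (\<exists>x. homoclinic \<mu> c \<gamma> x \<and> collides x earth) \<and>
          (\<exists>x. homoclinic \<mu> c \<gamma> x \<and> collides x moon) \<and>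
          (\<forall>x. homoclinic \<mu> c \<gamma> x \<and> non_collision x \<longrightarrow>
             rotates_once earth \<gamma> x \<and> turns moon \<gamma> x 0 \<or>
             rotates_once moon \<gamma> x \<and> turns earth \<gamma> x 0)))
     \<and>
     (\<forall>c. c_e < c \<and> c < 0 \<longrightarrow>
        (\<exists>\<gamma>. double_collision_orbit \<mu> c \<gamma>) \<and>
        (\<forall>\<gamma>. double_collision_orbit \<mu> c \<gamma> \<longrightarrow>
          (\<forall>x. homoclinic \<mu> c \<gamma> x \<longrightarrow> rotates_around_orbit \<gamma> x) \<and>
          (\<forall>x. homoclinic \<mu> c \<gamma> x \<longrightarrow> non_collision x)))
     \<and>
     (\<forall>c. c_h \<mu> < c \<and> c < 0 \<and> \<mu> \<noteq> 1/2 \<longrightarrow>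
        (\<exists>\<gamma>. exterior_collision_orbit_moon \<mu> c \<gamma>) \<and>
        (\<forall>\<gamma>. exterior_collision_orbit_moon \<mu> c \<gamma> \<longrightarrow>
          (\<exists>x. homoclinic \<mu> c \<gamma> x \<and> collides x earth) \<and>
          (\<forall>x. homoclinic \<mu> c \<gamma> x \<longrightarrow> \<not> collides x moon) \<and>
          (\<forall>x. homoclinic \<mu> c \<gamma> x \<and> non_collision x \<longrightarrow> rotates_once earth \<gamma> x)))"
  apply (rule conjI)
   apply (rule allI, rule impI, erule conjE, rule hyperbolic_part[OF assms], assumption, assumption)
  apply (rule conjI)
   apply (rule allI, rule impI, erule conjE, rule double_collision_part[OF assms], assumption, assumption)
  apply (rule allI, rule impI, elim conjE, rule exterior_part[OF assms(1)])
    apply (use assms(2) in simp)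
   apply assumption+
  done

end
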